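(* Let $E \subset T$. There exists $f \in H^\infty$ whose radial limit exists at exactly the points of $T \setminus E$ (i.e. $\lim_{r\to1^-} f(r\zeta)$ exists for $\zeta \in T\setminus E$ and fails to exist for $\zeta \in E$) if and only if $E$ is a $G_{\delta\sigma}$ subset of $T$ of Lebesgue measure zero.
   Context: $\Delta = \{z \in \mathbb{C} : |z|<1\}$ is the open unit disc and $T = \{|z|=1\}$ is the unit circle. $H^\infty$ denotes the space of bounded analytic functions on $\Delta$. For $f\in H^\infty$ and $\zeta\in T$, the radial limit of $f$ at $\zeta$ is $\lim_{r\to1^-} f(r\zeta)$ (finite). A $G_\delta$ subset of $T$ is a countable intersection of relatively open subsets of $T$; a $G_{\delta\sigma}$ set is a countable union of $G_\delta$ sets. Measure on $T$ is Lebesgue (arc-length) measure. *)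

theory Defs
  imports "HOL-Analysis.Analysis"
begin

definition Hinf :: "(complex \<Rightarrow> complex) set" where
  "Hinf = {f. f holomorphic_on ball 0 1 \<and> bounded (f ` ball 0 1)}"

definition radial_limit_exists :: "(complex \<Rightarrow> complex) \<Rightarrow> complex \<Rightarrow> bool" where
  "radial_limit_exists f z \<longleftrightarrow>
     (\<exists>L. ((\<lambda>r::real. f (complex_of_real r * z)) \<longlongrightarrow> L) (at_left 1))"

definition Gdelta_T :: "complex set \<Rightarrow> bool" where
  "Gdelta_T E \<longleftrightarrow> (\<exists>U :: nat \<Rightarrow> complex set.
      (\<forall>n. openin (top_of_set (sphere 0 1)) (U n)) \<and> E = (\<Inter>n. U n))"

definition Gdelta_sigma_T :: "complex set \<Rightarrow> bool" where
  "Gdelta_sigma_T E \<longleftrightarrow> (\<exists>G :: nat \<Rightarrow> complex set. (\<forall>n. Gdelta_T (G n)) \<and> E = (\<Union>n. G n))"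

definition arc_null :: "complex set \<Rightarrow> bool" where
  "arc_null E \<longleftrightarrow> {t \<in> {0..<2*pi}. cis t \<in> E} \<in> null_sets lebesgue"

end

(*
  Necessity: the set is described by radial oscillations, and it is null by Fatou's theorem. For
  the latter, f is approximated by its Taylor polynomials; the error is controlled on whole radii
  by the L2 maximal inequality.

  Sufficiency: for a null Gdelta set E one builds F with nonnegative real part, Re F -> oo
  radially at the points of E and finite radial limits elsewhere; then exp (i Ln (1 + F)) is
  bounded and spins around 0 exactly along the radii ending in E. Countably many such functions
  are added up with rapidly decreasing coefficients, so that the oscillation of the first
  divergent term cannot be compensated.

  The main difficulty is to control the radial behaviour at EVERY point off E. Suppose
  F = sum G_m with Re G_m = w_m >= 0 on the circle and sup_r |G_m (r s)| <= C w_(m+1) (s). At a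
  point s either sum w_m (s) < oo, and dominated convergence gives a finite radial limit, or
  sum w_m (s) = oo, and then Re F -> oo. Such a sequence is obtained by iterating the radial
  maximal function with small coefficients (the Rubio de Francia device), which converges by the
  maximal inequality. The infinite limits at points off E are then removed by replacing F by
  F / (1 + F), whose limit is 1 there, and by summing over an exhaustion of the complement of E
  by closed sets K_n: the weights carry a factor dist (., K_n), which makes the n-th summand small
  on all radii ending in K_n.
*)
theory Submission
  imports Defs "HOL-Complex_Analysis.Complex_Analysis"
begin

section \<open>An abstract linearised maximal inequality\<close>

text \<open>Almost-everywhere statements decide nothing on a null set, so the construction needs
  bounds at every point of the circle. Hence the building blocks are dilated Herglotz integrals,
  continuous on the closed disc, and their maximal function runs over finitely many radii; uniform
  continuity reaches the others. The exponent is 2 because both estimates of the iteration are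
  elementary there: the maximal inequality follows by duality, without covering arguments, and an
  analytic function is controlled by its real part because the mean of its square is the square of
  its value at 0. The distance factor acts through the kernel \<open>(w + z) / (w - z)\<close>: for
  z on a radius ending in K_n, the distance of w to K_n is at most \<open>2 * norm (w - z)\<close>,
  which cancels the singularity. At a fixed point off K_n it is a positive constant and cannot
  affect the divergence of the series. The spinning function has modulus
  \<open>exp (- Im (Ln (1 + F)))\<close>, bounded above and away from 0 because the argument is
  bounded. So the oscillation on E has a lower bound independent of F, and one ratio of coefficients
  serves all summands.\<close>

lemma ennreal_two_mult_le:
  fixes a b :: ennreal
  shows "2 * (a * b) \<le> a\<^sup>2 + b\<^sup>2"
proof (cases a; cases b)
  fix x y :: real
  assume "0 \<le> x" "a = ennreal x" "0 \<le> y" "b = ennreal y"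
  moreover have "2 * (x * y) \<le> x\<^sup>2 + y\<^sup>2"
    using sum_squares_bound[of x y] by simp
  ultimately show ?thesis
    by (simp add: ennreal_mult[symmetric] ennreal_power ennreal_plus[symmetric] ennreal_leI
        flip: ennreal_numeral del: ennreal_plus)
qed (auto simp: power2_eq_square ennreal_top_mult)

lemma ennreal_two_mult_le_scaled:
  fixes a b c :: ennreal
  shows "2 * (c * (a * b)) \<le> c\<^sup>2 * a\<^sup>2 + b\<^sup>2"
  using ennreal_two_mult_le[of "c * a" b] by (simp add: mult.assoc power_mult_distrib)

text \<open>Finiteness of \<open>x\<close> licenses the cancellation; the boundedness assumptions of
  the maximal inequality below exist to provide it.\<close>

lemma ennreal_absorb:
  fixes x y :: ennreal
  assumes "2 * x \<le> y + x" "x < \<infinity>"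
  shows "x \<le> y"
  using assms by (cases x; cases y) (auto simp: ennreal_plus[symmetric] ennreal_mult[symmetric] 
      simp flip: ennreal_numeral simp del: ennreal_plus)

text \<open>To be applied with \<open>L s t = K (\<kappa> s) s t\<close>, where \<open>\<kappa> s\<close> selects the
  kernel for which the integral against \<open>u\<close> is maximal at \<open>s\<close>. The proof is by duality: the
  assumption \<open>L_quasi\<close> (a substitute for the semigroup property) bounds the composition of the
  operator with its adjoint by the sum of the two, so that the norm can be absorbed.\<close>

lemma linearised_maximal_inequality:
  fixes L :: "'a \<Rightarrow> 'a \<Rightarrow> ennreal" and u :: "'a \<Rightarrow> ennreal"
  assumes "finite_measure M"
    and L[measurable]: "(\<lambda>(s, t). L s t) \<in> borel_measurable (M \<Otimes>\<^sub>M M)"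
    and u[measurable]: "u \<in> borel_measurable M"
    and L_bd: "\<And>s t. s \<in> space M \<Longrightarrow> t \<in> space M \<Longrightarrow> L s t \<le> ennreal c"
    and u_bd: "\<And>t. t \<in> space M \<Longrightarrow> u t \<le> ennreal U"
    and L_int: "\<And>s. s \<in> space M \<Longrightarrow> (\<integral>\<^sup>+t. L s t \<partial>M) \<le> ennreal B"
    and L_quasi: "\<And>s s' t. s \<in> space M \<Longrightarrow> s' \<in> space M \<Longrightarrow> t \<in> space M \<Longrightarrow>
       L s t * L s' t \<le> 4 * (L s s' * L s' t + L s t * L s' s)"
    and B: "B > 0" and c: "c \<ge> 0" and U: "U \<ge> 0"
  shows "(\<integral>\<^sup>+s. (\<integral>\<^sup>+t. L s t * u t \<partial>M)\<^sup>2 \<partial>M) \<le> ennreal ((8 * B)\<^sup>2) * (\<integral>\<^sup>+t. (u t)\<^sup>2 \<partial>M)"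
proof -
  interpret finite_measure M by fact
  interpret P: pair_sigma_finite M M ..
  \<comment> \<open>For the operator T with kernel \<open>L\<close>, \<open>g\<close> is T u and
    \<open>h\<close> is the adjoint of T applied to \<open>g\<close>.\<close>
  define g where "g s = (\<integral>\<^sup>+t. L s t * u t \<partial>M)" for s
  define h where "h t = (\<integral>\<^sup>+s. L s t * g s \<partial>M)" for t
  have [measurable]: "g \<in> borel_measurable M"
    unfolding g_def by measurable
  have [measurable]: "h \<in> borel_measurable M"
    unfolding h_def by measurable
  define m where "m = measure M (space M)"
  have em: "emeasure M (space M) = ennreal m"
    by (simp add: m_def emeasure_eq_measure)
  have const: "(\<integral>\<^sup>+t. f t \<partial>M) \<le> ennreal k * ennreal m"
    if "\<And>t. t \<in> space M \<Longrightarrow> f t \<le> ennreal k" for f k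
  proof -
    have "(\<integral>\<^sup>+t. f t \<partial>M) \<le> (\<integral>\<^sup>+t. ennreal k \<partial>M)"
      by (intro nn_integral_mono that)
    then show ?thesis by (simp add: em)
  qed
  have m0: "m \<ge> 0" by (simp add: m_def)
  \<comment> \<open>These crude bounds in terms of \<open>c\<close>, \<open>U\<close> and the total
    mass only serve to make \<open>X\<close> and \<open>Y\<close> finite; they do not enter the
    final constant.\<close>
  have g_bd: "g s \<le> ennreal (c * U * m)" if "s \<in> space M" for s
  proof -
    have "L s t * u t \<le> ennreal (c * U)" if "t \<in> space M" for t
    proof -
      have "L s t * u t \<le> ennreal c * ennreal U"
        using L_bd u_bd that \<open>s \<in> space M\<close> by (intro mult_mono) auto
      also have "\<dots> = ennreal (c * U)"
        using c U by (rule ennreal_mult[symmetric])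
      finally show ?thesis .
    qed
    from const[OF this] show ?thesis
      using c U by (simp add: g_def m0 ennreal_mult[symmetric])
  qed
  define V where "V = c * U * m"
  have V0: "V \<ge> 0" using c U by (simp add: V_def m0)
  have h_bd: "h t \<le> ennreal (c * V * m)" if "t \<in> space M" for t
  proof -
    have "L s t * g s \<le> ennreal (c * V)" if "s \<in> space M" for s
    proof -
      have "L s t * g s \<le> ennreal c * ennreal V"
        using L_bd g_bd that \<open>t \<in> space M\<close> by (intro mult_mono) (auto simp: V_def)
      also have "\<dots> = ennreal (c * V)"
        using c V0 by (rule ennreal_mult[symmetric])
      finally show ?thesis .
    qed
    from const[OF this] show ?thesis
      using V0 c by (simp add: h_def m0 ennreal_mult[symmetric])
  qed
  define X where "X = (\<integral>\<^sup>+t. (h t)\<^sup>2 \<partial>M)"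
  define Y where "Y = (\<integral>\<^sup>+s. (g s)\<^sup>2 \<partial>M)"
  define W where "W = c * V * m"
  have W0: "W \<ge> 0" using V0 c by (simp add: W_def m0)
  have "X \<le> ennreal (W\<^sup>2) * ennreal m"
    unfolding X_def
    using h_bd by (intro const) (auto simp: W_def[symmetric] ennreal_power[OF W0, symmetric] intro!: power_mono)
  then have Xfin: "X < \<infinity>"
    by (metis ennreal_less_top ennreal_mult_less_top infinity_ennreal_def le_less_trans)
  have "Y \<le> ennreal (V\<^sup>2) * ennreal m"
    unfolding Y_def
    using g_bd by (intro const) (auto simp: V_def[symmetric] ennreal_power[OF V0, symmetric] intro!: power_mono)
  then have Yfin: "Y < \<infinity>"
    by (metis ennreal_less_top ennreal_mult_less_top infinity_ennreal_def le_less_trans)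
  define Z where "Z = (\<integral>\<^sup>+s. g s * h s \<partial>M)"
  \<comment> \<open>Integrating over \<open>t\<close> first costs the row bound \<open>B\<close> and
    leaves the pairing of \<open>g\<close> with \<open>h\<close>, that is \<open>Z\<close>.\<close>
  define I where "I = (\<integral>\<^sup>+s. \<integral>\<^sup>+s'. \<integral>\<^sup>+t. L s s' * L s' t * (g s * g s') \<partial>M \<partial>M \<partial>M)"
  have I_le: "I \<le> ennreal B * Z"
  proof -
    have "I \<le> (\<integral>\<^sup>+s. \<integral>\<^sup>+s'. L s s' * (g s * g s') * ennreal B \<partial>M \<partial>M)"
      unfolding I_def
    proof (intro nn_integral_mono)
      fix s s' assume "s \<in> space M" "s' \<in> space M"
      have "(\<integral>\<^sup>+t. L s s' * L s' t * (g s * g s') \<partial>M) = (\<integral>\<^sup>+t. L s s' * (g s * g s') * L s' t \<partial>M)"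
        by (intro nn_integral_cong) (simp add: mult_ac)
      also have "\<dots> = L s s' * (g s * g s') * (\<integral>\<^sup>+t. L s' t \<partial>M)"
        using \<open>s' \<in> space M\<close> by (intro nn_integral_cmult) measurable
      also have "\<dots> \<le> L s s' * (g s * g s') * ennreal B"
        using L_int[OF \<open>s' \<in> space M\<close>] by (intro mult_left_mono) auto
      finally show "(\<integral>\<^sup>+t. L s s' * L s' t * (g s * g s') \<partial>M) \<le> L s s' * (g s * g s') * ennreal B" .
    qed
    also have "\<dots> = (\<integral>\<^sup>+s'. \<integral>\<^sup>+s. L s s' * (g s * g s') * ennreal B \<partial>M \<partial>M)"
      by (rule P.Fubini') measurable
    also have "\<dots> = (\<integral>\<^sup>+s'. ennreal B * (g s' * h s') \<partial>M)"
    proof (intro nn_integral_cong)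
      fix s' assume [measurable]: "s' \<in> space M"
      have "(\<integral>\<^sup>+s. L s s' * (g s * g s') * ennreal B \<partial>M) = (\<integral>\<^sup>+s. (ennreal B * g s') * (L s s' * g s) \<partial>M)"
        by (intro nn_integral_cong) (simp add: mult_ac)
      also have "\<dots> = (ennreal B * g s') * h s'"
        unfolding h_def by (intro nn_integral_cmult) measurable
      finally show "(\<integral>\<^sup>+s. L s s' * (g s * g s') * ennreal B \<partial>M) = ennreal B * (g s' * h s')"
        by (simp add: mult_ac)
    qed
    also have "\<dots> = ennreal B * Z"
      unfolding Z_def by (intro nn_integral_cmult) measurable
    finally show ?thesis .
  qed
  have "X = (\<integral>\<^sup>+t. \<integral>\<^sup>+s. \<integral>\<^sup>+s'. L s t * L s' t * (g s * g s') \<partial>M \<partial>M \<partial>M)"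
    unfolding X_def
  proof (intro nn_integral_cong)
    fix t assume [measurable]: "t \<in> space M"
    have "(h t)\<^sup>2 = (\<integral>\<^sup>+s. L s t * g s \<partial>M) * h t"
      by (simp add: h_def power2_eq_square)
    also have "\<dots> = (\<integral>\<^sup>+s. L s t * g s * h t \<partial>M)"
      by (rule nn_integral_multc[symmetric]) measurable
    also have "\<dots> = (\<integral>\<^sup>+s. \<integral>\<^sup>+s'. L s t * L s' t * (g s * g s') \<partial>M \<partial>M)"
    proof (intro nn_integral_cong)
      fix s assume [measurable]: "s \<in> space M"
      have "L s t * g s * h t = (\<integral>\<^sup>+s'. L s t * g s * (L s' t * g s') \<partial>M)"
        unfolding h_def by (rule nn_integral_cmult[symmetric]) measurable
      then show "L s t * g s * h t = (\<integral>\<^sup>+s'. L s t * L s' t * (g s * g s') \<partial>M)"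
        by (simp add: mult_ac)
    qed
    finally show "(h t)\<^sup>2 = (\<integral>\<^sup>+s. \<integral>\<^sup>+s'. L s t * L s' t * (g s * g s') \<partial>M \<partial>M)" .
  qed
  \<comment> \<open>After \<open>L_quasi\<close> each of the two summands is a multiple of
    \<open>I\<close>: the first after reordering the integrals, the second after also interchanging
    the names \<open>s\<close> and \<open>s'\<close>.\<close>
  also have "\<dots> \<le> (\<integral>\<^sup>+t. \<integral>\<^sup>+s. \<integral>\<^sup>+s'. (4 * (L s s' * L s' t * (g s * g s')) + 4 * (L s t * L s' s * (g s * g s'))) \<partial>M \<partial>M \<partial>M)"
  proof (intro nn_integral_mono)
    fix t s s' assume "t \<in> space M" "s \<in> space M" "s' \<in> space M"
    then have "L s t * L s' t * (g s * g s') \<le> 4 * (L s s' * L s' t + L s t * L s' s) * (g s * g s')"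
      by (intro mult_right_mono L_quasi) auto
    then show "L s t * L s' t * (g s * g s') \<le> 4 * (L s s' * L s' t * (g s * g s')) + 4 * (L s t * L s' s * (g s * g s'))"
      by (simp add: distrib_left distrib_right mult_ac)
  qed
  also have "\<dots> = (\<integral>\<^sup>+t. \<integral>\<^sup>+s. (\<integral>\<^sup>+s'. 4 * (L s s' * L s' t * (g s * g s')) \<partial>M) + (\<integral>\<^sup>+s'. 4 * (L s t * L s' s * (g s * g s')) \<partial>M) \<partial>M \<partial>M)"
    by (intro nn_integral_cong nn_integral_add) measurable
  also have "\<dots> = (\<integral>\<^sup>+t. (\<integral>\<^sup>+s. (\<integral>\<^sup>+s'. 4 * (L s s' * L s' t * (g s * g s')) \<partial>M) \<partial>M) + (\<integral>\<^sup>+s. (\<integral>\<^sup>+s'. 4 * (L s t * L s' s * (g s * g s')) \<partial>M) \<partial>M) \<partial>M)"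
    by (intro nn_integral_cong nn_integral_add) measurable
  also have "\<dots> = (\<integral>\<^sup>+t. \<integral>\<^sup>+s. \<integral>\<^sup>+s'. 4 * (L s s' * L s' t * (g s * g s')) \<partial>M \<partial>M \<partial>M) + (\<integral>\<^sup>+t. \<integral>\<^sup>+s. \<integral>\<^sup>+s'. 4 * (L s t * L s' s * (g s * g s')) \<partial>M \<partial>M \<partial>M)"
    by (intro nn_integral_add) measurable
  also have "(\<integral>\<^sup>+t. \<integral>\<^sup>+s. \<integral>\<^sup>+s'. 4 * (L s s' * L s' t * (g s * g s')) \<partial>M \<partial>M \<partial>M)
           = (\<integral>\<^sup>+t. \<integral>\<^sup>+s. 4 * (\<integral>\<^sup>+s'. L s s' * L s' t * (g s * g s') \<partial>M) \<partial>M \<partial>M)"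
    by (intro nn_integral_cong nn_integral_cmult) measurable
  also have "\<dots> = (\<integral>\<^sup>+t. 4 * (\<integral>\<^sup>+s. \<integral>\<^sup>+s'. L s s' * L s' t * (g s * g s') \<partial>M \<partial>M) \<partial>M)"
    by (intro nn_integral_cong nn_integral_cmult) measurable
  also have "\<dots> = 4 * (\<integral>\<^sup>+t. \<integral>\<^sup>+s. \<integral>\<^sup>+s'. L s s' * L s' t * (g s * g s') \<partial>M \<partial>M \<partial>M)"
    by (intro nn_integral_cmult) measurable
  also have "(\<integral>\<^sup>+t. \<integral>\<^sup>+s. \<integral>\<^sup>+s'. L s s' * L s' t * (g s * g s') \<partial>M \<partial>M \<partial>M)
      = (\<integral>\<^sup>+s. \<integral>\<^sup>+t. \<integral>\<^sup>+s'. L s s' * L s' t * (g s * g s') \<partial>M \<partial>M \<partial>M)"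
    by (rule P.Fubini') measurable
  also have "\<dots> = I"
    unfolding I_def by (intro nn_integral_cong P.Fubini') measurable
  also have "(\<integral>\<^sup>+t. \<integral>\<^sup>+s. \<integral>\<^sup>+s'. 4 * (L s t * L s' s * (g s * g s')) \<partial>M \<partial>M \<partial>M)
           = (\<integral>\<^sup>+t. \<integral>\<^sup>+s. 4 * (\<integral>\<^sup>+s'. L s t * L s' s * (g s * g s') \<partial>M) \<partial>M \<partial>M)"
    by (intro nn_integral_cong nn_integral_cmult) measurable
  also have "\<dots> = (\<integral>\<^sup>+t. 4 * (\<integral>\<^sup>+s. \<integral>\<^sup>+s'. L s t * L s' s * (g s * g s') \<partial>M \<partial>M) \<partial>M)"
    by (intro nn_integral_cong nn_integral_cmult) measurable
  also have "\<dots> = 4 * (\<integral>\<^sup>+t. \<integral>\<^sup>+s. \<integral>\<^sup>+s'. L s t * L s' s * (g s * g s') \<partial>M \<partial>M \<partial>M)"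
    by (intro nn_integral_cmult) measurable
  also have "(\<integral>\<^sup>+t. \<integral>\<^sup>+s. \<integral>\<^sup>+s'. L s t * L s' s * (g s * g s') \<partial>M \<partial>M \<partial>M)
      = (\<integral>\<^sup>+t. \<integral>\<^sup>+s'. \<integral>\<^sup>+s. L s t * L s' s * (g s * g s') \<partial>M \<partial>M \<partial>M)"
    by (intro nn_integral_cong P.Fubini') measurable
  also have "\<dots> = (\<integral>\<^sup>+s'. \<integral>\<^sup>+t. \<integral>\<^sup>+s. L s t * L s' s * (g s * g s') \<partial>M \<partial>M \<partial>M)"
    by (rule P.Fubini') measurable
  also have "\<dots> = (\<integral>\<^sup>+s'. \<integral>\<^sup>+s. \<integral>\<^sup>+t. L s t * L s' s * (g s * g s') \<partial>M \<partial>M \<partial>M)"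
    by (intro nn_integral_cong P.Fubini') measurable
  also have "\<dots> = I"
    unfolding I_def by (intro nn_integral_cong) (simp add: mult_ac)
  also have "4 * I + 4 * I = 8 * I"
    by (simp flip: distrib_right)
  finally have "X \<le> 8 * I" .
  also have "\<dots> \<le> 8 * (ennreal B * Z)"
    using I_le by (intro mult_left_mono) auto
  also have "\<dots> = ennreal (8 * B) * Z"
    using B by (simp add: ennreal_mult mult.assoc)
  finally have X_le: "X \<le> ennreal (8 * B) * Z" .
  have sq: "(ennreal (8 * B))\<^sup>2 = ennreal ((8 * B)\<^sup>2)"
    using B by (simp add: ennreal_power)
  have young: "2 * (ennreal k * (\<integral>\<^sup>+s. a s * b s \<partial>M)) \<le> (ennreal k)\<^sup>2 * (\<integral>\<^sup>+s. (a s)\<^sup>2 \<partial>M) + (\<integral>\<^sup>+s. (b s)\<^sup>2 \<partial>M)"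
    if [measurable]: "a \<in> borel_measurable M" "b \<in> borel_measurable M" for a b k
  proof -
    have "2 * (ennreal k * (\<integral>\<^sup>+s. a s * b s \<partial>M)) = (\<integral>\<^sup>+s. 2 * (ennreal k * (a s * b s)) \<partial>M)"
      by (simp add: nn_integral_cmult)
    also have "\<dots> \<le> (\<integral>\<^sup>+s. (ennreal k)\<^sup>2 * (a s)\<^sup>2 + (b s)\<^sup>2 \<partial>M)"
      by (intro nn_integral_mono ennreal_two_mult_le_scaled)
    also have "\<dots> = (ennreal k)\<^sup>2 * (\<integral>\<^sup>+s. (a s)\<^sup>2 \<partial>M) + (\<integral>\<^sup>+s. (b s)\<^sup>2 \<partial>M)"
      by (simp add: nn_integral_add nn_integral_cmult)
    finally show ?thesis .
  qed
  \<comment> \<open>Young's inequality leaves a single \<open>X\<close> on the right, which is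
    absorbed: the adjoint has norm at most \<open>8 * B\<close> on \<open>g\<close>.\<close>
  have "2 * X \<le> 2 * (ennreal (8 * B) * Z)"
    using X_le by (intro mult_left_mono) auto
  also have "\<dots> \<le> (ennreal (8 * B))\<^sup>2 * Y + X"
    unfolding Z_def X_def Y_def by (rule young) measurable
  finally have X_le_Y: "X \<le> ennreal ((8 * B)\<^sup>2) * Y"
    using ennreal_absorb Xfin by (simp only: sq)
  \<comment> \<open>Duality: the squared norm of T u is the pairing of \<open>u\<close> with the
    adjoint applied to T u.\<close>
  have Y_eq: "Y = (\<integral>\<^sup>+t. u t * h t \<partial>M)"
  proof -
    have "Y = (\<integral>\<^sup>+s. \<integral>\<^sup>+t. L s t * u t * g s \<partial>M \<partial>M)"
      unfolding Y_def
    proof (intro nn_integral_cong)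
      fix s assume [measurable]: "s \<in> space M"
      have "(g s)\<^sup>2 = (\<integral>\<^sup>+t. L s t * u t \<partial>M) * g s"
        by (simp add: g_def power2_eq_square)
      also have "\<dots> = (\<integral>\<^sup>+t. L s t * u t * g s \<partial>M)"
        by (rule nn_integral_multc[symmetric]) measurable
      finally show "(g s)\<^sup>2 = (\<integral>\<^sup>+t. L s t * u t * g s \<partial>M)" .
    qed
    also have "\<dots> = (\<integral>\<^sup>+t. \<integral>\<^sup>+s. L s t * u t * g s \<partial>M \<partial>M)"
      by (rule P.Fubini') measurable
    also have "\<dots> = (\<integral>\<^sup>+t. u t * h t \<partial>M)"
    proof (intro nn_integral_cong)
      fix t assume [measurable]: "t \<in> space M"
      have "(\<integral>\<^sup>+s. L s t * u t * g s \<partial>M) = (\<integral>\<^sup>+s. u t * (L s t * g s) \<partial>M)"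
        by (intro nn_integral_cong) (simp add: mult_ac)
      also have "\<dots> = u t * h t"
        unfolding h_def by (intro nn_integral_cmult) measurable
      finally show "(\<integral>\<^sup>+s. L s t * u t * g s \<partial>M) = u t * h t" .
    qed
    finally show ?thesis .
  qed
  \<comment> \<open>With this weight in Young's inequality, \<open>X_le_Y\<close> bounds the term
    \<open>X\<close> by \<open>k * Y\<close>, half of the left-hand side, so it can be absorbed
    again.\<close>
  define k where "k = (8 * B)\<^sup>2"
  have k: "k > 0" using B by (simp add: k_def)
  have "2 * (ennreal k * Y) \<le> (ennreal k)\<^sup>2 * (\<integral>\<^sup>+t. (u t)\<^sup>2 \<partial>M) + X"
    unfolding Y_eq X_def by (rule young) measurable
  also have "\<dots> \<le> (ennreal k)\<^sup>2 * (\<integral>\<^sup>+t. (u t)\<^sup>2 \<partial>M) + ennreal k * Y"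
    using X_le_Y by (intro add_left_mono) (simp add: k_def)
  finally have young_Y: "2 * (ennreal k * Y) \<le> (ennreal k)\<^sup>2 * (\<integral>\<^sup>+t. (u t)\<^sup>2 \<partial>M) + ennreal k * Y" .
  have "ennreal k * Y < \<infinity>"
    using Yfin by (metis ennreal_less_top ennreal_mult_less_top infinity_ennreal_def)
  with young_Y have "ennreal k * Y \<le> (ennreal k)\<^sup>2 * (\<integral>\<^sup>+t. (u t)\<^sup>2 \<partial>M)"
    by (rule ennreal_absorb)
  then have "ennreal k * Y \<le> ennreal k * (ennreal k * (\<integral>\<^sup>+t. (u t)\<^sup>2 \<partial>M))"
    by (simp add: power2_eq_square mult.assoc)
  then have "Y \<le> ennreal k * (\<integral>\<^sup>+t. (u t)\<^sup>2 \<partial>M)"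
    using k by (subst (asm) ennreal_mult_le_mult_iff) auto
  then show ?thesis
    by (simp add: Y_def g_def k_def)
qed

section \<open>Arc length and the Poisson kernel\<close>

text \<open>Arc length with total mass \<open>2 * pi\<close>, as a push-forward whose whole space is
  the circle, so that continuity on the circle already gives measurability. The closed parameter
  interval is that of contour integrals; it hits the point 1 twice, which costs nothing as single
  points have measure zero.\<close>

definition circ :: "complex measure" where
  "circ = distr (restrict_space lborel {0..2*pi}) (restrict_space borel (sphere 0 1)) cis"

lemma space_circ [simp]: "space circ = sphere 0 1"
  by (simp add: circ_def space_restrict_space)

lemma sets_circ: "sets circ = sets (restrict_space borel (sphere 0 1))"
  by (simp add: circ_def)

lemma cis_measurable_circ:
  "cis \<in> restrict_space lborel {0..2*pi} \<rightarrow>\<^sub>M restrict_space borel (sphere 0 1)"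
proof (rule measurable_restrict_space2)
  have "cis \<in> borel_measurable lborel"
    by (simp add: borel_measurable_continuous_onI continuous_on_cis)
  then show "cis \<in> restrict_space lborel {0..2*pi} \<rightarrow>\<^sub>M borel"
    by (rule measurable_restrict_space1)
qed auto

lemma emeasure_circ: "emeasure circ (sphere 0 1) = ennreal (2 * pi)"
proof -
  have "emeasure circ (sphere 0 1) = emeasure (restrict_space lborel {0..2*pi}) (cis -` sphere 0 1 \<inter> {0..2*pi})"
    unfolding circ_def using cis_measurable_circ
    by (subst emeasure_distr) (simp_all add: space_restrict_space sets.top[of "restrict_space borel (sphere 0 1)", simplified space_restrict_space, simplified])
  also have "cis -` sphere 0 1 \<inter> {0..2*pi} = {0..2*pi}" by auto
  also have "emeasure (restrict_space lborel {0..2*pi}) {0..2*pi} = ennreal (2 * pi)"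
    by (subst emeasure_restrict_space) auto
  finally show ?thesis .
qed

interpretation circ: finite_measure circ
  by standard (simp add: emeasure_circ)

lemma measure_circ [simp]: "measure circ (sphere 0 1) = 2 * pi"
  by (simp add: measure_def emeasure_circ)

lemma measurable_circI:
  assumes "continuous_on (sphere 0 1) f"
  shows "f \<in> borel_measurable circ"
  using borel_measurable_continuous_on_restrict[OF assms]
  by (simp cong: measurable_cong_sets add: sets_circ)

lemma measurable_circ_ident [measurable]: "(\<lambda>x. x) \<in> borel_measurable circ"
  by (intro measurable_circI continuous_intros)

lemma integrable_circ:
  fixes f :: "complex \<Rightarrow> 'b::{banach, second_countable_topology}"
  assumes "continuous_on (sphere 0 1) f"
  shows "integrable circ f"
proof -
  have "compact (f ` sphere 0 1)"
    by (intro compact_continuous_image assms) simp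
  then have "bounded (f ` sphere 0 1)"
    by (rule compact_imp_bounded)
  then obtain B where B: "\<forall>x\<in>sphere 0 1. norm (f x) \<le> B"
    unfolding bounded_iff by blast
  show ?thesis
  proof (rule circ.integrable_const_bound)
    show "AE x in circ. norm (f x) \<le> B"
      using B by (intro AE_I2) simp
    show "f \<in> borel_measurable circ"
      by (rule measurable_circI[OF assms])
  qed
qed

lemma has_integral_circ:
  fixes f :: "complex \<Rightarrow> 'b::euclidean_space"
  assumes "continuous_on (sphere 0 1) f"
  shows "((\<lambda>t. f (cis t)) has_integral (LINT w|circ. f w)) {0..2*pi}"
proof -
  have *: "continuous_on {0..2*pi} (\<lambda>t. f (cis t))"
    by (rule continuous_on_compose2[OF assms]) (auto intro!: continuous_intros)
  have f: "f \<in> borel_measurable (restrict_space borel (sphere 0 1))"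
    using measurable_circI[OF assms] by (simp cong: measurable_cong_sets add: sets_circ)
  have "(LINT w|circ. f w) = (LINT t|restrict_space lborel {0..2*pi}. f (cis t))"
    unfolding circ_def by (rule integral_distr[OF cis_measurable_circ f])
  also have "\<dots> = (LINT t:{0..2*pi}|lborel. f (cis t))"
    by (subst integral_restrict_space) (auto simp: set_lebesgue_integral_def)
  finally have eq: "(LINT w|circ. f w) = (LINT t:{0..2*pi}|lborel. f (cis t))" .
  have "set_integrable lborel {0..2*pi} (\<lambda>t. f (cis t))"
    unfolding set_integrable_def by (intro borel_integrable_compact *) auto
  then show ?thesis
    unfolding eq by (simp add: has_integral_iff set_borel_integral_eq_integral)
qed

text \<open>On the circle dw = i w dt, so the Cauchy kernel with respect to arc length carries an
  extra factor \<open>w\<close>.\<close>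

lemma circ_Cauchy:
  assumes "continuous_on (cball 0 1) f" "f holomorphic_on ball 0 1" "norm z < 1"
  shows "(LINT w|circ. f w * (w / (w - z))) = 2 * of_real pi * f z"
proof -
  have "((\<lambda>u. f u / (u - z)) has_contour_integral 2 * of_real pi * \<i> * f z) (part_circlepath 0 1 0 (2*pi))"
    using Cauchy_integral_circlepath[OF assms(1,2), of z] assms(3) by (simp add: circlepath_def)
  then have "((\<lambda>t. f (cis t) / (cis t - z) * \<i> * cis t) has_integral 2 * of_real pi * \<i> * f z) {0..2*pi}"
    by (subst (asm) has_contour_integral_part_circlepath_iff) auto
  from has_integral_mult_right[OF this, of "-\<i>"]
  have 1: "((\<lambda>t. f (cis t) * (cis t / (cis t - z))) has_integral 2 * of_real pi * f z) {0..2*pi}"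
    by (simp add: mult_ac)
  have "continuous_on (sphere 0 1) (\<lambda>w. f w * (w / (w - z)))"
    using assms(3) by (auto intro!: continuous_intros continuous_on_subset[OF assms(1)])
  from has_integral_circ[OF this] 1 show ?thesis
    by (rule has_integral_unique)
qed

text \<open>Without the factor 1 / (2 pi): the integral over \<open>circ\<close> is
  \<open>2 * pi\<close>.\<close>

definition poisson :: "complex \<Rightarrow> complex \<Rightarrow> real" where
  "poisson z w = (1 - (norm z)\<^sup>2) / (norm (w - z))\<^sup>2"

text \<open>The first summand is the Cauchy kernel with respect to arc length. The second is
  holomorphic in \<open>w\<close> on the closed disc and vanishes at 0, so it contributes nothing
  when integrated against an analytic function.\<close>

lemma poisson_eq:
  assumes "norm w = 1" "norm z < 1"
  shows "complex_of_real (poisson z w) = w / (w - z) + cnj z * w / (1 - cnj z * w)"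
proof -
  define a where "a = cnj z * w"
  have ww: "w * cnj w = 1"
    using assms(1) by (simp add: complex_norm_square[symmetric])
  have w0: "w \<noteq> 0" using assms(1) by auto
  have na: "norm a = norm z"
    using assms by (simp add: a_def norm_mult)
  have a1: "1 - a \<noteq> 0" "1 - cnj a \<noteq> 0"
    using assms(2) na by (auto dest: arg_cong[of _ _ norm])
  have e1: "w - z = w * (1 - cnj a)"
    using ww by (simp add: a_def algebra_simps)
  have "norm (w - z) = norm (1 - cnj a)"
    using e1 assms(1) by (simp add: norm_mult)
  then have e2: "complex_of_real ((norm (w - z))\<^sup>2) = (1 - cnj a) * (1 - a)"
    using complex_norm_square[of "1 - cnj a"] by simp
  have e3: "complex_of_real (1 - (norm z)\<^sup>2) = 1 - a * cnj a"
    unfolding na[symmetric] using complex_norm_square[of a] by simp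
  have "w / (w - z) = 1 / (1 - cnj a)"
    unfolding e1 using w0 by simp
  moreover have "complex_of_real (poisson z w) = (1 - a * cnj a) / ((1 - cnj a) * (1 - a))"
    unfolding poisson_def of_real_divide e2 e3 ..
  moreover have "\<dots> = 1 / (1 - cnj a) + a / (1 - a)"
    using a1 by (simp add: field_simps)
  ultimately show ?thesis
    by (simp add: a_def)
qed

lemma continuous_on_poisson [continuous_intros]:
  assumes "norm z < 1"
  shows "continuous_on (sphere 0 1) (poisson z)"
  unfolding poisson_def using assms by (auto intro!: continuous_intros)

lemma poisson_nonneg: "norm z < 1 \<Longrightarrow> poisson z w \<ge> 0"
  unfolding poisson_def by (intro divide_nonneg_nonneg) (auto simp: abs_square_le_1)

lemma circ_Poisson:
  assumes "continuous_on (cball 0 1) f" "f holomorphic_on ball 0 1" "norm z < 1"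
  shows "(LINT w|circ. f w * of_real (poisson z w)) = 2 * of_real pi * f z"
proof -
  have nz: "1 - cnj z * w \<noteq> 0" if "norm w \<le> 1" for w
  proof
    assume "1 - cnj z * w = 0"
    then have "norm (cnj z * w) = 1" by (metis eq_iff_diff_eq_0 norm_one)
    moreover have "norm (cnj z * w) \<le> norm z * 1"
      unfolding norm_mult using that by (intro mult_mono) auto
    ultimately show False using assms(3) by simp
  qed
  have cf: "continuous_on (sphere 0 1) f"
    using assms(1) continuous_on_subset by fastforce
  define g where "g w = f w * (cnj z * w / (1 - cnj z * w))" for w
  have cg: "continuous_on (cball 0 1) g"
    unfolding g_def using nz by (auto intro!: continuous_intros assms(1))
  have hg: "g holomorphic_on ball 0 1"
    unfolding g_def using nz by (auto intro!: holomorphic_intros assms(2))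
  \<comment> \<open>The inserted factor equals 1 on the circle and turns a plain mean into Cauchy's
    formula at 0; the same device recurs below.\<close>
  have "(LINT w|circ. g w) = (LINT w|circ. g w * (w / (w - 0)))"
    by (intro Bochner_Integration.integral_cong) auto
  also have "\<dots> = 0"
    using circ_Cauchy[OF cg hg, of 0] by (simp add: g_def)
  finally have g0: "(LINT w|circ. g w) = 0" .
  have "(LINT w|circ. f w * of_real (poisson z w)) = (LINT w|circ. f w * (w / (w - z)) + g w)"
    using assms(3) by (intro Bochner_Integration.integral_cong) (auto simp: poisson_eq g_def algebra_simps)
  also have "\<dots> = (LINT w|circ. f w * (w / (w - z))) + (LINT w|circ. g w)"
    using assms(3) cf nz by (intro Bochner_Integration.integral_add integrable_circ)
        (auto simp: g_def intro!: continuous_intros)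
  also have "\<dots> = 2 * of_real pi * f z"
    using circ_Cauchy[OF assms] g0 by simp
  finally show ?thesis .
qed

lemma integral_poisson:
  assumes "norm z < 1"
  shows "(LINT w|circ. poisson z w) = 2 * pi"
proof -
  have "complex_of_real (LINT w|circ. poisson z w) = (LINT w|circ. of_real (poisson z w))"
    by (rule integral_complex_of_real[symmetric])
  also have "\<dots> = 2 * of_real pi"
    using circ_Poisson[of "\<lambda>_. 1" z] assms by (simp add: holomorphic_on_const)
  finally show ?thesis
    by (metis of_real_eq_iff of_real_mult of_real_numeral)
qed

text \<open>Comparable with the Poisson kernel for \<open>e = 1 - r\<close>, but symmetric and monotone in the
  distance, which makes \<open>qkernel_quasi\<close> elementary.\<close>

definition qkernel :: "real \<Rightarrow> complex \<Rightarrow> complex \<Rightarrow> real" where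
  "qkernel e s t = e / (e + norm (s - t))\<^sup>2"

lemma qkernel_nonneg: "e > 0 \<Longrightarrow> qkernel e s t \<ge> 0"
  by (simp add: qkernel_def)

lemma qkernel_le: "e > 0 \<Longrightarrow> qkernel e s t \<le> 1 / e"
proof -
  assume e: "e > 0"
  have "0 < e + norm (s - t)"
    using e by (rule add_pos_nonneg) simp
  then have "e / (e + norm (s - t))\<^sup>2 \<le> e / e\<^sup>2"
    using e by (intro divide_left_mono power_mono mult_pos_pos zero_less_power) auto
  then show ?thesis
    using e by (simp add: qkernel_def power2_eq_square)
qed

text \<open>The assumption gives \<open>e + norm (s - s') \<le> 2 * (e + norm (s - t))\<close>;
  squaring produces the 4.\<close>

lemma qkernel_le_far:
  assumes "e > 0" "norm (s - s') \<le> 2 * norm (s - t)"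
  shows "qkernel e s t \<le> 4 * qkernel e s s'"
proof -
  have "(e + norm (s - s'))\<^sup>2 \<le> (2 * (e + norm (s - t)))\<^sup>2"
    using assms by (intro power_mono) auto
  also have "\<dots> = 4 * (e + norm (s - t))\<^sup>2"
    by (simp only: power_mult_distrib) simp
  finally have "e * (e + norm (s - s'))\<^sup>2 \<le> e * (4 * (e + norm (s - t))\<^sup>2)"
    using assms(1) by (intro mult_left_mono) auto
  moreover have "e + norm (s - s') > 0" "e + norm (s - t) > 0"
    using assms(1) by (auto simp: add_pos_nonneg)
  ultimately show ?thesis
    by (simp add: qkernel_def divide_simps mult_ac)
qed

text \<open>By the triangle inequality one of the distances from \<open>t\<close> to
  \<open>s\<close> and to \<open>s'\<close> is at least half the distance between \<open>s\<close>
  and \<open>s'\<close>. In the corresponding kernel \<open>t\<close> may be replaced by the other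
  centre, and the two cases yield the two summands.\<close>

lemma qkernel_quasi:
  assumes "e > 0" "e' > 0"
  shows "qkernel e s t * qkernel e' s' t
     \<le> 4 * (qkernel e s s' * qkernel e' s' t + qkernel e s t * qkernel e' s' s)"
proof -
  have "norm (s - s') \<le> norm (s - t) + norm (s' - t)"
    using norm_triangle_ineq4[of "s - t" "s' - t"] by simp
  then consider "norm (s - s') \<le> 2 * norm (s - t)" | "norm (s' - s) \<le> 2 * norm (s' - t)"
    by (fastforce simp: norm_minus_commute)
  then show ?thesis
  proof cases
    case 1
    have "qkernel e s t * qkernel e' s' t \<le> 4 * qkernel e s s' * qkernel e' s' t"
      using qkernel_le_far[OF assms(1) 1] assms(2) by (intro mult_right_mono qkernel_nonneg)
    moreover have "qkernel e s t * qkernel e' s' s \<ge> 0"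
      using assms by (simp add: qkernel_nonneg)
    ultimately show ?thesis by (simp add: algebra_simps)
  next
    case 2
    have "qkernel e s t * qkernel e' s' t \<le> qkernel e s t * (4 * qkernel e' s' s)"
      using qkernel_le_far[OF assms(2) 2] assms(1) by (intro mult_left_mono qkernel_nonneg)
    moreover have "qkernel e s s' * qkernel e' s' t \<ge> 0"
      using assms by (simp add: qkernel_nonneg)
    ultimately show ?thesis by (simp add: algebra_simps)
  qed
qed

lemma norm_radius_le:
  fixes s :: complex
  assumes "norm s = 1" "0 \<le> r" "r \<le> 1"
  shows "norm (of_real r * s - s) = 1 - r"
proof -
  have "of_real r * s - s = of_real (r - 1) * s" by (simp add: algebra_simps)
  then show ?thesis using assms by (simp only: norm_mult norm_of_real) simp
qed

text \<open>Put e = 1 - r and let d be the distance from r s to t. Then d <= e + |s - t| <= 3 d,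
  while 1 - r^2 = e (1 + r) lies between e and 2 e. Hence 18 = 2 * 3^2.\<close>

lemma poisson_qkernel:
  assumes "norm s = 1" "norm t = 1" "0 \<le> r" "r < 1"
  shows "qkernel (1 - r) s t \<le> poisson (of_real r * s) t"
    and "poisson (of_real r * s) t \<le> 18 * qkernel (1 - r) s t"
proof -
  define e where "e = 1 - r"
  define d where "d = norm (t - of_real r * s)"
  define q where "q = norm (s - t)"
  have e: "e > 0" "e \<le> 1" using assms by (auto simp: e_def)
  have n: "norm (of_real r * s) = r" using assms by (simp add: norm_mult)
  have re: "norm (of_real r * s - s) = e"
    using norm_radius_le assms by (simp add: e_def)
  have de: "e \<le> d"
    using norm_triangle_ineq2[of t "of_real r * s"] n assms by (simp add: d_def e_def)
  have dq: "d \<le> e + q"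
    using norm_triangle_ineq[of "t - s" "s - of_real r * s"] re
    by (simp add: d_def q_def norm_minus_commute)
  have "q \<le> e + d"
    using norm_triangle_ineq[of "s - of_real r * s" "of_real r * s - t"] re
    by (simp add: d_def q_def norm_minus_commute)
  then have qd: "e + q \<le> 3 * d" using de by simp
  have d0: "d > 0" and eq0: "e + q > 0"
    using de e by (auto simp: q_def add_pos_nonneg)
  have P: "poisson (of_real r * s) t = e * (1 + r) / d\<^sup>2"
    unfolding poisson_def n d_def e_def by (simp add: power2_eq_square algebra_simps)
  have Q: "qkernel (1 - r) s t = e / (e + q)\<^sup>2"
    by (simp add: qkernel_def e_def q_def)
  have "e / (e + q)\<^sup>2 \<le> e / d\<^sup>2"
    using dq e d0 by (intro divide_left_mono power_mono) auto
  also have "\<dots> \<le> e * (1 + r) / d\<^sup>2"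
    using e assms(3) by (intro divide_right_mono) auto
  finally show "qkernel (1 - r) s t \<le> poisson (of_real r * s) t"
    by (simp add: P Q)
  have "(e + q)\<^sup>2 \<le> (3 * d)\<^sup>2"
    using qd eq0 by (intro power_mono) auto
  then have "e * (1 + r) * (e + q)\<^sup>2 \<le> e * 2 * (3 * d)\<^sup>2"
    using e assms by (intro mult_mono) auto
  then have "e * (1 + r) / d\<^sup>2 \<le> 18 * (e / (e + q)\<^sup>2)"
    using d0 eq0 by (simp add: divide_simps power_mult_distrib mult_ac)
  then show "poisson (of_real r * s) t \<le> 18 * qkernel (1 - r) s t"
    by (simp add: P Q)
qed

section \<open>The radial maximal inequality\<close>

lemma nn_integral_circ:
  assumes "continuous_on (sphere 0 1) f" "\<And>w. w \<in> sphere 0 1 \<Longrightarrow> f w \<ge> 0"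
  shows "(\<integral>\<^sup>+w. ennreal (f w) \<partial>circ) = ennreal (LINT w|circ. f w)"
  using assms by (intro nn_integral_eq_integral integrable_circ AE_I2) auto

lemma integral_circ_mono:
  fixes f g :: "complex \<Rightarrow> real"
  assumes "continuous_on (sphere 0 1) f" "continuous_on (sphere 0 1) g"
    and "\<And>w. norm w = 1 \<Longrightarrow> f w \<le> g w"
  shows "(LINT w|circ. f w) \<le> (LINT w|circ. g w)"
  using assms by (intro integral_mono integrable_circ) auto

lemma integral_circ_nonneg:
  fixes f :: "complex \<Rightarrow> real"
  assumes "\<And>w. norm w = 1 \<Longrightarrow> 0 \<le> f w"
  shows "0 \<le> (LINT w|circ. f w)"
  using assms by (intro Bochner_Integration.integral_nonneg_AE AE_I2) auto

lemma radial_in_ball: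
  fixes s :: complex
  shows "norm s = 1 \<Longrightarrow> 0 \<le> r \<Longrightarrow> r < 1 \<Longrightarrow> norm (of_real r * s) < 1"
  by (simp add: norm_mult)

lemma continuous_on_Max_fun:
  fixes h :: "nat \<Rightarrow> 'a::topological_space \<Rightarrow> real"
  assumes "\<And>k. k \<le> N \<Longrightarrow> continuous_on S (h k)"
  shows "continuous_on S (\<lambda>s. MAX k\<in>{..N}. h k s)"
  using assms
proof (induction N)
  case (Suc N)
  have "(MAX k\<in>{..Suc N}. h k s) = max (h (Suc N) s) (MAX k\<in>{..N}. h k s)" for s
    by (simp add: atMost_Suc)
  then show ?case
    using Suc by (auto intro!: continuous_intros)
qed simp

lemma norm_le_qkernel_integral:
  assumes "continuous_on (cball 0 1) f" "f holomorphic_on ball 0 1"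
    and "norm s = 1" "0 \<le> r" "r < 1"
  shows "2 * pi * norm (f (of_real r * s)) \<le> 18 * (LINT t|circ. qkernel (1 - r) s t * norm (f t))"
proof -
  have rs: "norm (of_real r * s) < 1"
    using assms by (simp add: radial_in_ball)
  have cf: "continuous_on (sphere 0 1) f"
    using assms(1) continuous_on_subset by fastforce
  have "2 * pi * norm (f (of_real r * s)) = norm (2 * of_real pi * f (of_real r * s))"
    by (simp add: norm_mult)
  also have "\<dots> = norm (LINT w|circ. f w * of_real (poisson (of_real r * s) w))"
    by (simp add: circ_Poisson[OF assms(1,2) rs])
  also have "\<dots> \<le> (LINT w|circ. norm (f w * of_real (poisson (of_real r * s) w)))"
    by simp
  also have "\<dots> \<le> (LINT w|circ. 18 * (qkernel (1 - r) s w * norm (f w)))"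
  proof (rule integral_circ_mono)
    show "continuous_on (sphere 0 1) (\<lambda>w. norm (f w * of_real (poisson (of_real r * s) w)))"
      by (intro continuous_intros cf rs)
    have "1 - r + norm (s - w) \<noteq> 0" for w
      using assms(5) norm_ge_zero[of "s - w"] by linarith
    then show "continuous_on (sphere 0 1) (\<lambda>w. 18 * (qkernel (1 - r) s w * norm (f w)))"
      unfolding qkernel_def by (intro continuous_intros cf) auto
    fix w :: complex assume w: "norm w = 1"
    have "norm (f w) * poisson (of_real r * s) w \<le> norm (f w) * (18 * qkernel (1 - r) s w)"
      using poisson_qkernel(2)[OF assms(3) w assms(4,5)] by (intro mult_left_mono) auto
    then show "norm (f w * of_real (poisson (of_real r * s) w)) \<le> 18 * (qkernel (1 - r) s w * norm (f w))"
      using poisson_nonneg[OF rs] by (simp add: norm_mult mult_ac)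
  qed
  finally show ?thesis by simp
qed

text \<open>The constant is independent of the number and position of the radii, so arbitrarily fine
  sets of radii are allowed. It is 144^2, the quotient of (16 pi)^2 from the linearised inequality
  by (pi / 9)^2 from the comparison of the kernels.\<close>

theorem radial_maximal_inequality:
  fixes N :: nat and \<rho> :: "nat \<Rightarrow> real"
  assumes "continuous_on (cball 0 1) f" "f holomorphic_on ball 0 1"
    and \<rho>: "\<And>k. k \<le> N \<Longrightarrow> 0 \<le> \<rho> k \<and> \<rho> k < 1"
  shows "(LINT s|circ. (MAX k\<in>{..N}. norm (f (of_real (\<rho> k) * s)))\<^sup>2)
       \<le> 20736 * (LINT w|circ. (norm (f w))\<^sup>2)"
proof -
  define h where "h k s = norm (f (of_real (\<rho> k) * s))" for k s
  define X where "X s = (MAX k\<in>{..N}. h k s)" for s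
  have cf: "continuous_on (sphere 0 1) f"
    using assms(1) continuous_on_subset by fastforce
  have ch: "continuous_on (sphere 0 1) (h k)" if "k \<le> N" for k
  proof -
    have "norm (of_real (\<rho> k) * s) \<le> 1" if "norm s = 1" for s :: complex
      using \<rho>[OF \<open>k \<le> N\<close>] that by (simp add: norm_mult)
    then show ?thesis
      unfolding h_def
      by (intro continuous_intros continuous_on_compose2[OF assms(1)]) auto
  qed
  have cX: "continuous_on (sphere 0 1) X"
    unfolding X_def by (rule continuous_on_Max_fun) (rule ch)
  \<comment> \<open>Choosing the least maximising index makes the selection measurable.\<close>
  define \<kappa> where "\<kappa> s = (LEAST k. k \<le> N \<and> h k s = X s)" for s
  have \<kappa>: "\<kappa> s \<le> N" "h (\<kappa> s) s = X s" for s
  proof -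
    have "X s \<in> (\<lambda>k. h k s) ` {..N}"
      unfolding X_def by (rule Max_in) auto
    then have "\<exists>k. k \<le> N \<and> h k s = X s" by auto
    from LeastI_ex[OF this] show "\<kappa> s \<le> N" "h (\<kappa> s) s = X s"
      unfolding \<kappa>_def by auto
  qed
  have [measurable]: "\<kappa> \<in> measurable circ (count_space UNIV)"
    unfolding \<kappa>_def
  proof (rule measurable_Least)
    fix k show "Measurable.pred circ (\<lambda>s. k \<le> N \<and> h k s = X s)"
    proof (cases "k \<le> N")
      case True
      then have [measurable]: "h k \<in> borel_measurable circ" "X \<in> borel_measurable circ"
        by (auto intro!: measurable_circI ch cX)
      show ?thesis by measurable
    qed simp
  qed
  define e where "e s = 1 - \<rho> (\<kappa> s)" for s
  have [measurable]: "e \<in> borel_measurable circ"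
    unfolding e_def by measurable
  have e: "e s > 0" for s
    using \<rho>[OF \<kappa>(1)[of s]] by (simp add: e_def)
  \<comment> \<open>This pointwise bound of the kernel depends on the radii, but it enters the
    linearised inequality only through finiteness.\<close>
  define c where "c = (\<Sum>k\<le>N. 1 / (1 - \<rho> k))"
  have c0: "c \<ge> 0"
    unfolding c_def using \<rho> by (intro sum_nonneg) (auto simp: less_imp_le)
  define L where "L s t = ennreal (qkernel (e s) s t)" for s t
  have [measurable]: "(\<lambda>(s, t). L s t) \<in> borel_measurable (circ \<Otimes>\<^sub>M circ)"
    unfolding L_def qkernel_def by measurable
  have "bounded (f ` cball 0 1)"
    by (intro compact_imp_bounded compact_continuous_image assms) simp
  then obtain U where U: "U > 0" "\<And>z. norm z \<le> 1 \<Longrightarrow> norm (f z) \<le> U"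
    unfolding bounded_pos by (auto simp: mem_cball)
  define u where "u t = ennreal (norm (f t))" for t
  have [measurable]: "u \<in> borel_measurable circ"
    unfolding u_def by (intro measurable_compose[OF measurable_circI measurable_ennreal] continuous_intros cf)
  have *: "(\<integral>\<^sup>+s. (\<integral>\<^sup>+t. L s t * u t \<partial>circ)\<^sup>2 \<partial>circ) \<le> ennreal ((8 * (2 * pi))\<^sup>2) * (\<integral>\<^sup>+t. (u t)\<^sup>2 \<partial>circ)"
  proof (rule linearised_maximal_inequality[where c=c and U=U])
    show "finite_measure circ" by (rule circ.finite_measure_axioms)
    show "L s t \<le> ennreal c" for s t
    proof -
      have "qkernel (e s) s t \<le> 1 / (1 - \<rho> (\<kappa> s))"
        using qkernel_le[OF e] by (simp add: e_def)
      also have "\<dots> \<le> c"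
        unfolding c_def using \<kappa>(1) \<rho> by (intro member_le_sum) (auto simp: less_imp_le)
      finally show ?thesis by (simp add: L_def ennreal_leI)
    qed
    show "u t \<le> ennreal U" if "t \<in> space circ" for t
      using that U by (simp add: u_def ennreal_leI)
    show "(\<integral>\<^sup>+t. L s t \<partial>circ) \<le> ennreal (2 * pi)" if "s \<in> space circ" for s
    proof -
      have rs: "norm (of_real (\<rho> (\<kappa> s)) * s) < 1"
        using \<rho>[OF \<kappa>(1)] that by (simp add: norm_mult)
      have "(\<integral>\<^sup>+t. L s t \<partial>circ) \<le> (\<integral>\<^sup>+t. ennreal (poisson (of_real (\<rho> (\<kappa> s)) * s) t) \<partial>circ)"
        unfolding L_def e_def using \<rho>[OF \<kappa>(1)[of s]] that
        by (intro nn_integral_mono ennreal_leI poisson_qkernel) auto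
      also have "\<dots> = ennreal (2 * pi)"
        using rs by (subst nn_integral_circ) (auto intro!: continuous_intros simp: poisson_nonneg integral_poisson)
      finally show ?thesis .
    qed
    show "L s t * L s' t \<le> 4 * (L s s' * L s' t + L s t * L s' s)" for s s' t
      using qkernel_quasi[OF e[of s] e[of s'], of s t s'] 
      by (simp add: L_def ennreal_mult[symmetric] qkernel_nonneg e ennreal_leI
          flip: ennreal_plus ennreal_numeral)
  qed (use U c0 in auto)
  \<comment> \<open>Here \<open>pi / 9\<close> is 2 pi / 18: the mass in the Poisson formula over
    the constant of the kernel comparison.\<close>
  have X_le: "ennreal (pi / 9 * X s) \<le> (\<integral>\<^sup>+t. L s t * u t \<partial>circ)" if "s \<in> space circ" for s
  proof -
    have s: "norm s = 1" using that by simp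
    have "1 - \<rho> (\<kappa> s) + norm (s - w) \<noteq> 0" for w
      using e[of s] norm_ge_zero[of "s - w"] unfolding e_def by linarith
    then have cq: "continuous_on (sphere 0 1) (\<lambda>t. qkernel (1 - \<rho> (\<kappa> s)) s t * norm (f t))"
      unfolding qkernel_def by (intro continuous_intros cf) auto
    have "2 * pi * X s \<le> 18 * (LINT t|circ. qkernel (1 - \<rho> (\<kappa> s)) s t * norm (f t))"
      using norm_le_qkernel_integral[OF assms(1,2) s, of "\<rho> (\<kappa> s)"] \<rho>[OF \<kappa>(1)[of s]] \<kappa>(2)[of s]
      by (simp add: h_def)
    then have "ennreal (pi / 9 * X s) \<le> ennreal (LINT t|circ. qkernel (1 - \<rho> (\<kappa> s)) s t * norm (f t))"
      by (intro ennreal_leI) simp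
    also have "\<dots> = (\<integral>\<^sup>+t. ennreal (qkernel (1 - \<rho> (\<kappa> s)) s t * norm (f t)) \<partial>circ)"
      using e[of s] by (intro nn_integral_circ[symmetric] cq) (auto simp: e_def qkernel_nonneg)
    also have "\<dots> = (\<integral>\<^sup>+t. L s t * u t \<partial>circ)"
      using e[of s] by (intro nn_integral_cong) (auto simp: L_def u_def e_def ennreal_mult qkernel_nonneg)
    finally show ?thesis .
  qed
  have X0: "X s \<ge> 0" for s
    using \<kappa>(2)[of s] unfolding h_def by (metis norm_ge_zero)
  have "ennreal (LINT s|circ. (pi / 9 * X s)\<^sup>2) = (\<integral>\<^sup>+s. ennreal ((pi / 9 * X s)\<^sup>2) \<partial>circ)"
    by (intro nn_integral_circ[symmetric] continuous_intros cX) auto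
  also have "\<dots> \<le> (\<integral>\<^sup>+s. (\<integral>\<^sup>+t. L s t * u t \<partial>circ)\<^sup>2 \<partial>circ)"
  proof (rule nn_integral_mono)
    fix s assume s: "s \<in> space circ"
    have "ennreal ((pi / 9 * X s)\<^sup>2) = (ennreal (pi / 9 * X s))\<^sup>2"
      using X0[of s] by (simp add: ennreal_power)
    also have "\<dots> \<le> (\<integral>\<^sup>+t. L s t * u t \<partial>circ)\<^sup>2"
      using X_le[OF s] by (intro power_mono) auto
    finally show "ennreal ((pi / 9 * X s)\<^sup>2) \<le> (\<integral>\<^sup>+t. L s t * u t \<partial>circ)\<^sup>2" .
  qed
  also note *
  also have "(\<integral>\<^sup>+t. (u t)\<^sup>2 \<partial>circ) = (\<integral>\<^sup>+t. ennreal ((norm (f t))\<^sup>2) \<partial>circ)"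
    by (simp add: u_def ennreal_power)
  also have "\<dots> = ennreal (LINT t|circ. (norm (f t))\<^sup>2)"
    by (intro nn_integral_circ continuous_intros cf) auto
  also have "ennreal ((8 * (2 * pi))\<^sup>2) * \<dots> = ennreal ((8 * (2 * pi))\<^sup>2 * (LINT t|circ. (norm (f t))\<^sup>2))"
    by (rule ennreal_mult'[symmetric]) simp
  finally have "(LINT s|circ. (pi / 9 * X s)\<^sup>2) \<le> (8 * (2 * pi))\<^sup>2 * (LINT t|circ. (norm (f t))\<^sup>2)"
    by (subst (asm) ennreal_le_iff) (auto intro!: mult_nonneg_nonneg integral_circ_nonneg)
  also have "(LINT s|circ. (pi / 9 * X s)\<^sup>2) = (pi / 9)\<^sup>2 * (LINT s|circ. (X s)\<^sup>2)"
    by (simp only: power_mult_distrib integral_mult_right_zero)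
  finally have "(pi / 9)\<^sup>2 * (LINT s|circ. (X s)\<^sup>2) \<le> (pi / 9)\<^sup>2 * (20736 * (LINT t|circ. (norm (f t))\<^sup>2))"
    by (simp add: power_mult_distrib power_divide)
  then have "(LINT s|circ. (X s)\<^sup>2) \<le> 20736 * (LINT t|circ. (norm (f t))\<^sup>2)"
    by (subst (asm) mult_le_cancel_left_pos) auto
  then show ?thesis
    by (simp add: X_def h_def)
qed

section \<open>Null sets and Parseval's identity\<close>

text \<open>The two sides differ by the completion of Lebesgue measure and by the endpoint
  \<open>2 * pi\<close> of the parameter interval; neither affects null sets.\<close>

lemma arc_null_iff:
  assumes "E \<in> sets circ"
  shows "arc_null E \<longleftrightarrow> E \<in> null_sets circ"
proof -
  define A where "A = cis -` E \<inter> {0..2*pi}"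
  define B where "B = {t \<in> {0..<2*pi}. cis t \<in> E}"
  have E: "E \<in> sets (restrict_space borel (sphere 0 1))"
    using assms by (simp add: sets_circ)
  have A0: "cis -` E \<inter> space (restrict_space lborel {0..2*pi}) = A"
    by (auto simp: A_def space_restrict_space)
  have A1: "A \<in> sets (restrict_space lborel {0..2*pi})"
    using measurable_sets[OF cis_measurable_circ E] unfolding A0 .
  then have A: "A \<in> sets lborel"
    by (subst (asm) sets_restrict_space_iff) auto
  have "emeasure circ E = emeasure (restrict_space lborel {0..2*pi}) A"
    unfolding circ_def by (subst emeasure_distr[OF cis_measurable_circ E]) (simp only: A0)
  also have "\<dots> = emeasure lborel A"
    by (rule emeasure_restrict_space) (auto simp: A_def)
  also have "\<dots> = emeasure lebesgue A"
    using A by (simp add: emeasure_completion)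
  finally have em: "emeasure circ E = emeasure lebesgue A" .
  have "E \<in> null_sets circ \<longleftrightarrow> A \<in> null_sets lebesgue"
    using assms A em by (auto simp: null_sets_def)
  also have "\<dots> \<longleftrightarrow> negligible A"
    by (simp add: negligible_iff_null_sets)
  also have "\<dots> \<longleftrightarrow> negligible B"
  proof
    assume "negligible A"
    then show "negligible B" by (rule negligible_subset) (auto simp: A_def B_def)
  next
    assume "negligible B"
    then have "negligible (B \<union> {2*pi})" by (simp add: negligible_Un)
    then show "negligible A" by (rule negligible_subset) (auto simp: A_def B_def)
  qed
  finally show ?thesis
    by (simp add: arc_null_def B_def negligible_iff_null_sets)
qed

lemma integral_circ_monomials:
  "(LINT w|circ. w ^ n * cnj w ^ m) = (if n = m then 2 * of_real pi else 0)"
proof -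
  have pow: "(LINT w|circ. w ^ k) = (if k = 0 then 2 * of_real pi else 0)" for k
  proof -
    have "(LINT w|circ. w ^ k) = (LINT w|circ. w ^ k * (w / (w - 0)))"
      by (intro Bochner_Integration.integral_cong) auto
    also have "\<dots> = 2 * of_real pi * 0 ^ k"
      by (rule circ_Cauchy) (auto intro!: continuous_intros holomorphic_intros)
    finally show ?thesis by auto
  qed
  have cancel: "w ^ m * cnj w ^ m = 1" if "norm w = 1" for w m
    using that by (simp add: power_mult_distrib[symmetric] complex_norm_square[symmetric])
  show ?thesis
  proof (cases "m \<le> n")
    case True
    have "w ^ n * cnj w ^ m = w ^ (n - m)" if "norm w = 1" for w
    proof -
      have "w ^ n = w ^ (n - m) * w ^ m"
        using True by (simp flip: power_add)
      then show ?thesis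
        using cancel[OF that] by (simp add: mult.assoc)
    qed
    then have "(LINT w|circ. w ^ n * cnj w ^ m) = (LINT w|circ. w ^ (n - m))"
      by (intro Bochner_Integration.integral_cong) auto
    then show ?thesis
      using pow[of "n - m"] True by simp
  next
    case False
    have "w ^ n * cnj w ^ m = cnj (w ^ (m - n))" if "norm w = 1" for w
    proof -
      have "cnj w ^ m = cnj w ^ n * cnj w ^ (m - n)"
        using False by (simp flip: power_add)
      then show ?thesis
        using cancel[OF that, of n] by (simp add: mult.assoc[symmetric])
    qed
    then have "(LINT w|circ. w ^ n * cnj w ^ m) = (LINT w|circ. cnj (w ^ (m - n)))"
      by (intro Bochner_Integration.integral_cong) auto
    also have "\<dots> = cnj (LINT w|circ. w ^ (m - n))"
      by (rule integral_bounded_linear'[OF bounded_linear_cnj bounded_linear_cnj]) auto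
    finally show ?thesis
      using pow[of "m - n"] False by simp
  qed
qed

lemma circ_Parseval_finite:
  "(LINT w|circ. (norm (\<Sum>n<N. b n * w ^ n))\<^sup>2) = 2 * pi * (\<Sum>n<N. (norm (b n))\<^sup>2)"
proof -
  have "complex_of_real (LINT w|circ. (norm (\<Sum>n<N. b n * w ^ n))\<^sup>2)
      = (LINT w|circ. of_real ((norm (\<Sum>n<N. b n * w ^ n))\<^sup>2))"
    by (rule integral_complex_of_real[symmetric])
  also have "\<dots> = (LINT w|circ. (\<Sum>n<N. \<Sum>m<N. (b n * cnj (b m)) * (w ^ n * cnj w ^ m)))"
    unfolding complex_norm_square by (simp add: sum_product mult_ac)
  also have "\<dots> = (\<Sum>n<N. \<Sum>m<N. (LINT w|circ. (b n * cnj (b m)) * (w ^ n * cnj w ^ m)))"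
    by (subst Bochner_Integration.integral_sum Bochner_Integration.integral_sum
         | intro Bochner_Integration.integral_sum sum.cong integrable_circ continuous_intros refl)+
  also have "\<dots> = (\<Sum>n<N. \<Sum>m<N. if n = m then b n * cnj (b n) * (2 * of_real pi) else 0)"
    by (intro sum.cong refl) (simp add: integral_circ_monomials)
  also have "\<dots> = (\<Sum>n<N. b n * cnj (b n) * (2 * of_real pi))"
    by simp
  also have "\<dots> = of_real (2 * pi * (\<Sum>n<N. (norm (b n))\<^sup>2))"
    by (simp only: complex_norm_square[symmetric] of_real_mult of_real_sum sum_distrib_left) (simp add: mult_ac)
  finally show ?thesis
    by (simp only: of_real_eq_iff)
qed

text \<open>Absolute summability supplies a constant majorant for passing to the limit in the finite
  identity. Coefficients of functions dilated into the disc have this property.\<close>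

lemma circ_Parseval:
  fixes b :: "nat \<Rightarrow> complex"
  assumes "summable (\<lambda>n. norm (b n))"
  shows "(\<lambda>n. (norm (b n))\<^sup>2) sums ((LINT w|circ. (norm (\<Sum>n. b n * w ^ n))\<^sup>2) / (2 * pi))"
proof -
  define S where "S N w = (\<Sum>n<N. b n * w ^ n)" for N and w :: complex
  define C where "C = (\<Sum>n. norm (b n))"
  have lim: "(\<lambda>N. S N w) \<longlonglongrightarrow> (\<Sum>n. b n * w ^ n)" if "norm w = 1" for w
  proof -
    have "summable (\<lambda>n. b n * w ^ n)"
      using assms that by (intro summable_norm_cancel[of "\<lambda>n. b n * w ^ n"]) (simp add: norm_mult norm_power)
    then show ?thesis
      unfolding S_def by (rule summable_LIMSEQ)
  qed
  have bd: "norm (S N w) \<le> C" if "norm w = 1" for N w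
  proof -
    have "norm (S N w) \<le> (\<Sum>n<N. norm (b n * w ^ n))"
      unfolding S_def by (rule norm_sum)
    also have "\<dots> = (\<Sum>n<N. norm (b n))"
      using that by (simp add: norm_mult norm_power)
    also have "\<dots> \<le> C"
      unfolding C_def by (intro sum_le_suminf assms) auto
    finally show ?thesis .
  qed
  have meas: "S N \<in> borel_measurable circ" for N
    unfolding S_def by (intro measurable_circI continuous_intros)
  have meas': "(\<lambda>w. \<Sum>n. b n * w ^ n) \<in> borel_measurable circ"
    by (rule borel_measurable_LIMSEQ_metric[OF meas]) (use lim in auto)
  have "(\<lambda>N. LINT w|circ. (norm (S N w))\<^sup>2) \<longlonglongrightarrow> (LINT w|circ. (norm (\<Sum>n. b n * w ^ n))\<^sup>2)"
  proof (rule integral_dominated_convergence[where w = "\<lambda>_. C\<^sup>2"])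
    show "(\<lambda>w. (norm (\<Sum>n. b n * w ^ n))\<^sup>2) \<in> borel_measurable circ"
      using meas' by simp
    show "(\<lambda>w. (norm (S N w))\<^sup>2) \<in> borel_measurable circ" for N
      using meas[of N] by simp
    show "AE w in circ. (\<lambda>N. (norm (S N w))\<^sup>2) \<longlonglongrightarrow> (norm (\<Sum>n. b n * w ^ n))\<^sup>2"
      by (intro AE_I2 tendsto_intros lim) auto
    show "AE w in circ. norm ((norm (S N w))\<^sup>2) \<le> C\<^sup>2" for N
      using bd by (intro AE_I2) (auto intro!: power_mono)
  qed simp
  then have "(\<lambda>N. 2 * pi * (\<Sum>n<N. (norm (b n))\<^sup>2) / (2 * pi)) \<longlonglongrightarrow> (LINT w|circ. (norm (\<Sum>n. b n * w ^ n))\<^sup>2) / (2 * pi)"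
    unfolding S_def circ_Parseval_finite by (intro tendsto_divide tendsto_const) auto
  then show ?thesis
    by (simp add: sums_def)
qed

section \<open>Radial oscillation\<close>

lemma continuous_on_radius:
  assumes "continuous_on (ball 0 1) f" "norm s = 1"
  shows "continuous_on {0..<1} (\<lambda>r. f (complex_of_real r * s))"
  using assms by (intro continuous_on_compose2[OF assms(1)] continuous_intros) (auto simp: norm_mult)

lemma eventually_at_left_1: "eventually (\<lambda>r. 0 < r \<and> r < 1) (at_left (1::real))"
  using eventually_at_left_real[of 0 "1::real"] by (auto elim: eventually_mono)

text \<open>The Cauchy criterion eliminates the unknown limit, so that its failure can be described
  by values of the function alone.\<close>

lemma Cauchy_at_left_iff:
  fixes f :: "real \<Rightarrow> 'a::complete_space"
  shows "(\<exists>L. (f \<longlongrightarrow> L) (at_left 1)) \<longleftrightarrow>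
    (\<forall>e>0. \<exists>\<rho><1. \<forall>r r'. \<rho> < r \<longrightarrow> r < 1 \<longrightarrow> \<rho> < r' \<longrightarrow> r' < 1 \<longrightarrow> dist (f r) (f r') \<le> e)"
    (is "?L \<longleftrightarrow> ?R")
proof
  assume ?L
  then obtain L where L: "(f \<longlongrightarrow> L) (at_left 1)" by blast
  show ?R
  proof (intro allI impI)
    fix e :: real assume "e > 0"
    then have "eventually (\<lambda>r. dist (f r) L < e / 2) (at_left 1)"
      using tendstoD[OF L, of "e / 2"] by simp
    then obtain \<rho> where \<rho>: "\<rho> < 1" "\<And>r. \<rho> < r \<Longrightarrow> r < 1 \<Longrightarrow> dist (f r) L < e / 2"
      unfolding eventually_at_left_field by blast
    show "\<exists>\<rho><1. \<forall>r r'. \<rho> < r \<longrightarrow> r < 1 \<longrightarrow> \<rho> < r' \<longrightarrow> r' < 1 \<longrightarrow> dist (f r) (f r') \<le> e"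
      using \<rho> by (intro exI[of _ \<rho>]) (meson dist_triangle_half_l less_imp_le)
  qed
next
  assume R: ?R
  define x where "x n = 1 - 1 / real (Suc (Suc n))" for n
  have x1: "x n < 1" for n by (simp add: x_def)
  have xlim: "x \<longlonglongrightarrow> 1"
    unfolding x_def using tendsto_diff[OF tendsto_const LIMSEQ_Suc[OF LIMSEQ_inverse_real_of_nat], of 1]
    by (simp add: field_simps)
  have "Cauchy (\<lambda>n. f (x n))"
  proof (rule metric_CauchyI)
    fix e :: real assume "e > 0"
    then obtain \<rho> where \<rho>: "\<rho> < 1" "\<And>r r'. \<rho> < r \<Longrightarrow> r < 1 \<Longrightarrow> \<rho> < r' \<Longrightarrow> r' < 1 \<Longrightarrow> dist (f r) (f r') \<le> e / 2"
      using R[rule_format, of "e / 2"] by auto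
    have "eventually (\<lambda>n. x n > \<rho>) sequentially"
      using order_tendstoD(1)[OF xlim \<rho>(1)] .
    then obtain N where "\<And>n. n \<ge> N \<Longrightarrow> x n > \<rho>"
      unfolding eventually_sequentially by blast
    then show "\<exists>M. \<forall>m\<ge>M. \<forall>n\<ge>M. dist (f (x m)) (f (x n)) < e"
      using \<rho>(2) x1 \<open>e > 0\<close> by (intro exI[of _ N]) (smt (verit) field_sum_of_halves)
  qed
  then obtain L where L: "(\<lambda>n. f (x n)) \<longlonglongrightarrow> L"
    using Cauchy_convergent_iff convergent_def by blast
  have "(f \<longlongrightarrow> L) (at_left 1)"
  proof (rule tendstoI)
    fix e :: real assume "e > 0"
    then obtain \<rho> where \<rho>: "\<rho> < 1" "\<And>r r'. \<rho> < r \<Longrightarrow> r < 1 \<Longrightarrow> \<rho> < r' \<Longrightarrow> r' < 1 \<Longrightarrow> dist (f r) (f r') \<le> e / 2"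
      using R[rule_format, of "e / 2"] by auto
    have "dist (f r) L < e" if r: "\<rho> < r" "r < 1" for r
    proof -
      have "(\<lambda>n. dist (f r) (f (x n))) \<longlonglongrightarrow> dist (f r) L"
        by (intro tendsto_intros L)
      moreover have "eventually (\<lambda>n. dist (f r) (f (x n)) \<le> e / 2) sequentially"
        using order_tendstoD(1)[OF xlim \<rho>(1)] by eventually_elim (use \<rho>(2) r x1 in auto)
      ultimately have "dist (f r) L \<le> e / 2"
        by (rule tendsto_upperbound) simp
      then show ?thesis using \<open>e > 0\<close> by simp
    qed
    then show "eventually (\<lambda>r. dist (f r) L < e) (at_left 1)"
      unfolding eventually_at_left_field using \<rho>(1) by blast
  qed
  then show ?L by blast
qed

text \<open>The strict inequality makes the condition open in \<open>s\<close> for fixed radii; this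
  is what yields a Gdelta set.\<close>

definition osc_set :: "(complex \<Rightarrow> complex) \<Rightarrow> real \<Rightarrow> complex set" where
  "osc_set f e = {s \<in> sphere 0 1. \<forall>\<rho><1. \<exists>r r'. \<rho> < r \<and> r < 1 \<and> \<rho> < r' \<and> r' < 1 \<and>
      e < dist (f (of_real r * s)) (f (of_real r' * s))}"

lemma no_radial_limit_iff:
  assumes "norm s = 1"
  shows "\<not> radial_limit_exists f s \<longleftrightarrow> (\<exists>k. s \<in> osc_set f (1 / real (Suc k)))"
proof -
  have "\<not> radial_limit_exists f s \<longleftrightarrow> (\<exists>e>0. s \<in> osc_set f e)"
    unfolding radial_limit_exists_def Cauchy_at_left_iff osc_set_def using assms
    by (auto simp: not_le)
  also have "\<dots> \<longleftrightarrow> (\<exists>k. s \<in> osc_set f (1 / real (Suc k)))"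
  proof
    assume "\<exists>e>0. s \<in> osc_set f e"
    then obtain e where e: "e > 0" "s \<in> osc_set f e" by blast
    obtain k where k: "1 / real (Suc k) < e"
      using e(1) nat_approx_posE by blast
    have "s \<in> osc_set f (1 / real (Suc k))"
      using e(2) less_trans[OF k] unfolding osc_set_def by blast
    then show "\<exists>k. s \<in> osc_set f (1 / real (Suc k))" ..
  next
    assume "\<exists>k. s \<in> osc_set f (1 / real (Suc k))"
    then show "\<exists>e>0. s \<in> osc_set f e"
      by (meson of_nat_0_less_iff zero_less_Suc zero_less_divide_1_iff)
  qed
  finally show ?thesis .
qed

text \<open>The thresholds 1 - 1 / (n + 1) are cofinal below 1, so countably many of them replace
  all \<rho>. They are nonnegative, hence the radii beyond them stay in the disc, where
  \<open>f\<close> is continuous.\<close>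

lemma Gdelta_osc_set:
  assumes "continuous_on (ball 0 1) f"
  shows "Gdelta_T (osc_set f e)"
proof -
  define V where "V r r' = {s \<in> sphere 0 1. e < dist (f (of_real r * s)) (f (of_real r' * s))}" for r r'
  define U where "U n = (\<Union>(r, r')\<in>{1 - 1 / real (Suc n)<..<1} \<times> {1 - 1 / real (Suc n)<..<1}. V r r')" for n
  have V: "openin (top_of_set (sphere 0 1)) (V r r')" if "0 \<le> r" "r < 1" "0 \<le> r'" "r' < 1" for r r'
  proof -
    have "continuous_on (sphere 0 1) (\<lambda>s. dist (f (of_real r * s)) (f (of_real r' * s)))"
      using that by (intro continuous_intros continuous_on_compose2[OF assms]) (auto simp: norm_mult)
    from continuous_openin_preimage_gen[OF this, of "{e<..}"] show ?thesis
      by (simp add: V_def vimage_def Int_def)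
  qed
  have "openin (top_of_set (sphere 0 1)) (U n)" for n
  proof -
    have n0: "0 \<le> 1 - 1 / real (Suc n)" by simp
    have "openin (top_of_set (sphere 0 1)) (V r r')"
      if "(r, r') \<in> {1 - 1 / real (Suc n)<..<1} \<times> {1 - 1 / real (Suc n)<..<1}" for r r'
    proof -
      have r: "1 - 1 / real (Suc n) < r" "r < 1" "1 - 1 / real (Suc n) < r'" "r' < 1"
        using that by (simp_all only: mem_Sigma_iff greaterThanLessThan_iff)
      with n0 have "0 \<le> r" "0 \<le> r'" by linarith+
      with r show ?thesis by (intro V)
    qed
    then show ?thesis
      unfolding U_def by (intro openin_Union) auto
  qed
  moreover have "osc_set f e = (\<Inter>n. U n)"
  proof (intro equalityI subsetI INT_I)
    fix s n assume "s \<in> osc_set f e"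
    moreover have "1 - 1 / real (Suc n) < 1" by simp
    ultimately obtain r r' where "1 - 1 / real (Suc n) < r" "r < 1" "1 - 1 / real (Suc n) < r'" "r' < 1"
        "e < dist (f (of_real r * s)) (f (of_real r' * s))" "s \<in> sphere 0 1"
      unfolding osc_set_def by blast
    then show "s \<in> U n"
      unfolding U_def V_def by (intro UN_I[of "(r, r')"]) auto
  next
    fix s assume s: "s \<in> (\<Inter>n. U n)"
    have "s \<in> U 0" using s by blast
    then have "s \<in> sphere 0 1" by (auto simp: U_def V_def)
    moreover have "\<exists>r r'. \<rho> < r \<and> r < 1 \<and> \<rho> < r' \<and> r' < 1 \<and> e < dist (f (of_real r * s)) (f (of_real r' * s))"
      if \<rho>: "\<rho> < 1" for \<rho>
    proof -
      obtain n where n: "1 / real (Suc n) < 1 - \<rho>"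
        using \<rho> nat_approx_posE[of "1 - \<rho>"] by auto
      have "s \<in> U n" using s by blast
      then obtain r r' where "1 - 1 / real (Suc n) < r" "r < 1" "1 - 1 / real (Suc n) < r'" "r' < 1"
        "e < dist (f (of_real r * s)) (f (of_real r' * s))"
        unfolding U_def V_def by auto
      moreover from this n have "\<rho> < r" "\<rho> < r'" by linarith+
      ultimately show ?thesis by blast
    qed
    ultimately show "s \<in> osc_set f e"
      unfolding osc_set_def by blast
  qed
  ultimately show ?thesis
    unfolding Gdelta_T_def by blast
qed

lemma Gdelta_T_sets_circ:
  assumes "Gdelta_T E"
  shows "E \<in> sets circ"
proof -
  from assms[unfolded Gdelta_T_def] obtain U :: "nat \<Rightarrow> complex set"
    where U': "(\<forall>n. openin (top_of_set (sphere 0 1)) (U n)) \<and> E = (\<Inter>n. U n)" by (rule exE)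
  then have U: "\<And>n. openin (top_of_set (sphere 0 1)) (U n)" "E = (\<Inter>n. U n)"
    by simp_all
  have "U n \<in> sets circ" for n :: nat
  proof -
    obtain V where V: "open V" "U n = sphere 0 1 \<inter> V"
      using openin_open[THEN iffD1, OF U(1)[of n]] by (elim exE conjE)
    from V(1) have "V \<in> sets borel" by (rule borel_open)
    then show ?thesis
      unfolding sets_circ sets_restrict_space V(2) by (rule imageI)
  qed
  then show ?thesis
    unfolding U(2) by (intro sets.countable_INT image_subsetI) simp_all
qed

lemma Gdelta_sigma_T_sets_circ:
  assumes "Gdelta_sigma_T E"
  shows "E \<in> sets circ"
proof -
  from assms[unfolded Gdelta_sigma_T_def] obtain G :: "nat \<Rightarrow> complex set"
    where G': "(\<forall>n. Gdelta_T (G n)) \<and> E = (\<Union>n. G n)" by (rule exE)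
  then have G: "\<And>n. Gdelta_T (G n)" "E = (\<Union>n. G n)"
    by simp_all
  show ?thesis
    unfolding G(2) by (intro sets.countable_UN image_subsetI Gdelta_T_sets_circ G(1))
qed

section \<open>Mean squares of Taylor remainders\<close>

definition taylor_coeff :: "(complex \<Rightarrow> complex) \<Rightarrow> nat \<Rightarrow> complex" where
  "taylor_coeff f n = (deriv ^^ n) f 0 / fact n"

definition taylor_rest :: "(complex \<Rightarrow> complex) \<Rightarrow> nat \<Rightarrow> complex \<Rightarrow> complex" where
  "taylor_rest f N z = f z - (\<Sum>n<N. taylor_coeff f n * z ^ n)"

lemma taylor_rest_l2:
  assumes f: "f holomorphic_on ball 0 1" and R: "0 < R" "R < 1"
  shows "(\<lambda>n. if n < N then 0 else (norm (taylor_coeff f n))\<^sup>2 * R ^ (2 * n)) sums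
     ((LINT w|circ. (norm (taylor_rest f N (of_real R * w)))\<^sup>2) / (2 * pi))"
proof -
  define b where "b n = (if n < N then 0 else taylor_coeff f n * of_real R ^ n)" for n
  have ser: "(\<lambda>n. taylor_coeff f n * z ^ n) sums f z" if "norm z < 1" for z
    using holomorphic_power_series[OF f, of z] that by (simp add: taylor_coeff_def)
  \<comment> \<open>Convergence at a slightly larger radius gives absolute convergence at
    \<open>R\<close>, as Parseval's identity requires.\<close>
  obtain R' where R': "R < R'" "R' < 1" using R dense by blast
  have "summable (\<lambda>n. taylor_coeff f n * of_real R' ^ n)"
    using ser[of "of_real R'"] R R' by (auto simp: sums_iff)
  then have "summable (\<lambda>n. norm (taylor_coeff f n * of_real R ^ n))"
    by (rule powser_insidea) (use R R' in auto)
  then have sb: "summable (\<lambda>n. norm (b n))"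
    by (rule summable_comparison_test'[where N=0]) (auto simp: b_def)
  have eq: "(\<Sum>n. b n * w ^ n) = taylor_rest f N (of_real R * w)" if "norm w = 1" for w
  proof -
    have "(\<lambda>n. taylor_coeff f n * (of_real R * w) ^ n) sums f (of_real R * w)"
      using R that by (intro ser) (simp add: norm_mult)
    moreover have "(\<lambda>n. if n \<in> {..<N} then taylor_coeff f n * (of_real R * w) ^ n else 0) sums
        (\<Sum>n<N. taylor_coeff f n * (of_real R * w) ^ n)"
      by (rule sums_If_finite_set) simp
    ultimately have "(\<lambda>n. taylor_coeff f n * (of_real R * w) ^ n -
         (if n \<in> {..<N} then taylor_coeff f n * (of_real R * w) ^ n else 0)) sums taylor_rest f N (of_real R * w)"
      unfolding taylor_rest_def by (rule sums_diff)
    then have "(\<lambda>n. b n * w ^ n) sums taylor_rest f N (of_real R * w)"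
      by (rule sums_cong[THEN iffD1, rotated]) (auto simp: b_def power_mult_distrib)
    then show ?thesis by (simp add: sums_iff)
  qed
  have "(LINT w|circ. (norm (\<Sum>n. b n * w ^ n))\<^sup>2) = (LINT w|circ. (norm (taylor_rest f N (of_real R * w)))\<^sup>2)"
    by (intro Bochner_Integration.integral_cong) (auto simp: eq)
  moreover have "(norm (b n))\<^sup>2 = (if n < N then 0 else (norm (taylor_coeff f n))\<^sup>2 * R ^ (2 * n))" for n
    using R by (auto simp: b_def norm_mult norm_power power_mult_distrib power_mult[symmetric] mult.commute)
  ultimately show ?thesis
    using circ_Parseval[OF sb] by simp
qed

text \<open>Parseval on the circle of radius R bounds the weighted sums by \<open>B\<^sup>2\<close>
  uniformly in R. In a finite partial sum the weights disappear as R tends to 1.\<close>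

lemma taylor_coeff_square_summable:
  assumes f: "f holomorphic_on ball 0 1" and B: "\<And>z. norm z < 1 \<Longrightarrow> norm (f z) \<le> B"
  shows "summable (\<lambda>n. (norm (taylor_coeff f n))\<^sup>2)"
proof (rule summableI_nonneg_bounded)
  fix M
  have bd: "(\<Sum>n<M. (norm (taylor_coeff f n))\<^sup>2 * R ^ (2 * n)) \<le> B\<^sup>2" if R: "0 < R" "R < 1" for R
  proof -
    have s: "(\<lambda>n. (norm (taylor_coeff f n))\<^sup>2 * R ^ (2 * n)) sums ((LINT w|circ. (norm (f (of_real R * w)))\<^sup>2) / (2 * pi))"
      using taylor_rest_l2[OF f R, of 0] by (simp add: taylor_rest_def)
    have "(\<Sum>n<M. (norm (taylor_coeff f n))\<^sup>2 * R ^ (2 * n)) \<le> (LINT w|circ. (norm (f (of_real R * w)))\<^sup>2) / (2 * pi)"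
      unfolding sums_unique[OF s] by (intro sum_le_suminf sums_summable[OF s]) (use R in auto)
    also have "\<dots> \<le> (LINT w|circ. B\<^sup>2) / (2 * pi)"
    proof (intro divide_right_mono integral_circ_mono)
      show "continuous_on (sphere 0 1) (\<lambda>w. (norm (f (of_real R * w)))\<^sup>2)"
        using R by (intro continuous_intros continuous_on_compose2[OF holomorphic_on_imp_continuous_on[OF f]])
          (auto simp: norm_mult)
      show "(norm (f (of_real R * w)))\<^sup>2 \<le> B\<^sup>2" if "norm w = 1" for w
        using R that by (intro power_mono B) (auto simp: norm_mult)
    qed auto
    finally show ?thesis by simp
  qed
  have "((\<lambda>R. \<Sum>n<M. (norm (taylor_coeff f n))\<^sup>2 * R ^ (2 * n)) \<longlongrightarrow>
          (\<Sum>n<M. (norm (taylor_coeff f n))\<^sup>2 * 1 ^ (2 * n))) (at_left 1)"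
    by (intro tendsto_intros)
  moreover have "eventually (\<lambda>R. (\<Sum>n<M. (norm (taylor_coeff f n))\<^sup>2 * R ^ (2 * n)) \<le> B\<^sup>2) (at_left 1)"
    using eventually_at_left_1 by eventually_elim (use bd in auto)
  ultimately have "(\<Sum>n<M. (norm (taylor_coeff f n))\<^sup>2 * 1 ^ (2 * n)) \<le> B\<^sup>2"
    by (rule tendsto_upperbound) simp
  then show "(\<Sum>n<M. (norm (taylor_coeff f n))\<^sup>2) \<le> B\<^sup>2" by simp
qed simp

section \<open>Fatou's theorem\<close>

text \<open>A Taylor polynomial oscillates by at most e/2 near the end of a radius, so an
  oscillation of \<open>f\<close> above e forces the remainder above e/4 somewhere on that radius (e
  = e/2 + e/4 + e/4). Such radii have measure O(\<tau> N), for every N.\<close>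

lemma measure_osc_set:
  assumes f: "f holomorphic_on ball 0 1" and B: "\<And>z. norm z < 1 \<Longrightarrow> norm (f z) \<le> B" and e: "e > 0"
  shows "measure circ (osc_set f e) = 0"
proof -
  \<comment> \<open>Bounds the integral of the squared remainder over all circles of radius below 1
    at once, and tends to 0 as a tail of a convergent series.\<close>
  define \<tau> where "\<tau> N = 2 * pi * (\<Sum>n. (norm (taylor_coeff f (n + N)))\<^sup>2)" for N
  have summ: "summable (\<lambda>n. (norm (taylor_coeff f n))\<^sup>2)"
    using taylor_coeff_square_summable[OF f B] .
  have summN: "summable (\<lambda>n. (norm (taylor_coeff f (n + N)))\<^sup>2)" for N
    using summ by (subst summable_iff_shift[of "\<lambda>n. (norm (taylor_coeff f n))\<^sup>2" N])
  have rest_le: "(LINT w|circ. (norm (taylor_rest f N (of_real R * w)))\<^sup>2) \<le> \<tau> N"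
    if R: "0 < R" "R < 1" for R N
  proof -
    define b where "b n = (if n < N then 0 else (norm (taylor_coeff f n))\<^sup>2 * R ^ (2 * n))" for n
    have "b sums ((LINT w|circ. (norm (taylor_rest f N (of_real R * w)))\<^sup>2) / (2 * pi))"
      unfolding b_def by (rule taylor_rest_l2[OF f R])
    from sums_split_initial_segment[OF this, of N]
    have s: "(\<lambda>n. b (n + N)) sums ((LINT w|circ. (norm (taylor_rest f N (of_real R * w)))\<^sup>2) / (2 * pi))"
      by (simp add: b_def)
    have "b (n + N) \<le> (norm (taylor_coeff f (n + N)))\<^sup>2" for n
      using R by (auto simp: b_def intro!: mult_left_le power_le_one)
    then have "(LINT w|circ. (norm (taylor_rest f N (of_real R * w)))\<^sup>2) / (2 * pi) \<le> (\<Sum>n. (norm (taylor_coeff f (n + N)))\<^sup>2)"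
      using summN[of N] by (intro sums_le[OF _ s summable_sums]) auto
    then show ?thesis
      by (simp add: \<tau>_def field_simps)
  qed
  \<comment> \<open>Rational radii are enough by continuity, and the initial segments of an
    enumeration are the finite families to which the maximal inequality applies.\<close>
  define \<rho> where "\<rho> = from_nat_into (\<rat> \<inter> {0..<1::real})"
  have "(0::real) \<in> \<rat> \<inter> {0..<1}" by simp
  then have \<rho>: "range \<rho> = \<rat> \<inter> {0..<1}"
    unfolding \<rho>_def by (intro range_from_nat_into) (auto intro: countable_rat countable_Int1)
  have \<rho>01: "0 \<le> \<rho> k" "\<rho> k < 1" for k
    using \<rho> by (metis IntD2 atLeastLessThan_iff rangeI)+
  have hol: "taylor_rest f N holomorphic_on ball 0 1" for N
    unfolding taylor_rest_def by (intro holomorphic_intros f)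
  have cont: "continuous_on (ball 0 1) (taylor_rest f N)" for N
    by (intro holomorphic_on_imp_continuous_on hol)
  define X where "X N n s = (MAX k\<in>{..n}. norm (taylor_rest f N (of_real (\<rho> k) * s)))" for N n s
  have cX: "continuous_on (sphere 0 1) (X N n)" for N n
    unfolding X_def using \<rho>01
    by (intro continuous_on_Max_fun continuous_intros continuous_on_compose2[OF cont]) (auto simp: norm_mult)
  have X_int: "(LINT s|circ. (X N n s)\<^sup>2) \<le> 20736 * \<tau> N" for N n
  proof -
    \<comment> \<open>The remainder need not extend to the closed disc. Dilating by some
      \<open>R\<close> strictly between the largest of these radii and 1 makes it continuous there
      and keeps every \<open>\<rho> k / R\<close> below 1.\<close>
    define m where "m = Max (\<rho> ` {..n})"
    have m: "\<rho> k \<le> m" if "k \<le> n" for k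
      unfolding m_def using that by (intro Max_ge) auto
    have "m \<in> \<rho> ` {..n}"
      unfolding m_def by (rule Max_in) auto
    then have m01: "0 \<le> m" "m < 1" using \<rho>01 by auto
    define R where "R = (1 + m) / 2"
    have R: "0 < R" "R < 1" using m01 by (auto simp: R_def)
    have \<rho>R: "\<rho> k < R" if "k \<le> n" for k
      using m[OF that] m01 by (simp add: R_def)
    have nR: "norm (of_real R * z) < 1" if "norm z \<le> 1" for z :: complex
      using R that by (simp add: norm_mult) (meson le_less_trans mult_left_le_one_le mult_right_le_one_le norm_ge_zero less_imp_le)
    have "(LINT s|circ. (MAX k\<in>{..n}. norm ((\<lambda>z. taylor_rest f N (of_real R * z)) (of_real (\<rho> k / R) * s)))\<^sup>2)
       \<le> 20736 * (LINT w|circ. (norm (taylor_rest f N (of_real R * w)))\<^sup>2)"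
    proof (rule radial_maximal_inequality)
      show "continuous_on (cball 0 1) (\<lambda>z. taylor_rest f N (of_real R * z))"
        using nR by (intro continuous_on_compose2[OF cont] continuous_intros) auto
      have "(taylor_rest f N \<circ> (\<lambda>z. of_real R * z)) holomorphic_on ball 0 1"
        using nR by (intro holomorphic_on_compose_gen[OF _ hol] holomorphic_intros) auto
      then show "(\<lambda>z. taylor_rest f N (of_real R * z)) holomorphic_on ball 0 1"
        by (simp add: o_def)
      show "0 \<le> \<rho> k / R \<and> \<rho> k / R < 1" if "k \<le> n" for k
        using \<rho>R[OF that] \<rho>01 R by auto
    qed
    also have "\<dots> \<le> 20736 * \<tau> N"
      using rest_le[OF R] by simp
    finally show ?thesis
      using R by (simp add: X_def)
  qed
  define A where "A N n = {s \<in> space circ. (e / 4)\<^sup>2 \<le> (X N n s)\<^sup>2}" for N n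
  have X0: "0 \<le> X N n s" for N n s
  proof -
    have "norm (taylor_rest f N (of_real (\<rho> 0) * s)) \<le> X N n s"
      unfolding X_def by (intro Max_ge) auto
    then show ?thesis by (rule order_trans[OF norm_ge_zero])
  qed
  have A_sets: "A N n \<in> sets circ" for N n
  proof -
    have [measurable]: "X N n \<in> borel_measurable circ" by (rule measurable_circI[OF cX])
    show ?thesis unfolding A_def by measurable
  qed
  have A_meas: "measure circ (A N n) \<le> 20736 * \<tau> N / (e / 4)\<^sup>2" for N n
  proof -
    have "measure circ (A N n) \<le> (LINT s|circ. (X N n s)\<^sup>2) / (e / 4)\<^sup>2"
      unfolding A_def using e
      by (intro integral_Markov_inequality_measure[where A = "{}"] integrable_circ continuous_intros cX) auto
    also have "\<dots> \<le> 20736 * \<tau> N / (e / 4)\<^sup>2"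
      by (intro divide_right_mono X_int) auto
    finally show ?thesis .
  qed
  have X_mono: "X N n s \<le> X N n' s" if "n \<le> n'" for N n n' s
    unfolding X_def using that by (intro Max_mono) auto
  \<comment> \<open>Monotonicity in \<open>n\<close> passes the bound, which does not involve
    \<open>n\<close>, to the union over all rational radii.\<close>
  have A_inc: "incseq (A N)" for N
    unfolding incseq_def A_def using X_mono X0 by (auto intro: order_trans power_mono)
  have UA: "measure circ (\<Union>n. A N n) \<le> 20736 * \<tau> N / (e / 4)\<^sup>2" for N
    using A_sets by (intro LIMSEQ_le_const2[OF circ.finite_Lim_measure_incseq[OF _ A_inc]]) (auto intro: A_meas)
  have osc_sub: "osc_set f e \<subseteq> (\<Union>n. A N n)" for N
  proof
    fix s assume s: "s \<in> osc_set f e"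
    then have ns: "norm s = 1" by (simp add: osc_set_def)
    define p where "p z = (\<Sum>n<N. taylor_coeff f n * z ^ n)" for z
    have "((\<lambda>r. p (complex_of_real r * s)) \<longlongrightarrow> p (complex_of_real 1 * s)) (at_left 1)"
      unfolding p_def by (intro tendsto_intros)
    then have "\<exists>L. ((\<lambda>r. p (complex_of_real r * s)) \<longlongrightarrow> L) (at_left 1)" ..
    from this[unfolded Cauchy_at_left_iff, rule_format, of "e / 2"] e
    obtain \<rho>0 where \<rho>0: "\<rho>0 < 1" "\<And>r r'. \<rho>0 < r \<Longrightarrow> r < 1 \<Longrightarrow> \<rho>0 < r' \<Longrightarrow> r' < 1 \<Longrightarrow>
        dist (p (complex_of_real r * s)) (p (complex_of_real r' * s)) \<le> e / 2"
      by auto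
    obtain r r' where r: "max \<rho>0 0 < r" "r < 1" "max \<rho>0 0 < r'" "r' < 1"
      "e < dist (f (of_real r * s)) (f (of_real r' * s))"
      using s \<rho>0(1) unfolding osc_set_def by (auto dest!: spec[of _ "max \<rho>0 0"])
    have f_eq: "f z = taylor_rest f N z + p z" for z
      by (simp add: taylor_rest_def p_def)
    have "\<exists>r. 0 < r \<and> r < 1 \<and> e / 4 < norm (taylor_rest f N (of_real r * s))"
    proof (rule ccontr)
      assume neg: "\<not> ?thesis"
      have small: "norm (taylor_rest f N (of_real q * s)) \<le> e / 4" if "max \<rho>0 0 < q" "q < 1" for q
      proof -
        have "\<not> (0 < q \<and> q < 1 \<and> e / 4 < norm (taylor_rest f N (of_real q * s)))"
          using neg by (auto simp only: not_ex)
        moreover have "0 < q" using that(1) by simp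
        ultimately show ?thesis using that(2) by (simp add: not_less)
      qed
      have "norm (taylor_rest f N (of_real r * s)) \<le> e / 4" "norm (taylor_rest f N (of_real r' * s)) \<le> e / 4"
        by (rule small[OF r(1,2)], rule small[OF r(3,4)])
      moreover have "dist (f (of_real r * s)) (f (of_real r' * s))
        \<le> dist (p (of_real r * s)) (p (of_real r' * s)) + norm (taylor_rest f N (of_real r * s)) + norm (taylor_rest f N (of_real r' * s))"
        using arg_cong2[of _ _ _ _ dist, OF f_eq[of "of_real r * s"] f_eq[of "of_real r' * s"]]
          dist_triangle_add[of "taylor_rest f N (of_real r * s)" "p (of_real r * s)" "taylor_rest f N (of_real r' * s)" "p (of_real r' * s)"]
          norm_triangle_ineq4[of "taylor_rest f N (of_real r * s)" "taylor_rest f N (of_real r' * s)"]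
          dist_norm[of "taylor_rest f N (of_real r * s)" "taylor_rest f N (of_real r' * s)"]
        by linarith
      ultimately show False
        using \<rho>0(2)[of r r'] r by auto
    qed
    then obtain q where q: "0 < q" "q < 1" "e / 4 < norm (taylor_rest f N (of_real q * s))" by blast
    \<comment> \<open>The radii where the remainder exceeds e/4 form an open set, which therefore
      contains some \<open>\<rho> k\<close>.\<close>
    have "continuous_on {0<..<1} (\<lambda>r. norm (taylor_rest f N (complex_of_real r * s)))"
      by (intro continuous_intros continuous_on_subset[OF continuous_on_radius[OF cont ns]]) auto
    then have "open ({0<..<1} \<inter> (\<lambda>r. norm (taylor_rest f N (complex_of_real r * s))) -` {e / 4<..})"
      by (intro continuous_open_preimage) auto
    moreover have "q \<in> {0<..<1} \<inter> (\<lambda>r. norm (taylor_rest f N (complex_of_real r * s))) -` {e / 4<..}"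
      using q by simp
    ultimately obtain d where d: "d > 0" "ball q d \<subseteq> {0<..<1} \<inter> (\<lambda>r. norm (taylor_rest f N (complex_of_real r * s))) -` {e / 4<..}"
      by (rule openE)
    obtain x where x: "x \<in> \<rat>" "q < x" "x < q + d"
      using Rats_dense_in_real[of q "q + d"] d(1) by auto
    then have "x \<in> ball q d" by (simp add: dist_real_def)
    with d(2) have x2: "0 < x" "x < 1" "e / 4 < norm (taylor_rest f N (complex_of_real x * s))" by auto
    with x \<rho> have "x \<in> range \<rho>" by auto
    then obtain k where k: "x = \<rho> k" by blast
    have "norm (taylor_rest f N (complex_of_real x * s)) \<le> X N k s"
      unfolding X_def k by (intro Max_ge) auto
    with x2 have "(e / 4)\<^sup>2 \<le> (X N k s)\<^sup>2"
      using e by (intro power_mono) auto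
    then show "s \<in> (\<Union>n. A N n)"
      using ns by (auto simp: A_def)
  qed
  have "measure circ (osc_set f e) \<le> 20736 * \<tau> N / (e / 4)\<^sup>2" for N
  proof -
    have "measure circ (osc_set f e) \<le> measure circ (\<Union>n. A N n)"
      by (intro circ.finite_measure_mono osc_sub sets.countable_UN image_subsetI A_sets)
    with UA[of N] show ?thesis by linarith
  qed
  moreover have "(\<lambda>N. 20736 * \<tau> N / (e / 4)\<^sup>2) \<longlonglongrightarrow> 20736 * (2 * pi * 0) / (e / 4)\<^sup>2"
    unfolding \<tau>_def using e by (intro tendsto_intros suminf_exist_split2 summ) auto
  ultimately have "measure circ (osc_set f e) \<le> 20736 * (2 * pi * 0) / (e / 4)\<^sup>2"
    by (intro LIMSEQ_le_const) auto
  then show ?thesis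
    by (simp add: measure_le_0_iff)
qed

theorem no_radial_limit_set:
  assumes f: "f \<in> Hinf" and E: "E \<subseteq> sphere 0 1"
    and lim: "\<forall>z\<in>sphere 0 1. radial_limit_exists f z \<longleftrightarrow> z \<notin> E"
  shows "Gdelta_sigma_T E \<and> arc_null E"
proof -
  have hol: "f holomorphic_on ball 0 1" and "bounded (f ` ball 0 1)"
    using f unfolding Hinf_def by blast+
  then obtain B where "\<forall>z\<in>ball 0 1. norm (f z) \<le> B"
    unfolding bounded_iff by blast
  then have B: "norm (f z) \<le> B" if "norm z < 1" for z
    using that by simp
  define G where "G k = osc_set f (1 / real (Suc k))" for k
  have G: "Gdelta_T (G k)" for k
    unfolding G_def by (intro Gdelta_osc_set holomorphic_on_imp_continuous_on hol)
  have "s \<in> E \<longleftrightarrow> (\<exists>k. s \<in> G k)" if "norm s = 1" for s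
  proof -
    have "s \<in> E \<longleftrightarrow> \<not> radial_limit_exists f s"
      using lim that by simp
    then show ?thesis
      unfolding no_radial_limit_iff[OF that] G_def .
  qed
  moreover have "G k \<subseteq> sphere 0 1" for k
    by (auto simp: G_def osc_set_def)
  ultimately have E_eq: "E = (\<Union>k. G k)"
    using E by (fastforce simp: subset_iff)
  then have Gs: "Gdelta_sigma_T E"
    using G unfolding Gdelta_sigma_T_def by blast
  have "G k \<in> null_sets circ" for k
  proof (rule null_setsI)
    have "measure circ (G k) = 0"
      unfolding G_def by (rule measure_osc_set[OF hol B]) auto
    then show "emeasure circ (G k) = 0"
      by (simp add: circ.emeasure_eq_measure)
  qed (rule Gdelta_T_sets_circ[OF G])
  then have "E \<in> null_sets circ"
    unfolding E_eq by (intro null_sets_UN) auto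
  then show ?thesis
    using Gs arc_null_iff[of E] by auto
qed

section \<open>Herglotz integrals\<close>

text \<open>The analytic completion of the Poisson integral of \<open>u\<close>, normalised to be
  real at 0.\<close>

definition herglotz :: "(complex \<Rightarrow> real) \<Rightarrow> complex \<Rightarrow> complex" where
  "herglotz u z = (LINT w|circ. of_real (u w) * ((w + z) / (w - z))) / of_real (2 * pi)"

lemma continuous_on_herglotz_kernel:
  assumes "continuous_on (sphere 0 1) u" "norm z < 1"
  shows "continuous_on (sphere 0 1) (\<lambda>w. complex_of_real (u w) * ((w + z) / (w - z)))"
  using assms by (auto intro!: continuous_intros)

text \<open>Since (w + z) / (w - z) = 2 w / (w - z) - 1, the integral is an affine function of a
  Cauchy integral, for which differentiation under the integral sign is available.\<close>

lemma herglotz_holomorphic: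
  assumes u: "continuous_on (sphere 0 1) u"
  shows "herglotz u holomorphic_on ball 0 1"
proof -
  define \<phi> where "\<phi> w = complex_of_real (u w)" for w
  have c\<phi>: "continuous_on (sphere 0 1) \<phi>"
    unfolding \<phi>_def by (intro continuous_intros u)
  define g where "g z = \<i> * (LINT w|circ. \<phi> w * (w / (w - z)))" for z
  have "(g has_field_derivative (of_nat 1 * contour_integral (circlepath 0 1) (\<lambda>w. \<phi> w / (w - z) ^ Suc 1))) (at z)"
    if z: "z \<in> ball 0 1" for z
  proof (rule Cauchy_next_derivative_circlepath(2))
    show "continuous_on (path_image (circlepath 0 1)) \<phi>"
      using c\<phi> by simp
    show "((\<lambda>w. \<phi> w / (w - z) ^ 1) has_contour_integral g z) (circlepath 0 1)" if "z \<in> ball 0 1" for z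
    proof -
      have "continuous_on (sphere 0 1) (\<lambda>w. \<i> * (\<phi> w * (w / (w - z))))"
        using that by (auto intro!: continuous_intros c\<phi>)
      from has_integral_circ[OF this]
      have "((\<lambda>t. \<i> * (\<phi> (cis t) * (cis t / (cis t - z)))) has_integral g z) {0..2 * pi}"
        unfolding g_def integral_mult_right_zero .
      then show ?thesis
        unfolding circlepath_def by (subst has_contour_integral_part_circlepath_iff) (auto simp: mult_ac)
    qed
  qed (use z in auto)
  then have hg: "g holomorphic_on ball 0 1"
    by (subst holomorphic_on_open) blast+
  have "herglotz u z = (2 * (- \<i> * g z) - (LINT w|circ. \<phi> w)) / of_real (2 * pi)" if z: "z \<in> ball 0 1" for z
  proof -
    have "(LINT w|circ. of_real (u w) * ((w + z) / (w - z))) = (LINT w|circ. 2 * (\<phi> w * (w / (w - z))) - \<phi> w)"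
    proof (intro Bochner_Integration.integral_cong refl)
      fix w assume "w \<in> space circ"
      then have "w \<noteq> z" using z by auto
      then show "of_real (u w) * ((w + z) / (w - z)) = 2 * (\<phi> w * (w / (w - z))) - \<phi> w"
        by (simp add: \<phi>_def field_simps)
    qed
    also have "\<dots> = (LINT w|circ. 2 * (\<phi> w * (w / (w - z)))) - (LINT w|circ. \<phi> w)"
      using z by (intro Bochner_Integration.integral_diff integrable_circ c\<phi>) (auto intro!: continuous_intros c\<phi>)
    also have "(LINT w|circ. 2 * (\<phi> w * (w / (w - z)))) = 2 * (LINT w|circ. \<phi> w * (w / (w - z)))"
      by (rule integral_mult_right_zero)
    also have "(LINT w|circ. \<phi> w * (w / (w - z))) = - \<i> * g z"
      by (simp only: g_def) simp
    finally show ?thesis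
      by (simp only: herglotz_def)
  qed
  moreover have "(\<lambda>z. (2 * (- \<i> * g z) - (LINT w|circ. \<phi> w)) / of_real (2 * pi)) holomorphic_on ball 0 1"
    by (intro holomorphic_intros hg) auto
  ultimately show ?thesis
    by (subst holomorphic_cong[OF refl]) auto
qed

lemma Re_herglotz:
  assumes u: "continuous_on (sphere 0 1) u" and z: "norm z < 1"
  shows "Re (herglotz u z) = (LINT w|circ. u w * poisson z w) / (2 * pi)"
proof -
  have "Re (LINT w|circ. of_real (u w) * ((w + z) / (w - z))) = (LINT w|circ. Re (of_real (u w) * ((w + z) / (w - z))))"
    by (intro integral_Re[symmetric] integrable_circ continuous_on_herglotz_kernel u z)
  also have "\<dots> = (LINT w|circ. u w * poisson z w)"
  proof (intro Bochner_Integration.integral_cong refl)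
    fix w assume "w \<in> space circ"
    then have w: "norm w = 1" by simp
    have "Re ((w + z) * cnj (w - z)) = (norm w)\<^sup>2 - (norm z)\<^sup>2"
      unfolding cmod_power2 by (simp add: algebra_simps power2_eq_square)
    then have "Re ((w + z) / (w - z)) = poisson z w"
      unfolding complex_div_cnj[of "w + z"] Re_divide_of_real[symmetric]
      by (simp add: poisson_def w)
    then show "Re (of_real (u w) * ((w + z) / (w - z))) = u w * poisson z w"
      by (simp only: scaleR_conv_of_real[symmetric] scaleR_complex.simps)
  qed
  finally show ?thesis
    by (simp add: herglotz_def del: of_real_mult)
qed

text \<open>The numerator of the kernel is at most 2 and the factor \<open>norm (w - z)\<close> in
  the hypothesis cancels the denominator, leaving the constant 4 / (2 pi) <= 1. It is used with C =
  1 / (1 - |z|) for general points and with C = 1 on radii ending in the closed set.\<close>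

lemma norm_herglotz_le:
  assumes u: "continuous_on (sphere 0 1) u" and z: "norm z < 1"
    and v: "continuous_on (sphere 0 1) v"
    and le: "\<And>w. norm w = 1 \<Longrightarrow> \<bar>u w\<bar> \<le> 2 * v w * norm (w - z) * C" and C: "C \<ge> 0"
    and v0: "\<And>w. norm w = 1 \<Longrightarrow> 0 \<le> v w"
  shows "norm (herglotz u z) \<le> C * (LINT w|circ. v w)"
proof -
  have "norm (LINT w|circ. of_real (u w) * ((w + z) / (w - z))) \<le> (LINT w|circ. norm (of_real (u w) * ((w + z) / (w - z))))"
    by simp
  also have "\<dots> \<le> (LINT w|circ. 4 * C * v w)"
  proof (rule integral_circ_mono)
    show "continuous_on (sphere 0 1) (\<lambda>w. norm (complex_of_real (u w) * ((w + z) / (w - z))))"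
      by (intro continuous_intros continuous_on_herglotz_kernel u z)
    show "continuous_on (sphere 0 1) (\<lambda>w. 4 * C * v w)"
      by (intro continuous_intros v)
    fix w :: complex assume w: "norm w = 1"
    have wz: "norm (w - z) > 0" using w z by auto
    have "norm (w + z) \<le> 2"
      using norm_triangle_ineq[of w z] w z by simp
    then have "\<bar>u w\<bar> * norm (w + z) \<le> (2 * v w * norm (w - z) * C) * 2"
      using le[OF w] order_trans[OF abs_ge_zero le[OF w]] by (intro mult_mono) simp_all
    then show "norm (complex_of_real (u w) * ((w + z) / (w - z))) \<le> 4 * C * v w"
      using wz by (simp add: norm_mult norm_divide divide_simps mult_ac)
  qed
  finally have "norm (LINT w|circ. of_real (u w) * ((w + z) / (w - z))) / (2 * pi) \<le> (LINT w|circ. 4 * C * v w) / (2 * pi)"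
    by (rule divide_right_mono) simp
  also have "norm (LINT w|circ. of_real (u w) * ((w + z) / (w - z))) / (2 * pi) = norm (herglotz u z)"
    by (simp only: herglotz_def norm_divide norm_of_real) simp
  finally have "norm (herglotz u z) \<le> 4 * C * (LINT w|circ. v w) / (2 * pi)"
    by simp
  also have "\<dots> = (2 / pi) * (C * (LINT w|circ. v w))"
    by simp
  also have "\<dots> \<le> 1 * (C * (LINT w|circ. v w))"
    using pi_ge_two C integral_circ_nonneg[of v] v0 by (intro mult_right_mono) auto
  finally show ?thesis by simp
qed

text \<open>One radius must serve all \<open>s\<close>, hence uniform continuity. Near
  \<open>s\<close> the variation of \<open>u\<close> is below \<delta>/2; far from \<open>s\<close>
  the kernel itself is small. Each contributes at most \<pi> \<delta> to the integral, of total mass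
  2 \<pi>.\<close>

lemma herglotz_approx:
  assumes u: "continuous_on (sphere 0 1) u" and \<delta>: "\<delta> > 0"
  obtains R where "0 < R" "R < 1" "\<And>s. norm s = 1 \<Longrightarrow> \<bar>Re (herglotz u (of_real R * s)) - u s\<bar> \<le> \<delta>"
proof -
  have "uniformly_continuous_on (sphere 0 1) u"
    by (intro compact_uniformly_continuous u) simp
  then obtain d where d: "d > 0" "\<And>s w. norm s = 1 \<Longrightarrow> norm w = 1 \<Longrightarrow> dist w s < d \<Longrightarrow> dist (u w) (u s) < \<delta> / 2"
    unfolding uniformly_continuous_on_def using \<delta> by (auto dest!: spec[of _ "\<delta> / 2"])
  have "bounded (u ` sphere 0 1)"
    by (intro compact_imp_bounded compact_continuous_image u) simp
  then obtain M where M: "M > 0" "\<forall>x\<in>u ` sphere 0 1. norm x \<le> M"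
    unfolding bounded_pos by blast
  \<comment> \<open>The bound d/2 keeps the point \<open>of_real R * s\<close> so close to
    \<open>s\<close> that points w at distance at least d from \<open>s\<close> are still at
    distance d/2 from it; the last bound then makes the kernel there at most \<delta> / (4
    M).\<close>
  define h where "h = min (1 / 2) (min (d / 2) (\<delta> * d\<^sup>2 / (32 * M)))"
  have h: "0 < h" "h < 1" "h \<le> d / 2" "h \<le> \<delta> * d\<^sup>2 / (32 * M)"
    using d M \<delta> by (auto simp: h_def)
  define R where "R = 1 - h"
  have R: "0 < R" "R < 1" using h by (auto simp: R_def)
  have "\<bar>Re (herglotz u (of_real R * s)) - u s\<bar> \<le> \<delta>" if s: "norm s = 1" for s
  proof -
    have Rs: "norm (of_real R * s) < 1" using R s by (simp add: norm_mult)
    have nRs: "norm (of_real R * s) = R" using R s by (simp add: norm_mult)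
    have "(LINT w|circ. u w * poisson (of_real R * s) w) - 2 * pi * u s
       = (LINT w|circ. u w * poisson (of_real R * s) w) - (LINT w|circ. u s * poisson (of_real R * s) w)"
      by (simp add: integral_poisson[OF Rs])
    also have "\<dots> = (LINT w|circ. u w * poisson (of_real R * s) w - u s * poisson (of_real R * s) w)"
      by (intro Bochner_Integration.integral_diff[symmetric] integrable_circ continuous_intros u Rs)
    finally have "\<bar>(LINT w|circ. u w * poisson (of_real R * s) w) - 2 * pi * u s\<bar>
      = norm (LINT w|circ. u w * poisson (of_real R * s) w - u s * poisson (of_real R * s) w)"
      by simp
    also have "\<dots> \<le> (LINT w|circ. norm (u w * poisson (of_real R * s) w - u s * poisson (of_real R * s) w))"
      by simp
    also have "\<dots> \<le> (LINT w|circ. \<delta> / 2 * poisson (of_real R * s) w + \<delta> / 2)"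
    proof (rule integral_circ_mono)
      fix w :: complex assume w: "norm w = 1"
      define P where "P = poisson (of_real R * s) w"
      have P0: "P \<ge> 0" unfolding P_def by (rule poisson_nonneg[OF Rs])
      have "\<bar>u w - u s\<bar> * P \<le> \<delta> / 2 * P + \<delta> / 2"
      proof (cases "dist w s < d")
        case True
        then have "\<bar>u w - u s\<bar> * P \<le> \<delta> / 2 * P"
          using d(2)[OF s w True] P0 by (intro mult_right_mono) (auto simp: dist_real_def)
        then show ?thesis using \<delta> by simp
      next
        case False
        have "norm (w - s) \<le> norm (w - of_real R * s) + norm (of_real R * s - s)"
          using norm_triangle_ineq[of "w - of_real R * s" "of_real R * s - s"] by simp
        then have "d \<le> norm (w - of_real R * s) + h"
          using False norm_radius_le[OF s, of R] R by (simp add: dist_norm R_def)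
        then have far: "d / 2 \<le> norm (w - of_real R * s)" using h by simp
        have "P \<le> (1 - R\<^sup>2) / (d / 2)\<^sup>2"
          unfolding P_def poisson_def nRs using far d R
          by (intro divide_left_mono power_mono mult_pos_pos) (auto simp: power_le_one)
        also have "1 - R\<^sup>2 \<le> 2 * h"
          using R unfolding R_def by (simp add: power2_eq_square algebra_simps)
        then have "(1 - R\<^sup>2) / (d / 2)\<^sup>2 \<le> 2 * h / (d / 2)\<^sup>2"
          by (intro divide_right_mono) auto
        also have "2 * h / (d / 2)\<^sup>2 \<le> 2 * (\<delta> * d\<^sup>2 / (32 * M)) / (d / 2)\<^sup>2"
          using h(4) by (intro divide_right_mono mult_left_mono) auto
        also have "\<dots> = \<delta> / (4 * M)"
          using d M by (simp add: field_simps power2_eq_square)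
        finally have P: "P \<le> \<delta> / (4 * M)" .
        have "\<bar>u w\<bar> \<le> M" "\<bar>u s\<bar> \<le> M"
          using M(2) s w by auto
        then have "\<bar>u w - u s\<bar> \<le> 2 * M" by simp
        then have "\<bar>u w - u s\<bar> * P \<le> 2 * M * (\<delta> / (4 * M))"
          using P P0 M by (intro mult_mono) auto
        also have "\<dots> = \<delta> / 2" using M by simp
        finally have "\<bar>u w - u s\<bar> * P \<le> \<delta> / 2" .
        moreover have "0 \<le> \<delta> / 2 * P" using \<delta> P0 by simp
        ultimately show ?thesis by linarith
      qed
      moreover have "u w * P - u s * P = (u w - u s) * P"
        by (simp add: left_diff_distrib)
      ultimately show "norm (u w * poisson (of_real R * s) w - u s * poisson (of_real R * s) w) \<le> \<delta> / 2 * poisson (of_real R * s) w + \<delta> / 2"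
        using P0 by (simp add: P_def abs_mult)
    qed (intro continuous_intros u Rs)+
    also have "\<dots> = (LINT w|circ. \<delta> / 2 * poisson (of_real R * s) w) + (LINT w|circ. \<delta> / 2)"
      by (intro Bochner_Integration.integral_add integrable_circ continuous_intros Rs)
    also have "\<dots> = 2 * pi * \<delta>"
      by (simp add: integral_poisson[OF Rs])
    finally have le: "\<bar>(LINT w|circ. u w * poisson (of_real R * s) w) - 2 * pi * u s\<bar> \<le> 2 * pi * \<delta>" .
    have "Re (herglotz u (of_real R * s)) - u s = ((LINT w|circ. u w * poisson (of_real R * s) w) - 2 * pi * u s) / (2 * pi)"
      unfolding Re_herglotz[OF u Rs] by (simp add: diff_divide_distrib)
    then have "\<bar>Re (herglotz u (of_real R * s)) - u s\<bar> = \<bar>(LINT w|circ. u w * poisson (of_real R * s) w) - 2 * pi * u s\<bar> / (2 * pi)"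
      by simp
    also have "\<dots> \<le> 2 * pi * \<delta> / (2 * pi)"
      by (intro divide_right_mono le) simp
    finally show ?thesis by simp
  qed
  with R show ?thesis by (rule that)
qed

text \<open>The mean of f^2 is f(0)^2, which is nonnegative because f(0) is real, and Re (f^2) = 2
  (Re f)^2 - |f|^2. This is the square-mean bound for the conjugate function.\<close>

lemma analytic_l2_le_Re:
  assumes f: "continuous_on (cball 0 1) f" "f holomorphic_on ball 0 1" and "Im (f 0) = 0"
  shows "(LINT w|circ. (norm (f w))\<^sup>2) \<le> 2 * (LINT w|circ. (Re (f w))\<^sup>2)"
proof -
  have cf: "continuous_on (sphere 0 1) f"
    using f(1) continuous_on_subset by fastforce
  have "(LINT w|circ. (f w)\<^sup>2) = (LINT w|circ. (f w)\<^sup>2 * (w / (w - 0)))"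
    by (intro Bochner_Integration.integral_cong) auto
  also have "\<dots> = 2 * of_real pi * (f 0)\<^sup>2"
    by (rule circ_Cauchy) (auto intro!: continuous_intros holomorphic_intros f)
  also have "(f 0)\<^sup>2 = of_real ((Re (f 0))\<^sup>2)"
    using assms(3) by (simp add: complex_eq_iff power2_eq_square)
  finally have "(LINT w|circ. (f w)\<^sup>2) = of_real (2 * pi * (Re (f 0))\<^sup>2)"
    by simp
  then have "2 * pi * (Re (f 0))\<^sup>2 = Re (LINT w|circ. (f w)\<^sup>2)"
    by (simp only: Re_complex_of_real)
  also have "\<dots> = (LINT w|circ. Re ((f w)\<^sup>2))"
    by (intro integral_Re[symmetric] integrable_circ continuous_intros cf)
  also have "\<dots> = (LINT w|circ. 2 * (Re (f w))\<^sup>2 - (norm (f w))\<^sup>2)"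
  proof (intro Bochner_Integration.integral_cong refl)
    show "Re ((f w)\<^sup>2) = 2 * (Re (f w))\<^sup>2 - (norm (f w))\<^sup>2" for w
      using cmod_power2[of "f w"] by (simp add: power2_eq_square)
  qed
  also have "\<dots> = 2 * (LINT w|circ. (Re (f w))\<^sup>2) - (LINT w|circ. (norm (f w))\<^sup>2)"
    by (subst Bochner_Integration.integral_diff) (auto intro!: integrable_circ continuous_intros cf)
  finally have "2 * (LINT w|circ. (Re (f w))\<^sup>2) - (LINT w|circ. (norm (f w))\<^sup>2) = 2 * pi * (Re (f 0))\<^sup>2" ..
  moreover have "2 * pi * (Re (f 0))\<^sup>2 \<ge> 0" by simp
  ultimately show ?thesis by linarith
qed

section \<open>One step of the iteration\<close>

lemma infdist_sphere_le:
  assumes "F \<subseteq> sphere 0 (1::real)" "F \<noteq> {}" "norm w = 1"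
  shows "infdist w F \<le> 2"
proof -
  obtain a where a: "a \<in> F" using assms(2) by blast
  then have "infdist w F \<le> dist w a" by (rule infdist_le)
  also have "\<dots> \<le> 2"
    using dist_triangle[of w a 0] a assms by (auto simp: dist_norm)
  finally show ?thesis .
qed

text \<open>Turns a weight \<open>v\<close> into an analytic function whose boundary real part is
  about \<open>infdist s F * v s\<close>, and returns a majorant \<open>v'\<close> of its radial
  maximal function, ready to enter the next weight. The cost in square mean is a fixed factor,
  whatever \<open>F\<close>, \<open>v\<close> and \<delta> are.\<close>

lemma one_stage:
  fixes v :: "complex \<Rightarrow> real"
  assumes F: "F \<subseteq> sphere 0 1" "F \<noteq> {}"
    and v: "continuous_on (sphere 0 1) v" and v0: "\<And>w. norm w = 1 \<Longrightarrow> 0 \<le> v w"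
    and \<delta>: "\<delta> > 0"
  obtains G v' where "G holomorphic_on ball 0 1" "continuous_on (cball 0 1) G"
    "\<And>z. norm z < 1 \<Longrightarrow> 0 \<le> Re (G z)"
    "\<And>z. norm z < 1 \<Longrightarrow> norm (G z) \<le> (LINT w|circ. v w) / (1 - norm z)"
    "\<And>s r. s \<in> F \<Longrightarrow> 0 \<le> r \<Longrightarrow> r < 1 \<Longrightarrow> norm (G (of_real r * s)) \<le> (LINT w|circ. v w)"
    "\<And>s. norm s = 1 \<Longrightarrow> infdist s F * v s - \<delta> \<le> Re (G s)"
    "continuous_on (sphere 0 1) v'"
    "\<And>s r. norm s = 1 \<Longrightarrow> 0 \<le> r \<Longrightarrow> r \<le> 1 \<Longrightarrow> norm (G (of_real r * s)) \<le> v' s"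
    "(LINT w|circ. (v' w)\<^sup>2) \<le> 1500000 * ((LINT w|circ. (v w)\<^sup>2) + \<delta>\<^sup>2)"
proof -
  define u where "u w = infdist w F * v w" for w
  have u: "continuous_on (sphere 0 1) u"
    unfolding u_def by (intro continuous_intros v)
  have u_le: "\<bar>u w\<bar> \<le> 2 * v w" "0 \<le> u w" if "norm w = 1" for w
    using infdist_sphere_le[OF F that] infdist_nonneg[of w F] v0[OF that]
    by (auto simp: u_def abs_mult intro!: mult_right_mono)
  define I where "I = (LINT w|circ. v w)"
  have I0: "I \<ge> 0" unfolding I_def by (intro integral_circ_nonneg v0)
  obtain R where R: "0 < R" "R < 1" and approx: "\<And>s. norm s = 1 \<Longrightarrow> \<bar>Re (herglotz u (of_real R * s)) - u s\<bar> \<le> \<delta>"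
    using herglotz_approx[OF u \<delta>] by metis
  \<comment> \<open>The dilation makes \<open>G\<close> continuous on the closed disc, so that it
    has a radial limit at every boundary point; \<delta> pays for the change of boundary
    values.\<close>
  define G where "G z = herglotz u (of_real R * z)" for z
  have nR: "norm (of_real R * z) < 1" if "norm z \<le> 1" for z :: complex
  proof -
    have "R * norm z \<le> R * 1" using R that by (intro mult_left_mono) auto
    then have "R * norm z < 1" using R by linarith
    then show ?thesis using R by (simp add: norm_mult)
  qed
  have hol: "G holomorphic_on ball 0 1"
  proof -
    have "(herglotz u \<circ> (\<lambda>z. of_real R * z)) holomorphic_on ball 0 1"
      using nR by (intro holomorphic_on_compose_gen[OF _ herglotz_holomorphic[OF u]] holomorphic_intros) auto
    then show ?thesis by (simp add: o_def G_def[abs_def])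
  qed
  have cont: "continuous_on (cball 0 1) G"
    unfolding G_def using nR
    by (intro continuous_on_compose2[OF holomorphic_on_imp_continuous_on[OF herglotz_holomorphic[OF u]]] continuous_intros) auto
  have cG: "continuous_on (sphere 0 1) G"
    using cont by (rule continuous_on_subset) auto
  have ReG: "0 \<le> Re (G z)" if "norm z < 1" for z
    unfolding G_def Re_herglotz[OF u nR[OF less_imp_le[OF that]]]
    using u_le(2) nR[OF less_imp_le[OF that]]
    by (intro divide_nonneg_nonneg integral_circ_nonneg mult_nonneg_nonneg poisson_nonneg) auto
  have bound: "norm (G z) \<le> I / (1 - norm z)" if z: "norm z < 1" for z
  proof -
    have "norm (G z) \<le> (1 / (1 - norm z)) * (LINT w|circ. v w)"
      unfolding G_def
    proof (rule norm_herglotz_le[OF u _ v])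
      show "norm (of_real R * z) < 1" using nR z by simp
      fix w :: complex assume w: "norm w = 1"
      have "norm (of_real R * z) \<le> norm z"
        using R by (simp add: norm_mult mult_left_le_one_le)
      then have "1 - norm z \<le> norm (w - of_real R * z)"
        using norm_triangle_ineq2[of w "of_real R * z"] w by linarith
      then have "1 \<le> norm (w - of_real R * z) * (1 / (1 - norm z))"
        using z by (simp add: field_simps)
      then have "2 * v w * 1 \<le> 2 * v w * (norm (w - of_real R * z) * (1 / (1 - norm z)))"
        using v0[OF w] by (intro mult_left_mono) auto
      then show "\<bar>u w\<bar> \<le> 2 * v w * norm (w - of_real R * z) * (1 / (1 - norm z))"
        using u_le(1)[OF w] by (simp only: mult.assoc mult_1_right)
    qed (use z v0 in auto)
    then show ?thesis by (simp add: I_def)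
  qed
  \<comment> \<open>For s in \<open>F\<close> and z = q s, the distance from w to \<open>F\<close>
    is at most |w - s| <= |w - z| + (1 - q) <= 2 |w - z|, so the bound no longer depends on the
    distance to the circle.\<close>
  have boundF: "norm (G (of_real r * s)) \<le> I" if s: "s \<in> F" and r: "0 \<le> r" "r < 1" for s r
  proof -
    have ns: "norm s = 1" using s F by auto
    define q where "q = R * r"
    have q: "0 \<le> q" "q < 1"
      using R r mult_strict_mono[of R 1 r 1] by (auto simp: q_def)
    have "norm (herglotz u (of_real q * s)) \<le> 1 * (LINT w|circ. v w)"
    proof (rule norm_herglotz_le[OF u _ v])
      show nq: "norm (of_real q * s) < 1" using q ns by (simp add: norm_mult)
      fix w :: complex assume w: "norm w = 1"
      have "infdist w F \<le> norm (w - s)"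
        using infdist_le[OF s, of w] by (simp add: dist_norm)
      also have "norm (w - s) \<le> norm (w - of_real q * s) + norm (of_real q * s - s)"
        using norm_triangle_ineq[of "w - of_real q * s" "of_real q * s - s"] by simp
      also have "norm (of_real q * s - s) = 1 - q"
        using norm_radius_le[OF ns] q by simp
      also have "1 - q \<le> norm (w - of_real q * s)"
        using norm_triangle_ineq2[of w "of_real q * s"] w ns q by (simp add: norm_mult)
      finally have "infdist w F \<le> 2 * norm (w - of_real q * s)" by simp
      then have "infdist w F * v w \<le> 2 * norm (w - of_real q * s) * v w"
        using v0[OF w] by (rule mult_right_mono)
      then show "\<bar>u w\<bar> \<le> 2 * v w * norm (w - of_real q * s) * 1"
        using u_le(2)[OF w] by (simp add: u_def mult_ac)
    qed (use v0 in auto)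
    then show ?thesis by (simp add: G_def q_def I_def mult.assoc)
  qed
  have lower: "infdist s F * v s - \<delta> \<le> Re (G s)" if "norm s = 1" for s
    using approx[OF that] by (simp add: G_def u_def abs_le_iff)
  have Im0: "Im (G 0) = 0"
  proof -
    have "(LINT w|circ. of_real (u w) * ((w + 0) / (w - 0))) = (LINT w|circ. complex_of_real (u w))"
      by (intro Bochner_Integration.integral_cong) auto
    also have "\<dots> = of_real (LINT w|circ. u w)"
      by (rule integral_complex_of_real)
    finally show ?thesis
      by (simp add: G_def herglotz_def)
  qed
  define V where "V = (LINT w|circ. (v w)\<^sup>2)"
  have l2: "(LINT w|circ. (norm (G w))\<^sup>2) \<le> 16 * V + 8 * pi * \<delta>\<^sup>2"
  proof -
    have "(LINT w|circ. (Re (G w))\<^sup>2) \<le> (LINT w|circ. 8 * (v w)\<^sup>2 + 2 * \<delta>\<^sup>2)"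
    proof (rule integral_circ_mono)
      fix w :: complex assume w: "norm w = 1"
      have "\<bar>Re (G w)\<bar> \<le> \<bar>2 * v w + \<delta>\<bar>"
        using approx[OF w] u_le[OF w] \<delta> v0[OF w] by (simp add: G_def)
      then have "(Re (G w))\<^sup>2 \<le> (2 * v w + \<delta>)\<^sup>2"
        by (simp add: abs_le_square_iff)
      also have "\<dots> \<le> 8 * (v w)\<^sup>2 + 2 * \<delta>\<^sup>2"
        using sum_squares_bound[of "2 * v w" \<delta>] by (simp add: power2_sum power_mult_distrib)
      finally show "(Re (G w))\<^sup>2 \<le> 8 * (v w)\<^sup>2 + 2 * \<delta>\<^sup>2" .
    qed (intro continuous_intros cG v)+
    also have "\<dots> = 8 * V + 4 * pi * \<delta>\<^sup>2"
      unfolding V_def by (subst Bochner_Integration.integral_add) (auto intro!: integrable_circ continuous_intros v)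
    finally show ?thesis
      using analytic_l2_le_Re[OF cont hol Im0] by linarith
  qed
  \<comment> \<open>A fine finite grid of radii controls all radii up to \<delta>, so the maximal
    inequality for finitely many radii suffices.\<close>
  have "uniformly_continuous_on (cball 0 1) G"
    by (intro compact_uniformly_continuous cont) simp
  then obtain d where d: "d > 0" "\<And>z w. norm z \<le> 1 \<Longrightarrow> norm w \<le> 1 \<Longrightarrow> dist w z < d \<Longrightarrow> dist (G w) (G z) < \<delta>"
    unfolding uniformly_continuous_on_def using \<delta> by (auto dest!: spec[of _ \<delta>])
  obtain N where N: "1 / real (Suc N) < d"
    using d(1) nat_approx_posE by blast
  define \<rho> where "\<rho> k = real k / real (Suc N)" for k
  have \<rho>: "0 \<le> \<rho> k \<and> \<rho> k < 1" if "k \<le> N" for k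
    using that by (simp add: \<rho>_def)
  define X where "X s = (MAX k\<in>{..N}. norm (G (of_real (\<rho> k) * s)))" for s
  define v' where "v' s = X s + \<delta>" for s
  have cX: "continuous_on (sphere 0 1) X"
    unfolding X_def
  proof (rule continuous_on_Max_fun)
    fix k assume "k \<le> N"
    with \<rho> have "norm (of_real (\<rho> k) * s) \<le> 1" if "norm s = 1" for s :: complex
      using that by (simp add: norm_mult less_imp_le)
    then show "continuous_on (sphere 0 1) (\<lambda>s. norm (G (of_real (\<rho> k) * s)))"
      by (intro continuous_intros continuous_on_compose2[OF cont]) auto
  qed
  have cv': "continuous_on (sphere 0 1) v'"
    unfolding v'_def by (intro continuous_intros cX)
  have maxi: "norm (G (of_real r * s)) \<le> v' s" if s: "norm s = 1" and r: "0 \<le> r" "r \<le> 1" for s r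
  proof -
    \<comment> \<open>The cap at \<open>N\<close> matters only for r = 1: the grid stops one step
      short of the circle.\<close>
    define k where "k = min N (nat \<lfloor>r * real (Suc N)\<rfloor>)"
    have kN: "k \<le> N" by (simp add: k_def)
    have "\<bar>r - \<rho> k\<bar> \<le> 1 / real (Suc N)"
    proof (cases "nat \<lfloor>r * real (Suc N)\<rfloor> \<le> N")
      case True
      then have k: "real k = of_int \<lfloor>r * real (Suc N)\<rfloor>" using r by (simp add: k_def)
      then have "real k \<le> r * real (Suc N)" "r * real (Suc N) < real k + 1" by linarith+
      then have "\<rho> k \<le> r" "r < \<rho> k + 1 / real (Suc N)"
        by (auto simp: \<rho>_def field_simps)
      then show ?thesis by simp
    next
      case False
      then have "k = N" by (simp add: k_def)
      have "real (Suc N) \<le> real (nat \<lfloor>r * real (Suc N)\<rfloor>)" using False by linarith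
      also have "\<dots> \<le> r * real (Suc N)" using r by simp
      finally have "r = 1" using r by simp
      then show ?thesis using \<open>k = N\<close> by (simp add: \<rho>_def field_simps)
    qed
    then have "\<bar>r - \<rho> k\<bar> < d" using N by simp
    moreover have "norm (of_real r * s - of_real (\<rho> k) * s) = \<bar>r - \<rho> k\<bar>"
    proof -
      have "of_real r * s - of_real (\<rho> k) * s = of_real (r - \<rho> k) * s" by (simp add: algebra_simps)
      then show ?thesis using s by (simp only: norm_mult norm_of_real) simp
    qed
    ultimately have "dist (G (of_real r * s)) (G (of_real (\<rho> k) * s)) < \<delta>"
      using \<rho>[OF kN] r s by (intro d(2)) (auto simp: norm_mult dist_norm)
    then have "norm (G (of_real r * s)) \<le> norm (G (of_real (\<rho> k) * s)) + \<delta>"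
      using norm_triangle_ineq2[of "G (of_real r * s)" "G (of_real (\<rho> k) * s)"] by (simp add: dist_norm)
    also have "norm (G (of_real (\<rho> k) * s)) \<le> X s"
      unfolding X_def using kN by (intro Max_ge) auto
    finally show ?thesis by (simp add: v'_def)
  qed
  have "(LINT w|circ. (v' w)\<^sup>2) \<le> (LINT w|circ. 2 * (X w)\<^sup>2 + 2 * \<delta>\<^sup>2)"
  proof (rule integral_circ_mono)
    fix w show "(v' w)\<^sup>2 \<le> 2 * (X w)\<^sup>2 + 2 * \<delta>\<^sup>2"
      using sum_squares_bound[of "X w" \<delta>] by (simp add: power2_sum v'_def)
  qed (intro continuous_intros cX cv')+
  also have "\<dots> = 2 * (LINT w|circ. (X w)\<^sup>2) + 4 * pi * \<delta>\<^sup>2"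
    by (subst Bochner_Integration.integral_add) (auto intro!: integrable_circ continuous_intros cX)
  finally have "(LINT w|circ. (v' w)\<^sup>2) \<le> 2 * (LINT w|circ. (X w)\<^sup>2) + 4 * pi * \<delta>\<^sup>2" .
  also have "2 * (LINT w|circ. (X w)\<^sup>2) + 4 * pi * \<delta>\<^sup>2 \<le> 2 * (20736 * (LINT w|circ. (norm (G w))\<^sup>2)) + 4 * pi * \<delta>\<^sup>2"
    unfolding X_def by (intro add_right_mono mult_left_mono radial_maximal_inequality[OF cont hol \<rho>]) auto
  also have "\<dots> \<le> 2 * (20736 * (16 * V + 8 * pi * \<delta>\<^sup>2)) + 4 * pi * \<delta>\<^sup>2"
    by (intro add_right_mono mult_left_mono l2) auto
  finally have "(LINT w|circ. (v' w)\<^sup>2) \<le> 2 * (20736 * (16 * V + 8 * pi * \<delta>\<^sup>2)) + 4 * pi * \<delta>\<^sup>2" .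
  moreover have "pi * \<delta>\<^sup>2 \<le> 4 * \<delta>\<^sup>2"
    using pi_less_4 by (intro mult_right_mono) auto
  moreover have "V \<ge> 0" unfolding V_def by (rule integral_circ_nonneg) simp
  \<comment> \<open>Here 663552 = 2 * 20736 * 16 and 331780 = 2 * 20736 * 8 + 4; with \<pi> < 4 both
    coefficients stay below 1500000.\<close>
  ultimately have "(LINT w|circ. (v' w)\<^sup>2) \<le> 663552 * V + 331780 * (pi * \<delta>\<^sup>2)"
    and "pi * \<delta>\<^sup>2 \<le> 4 * \<delta>\<^sup>2" "V \<ge> 0"
    by (simp_all add: algebra_simps)
  then have "(LINT w|circ. (v' w)\<^sup>2) \<le> 1500000 * (V + \<delta>\<^sup>2)"
    using zero_le_power2[of \<delta>] unfolding distrib_left by linarith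
  then show ?thesis
    using that[OF hol cont ReG _ _ lower cv' maxi] bound boundF by (simp add: I_def V_def)
qed

section \<open>Series along radii\<close>

text \<open>The majorant may blow up at the circle: convergence is uniform on compact subsets of the
  disc only, which suffices for holomorphy and still permits infinite radial limits of the
  sum.\<close>

lemma holomorphic_suminf:
  assumes hol: "\<And>n::nat. f n holomorphic_on ball 0 1"
    and bound: "\<forall>n z. norm z < 1 \<longrightarrow> norm (f n z) \<le> M n / (1 - norm z)"
    and M: "summable M"
  shows "(\<lambda>z. \<Sum>n. f n z) holomorphic_on ball 0 1"
    and "\<And>z. norm z < 1 \<Longrightarrow> summable (\<lambda>n. norm (f n z))"
    and "\<And>z. norm z < 1 \<Longrightarrow> norm (\<Sum>n. f n z) \<le> suminf M / (1 - norm z)"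
proof -
  have bd: "norm (f n z) \<le> M n / (1 - norm z)" if "norm z < 1" for n z
    using bound that by blast
  have summ: "summable (\<lambda>n. M n / c)" for c using M by (rule summable_divide)
  show *: "summable (\<lambda>n. norm (f n z))" if "norm z < 1" for z
    by (rule summable_comparison_test'[OF summ[of "1 - norm z"]]) (use bd[OF that] in auto)
  show "norm (\<Sum>n. f n z) \<le> suminf M / (1 - norm z)" if "norm z < 1" for z
  proof -
    have "norm (\<Sum>n. f n z) \<le> (\<Sum>n. norm (f n z))"
      by (rule summable_norm[OF *[OF that]])
    also have "\<dots> \<le> (\<Sum>n. M n / (1 - norm z))"
      by (intro suminf_le * summ bd that)
    also have "\<dots> = suminf M / (1 - norm z)"
      by (rule suminf_divide[OF M])
    finally show ?thesis .
  qed
  have M0: "M n \<ge> 0" for n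
    using order_trans[OF norm_ge_zero bd[of 0 n]] by simp
  show "(\<lambda>z. \<Sum>n. f n z) holomorphic_on ball 0 1"
  proof (rule holomorphic_uniform_sequence)
    show "(\<lambda>z. \<Sum>i<n. f i z) holomorphic_on ball 0 1" for n
      by (intro holomorphic_intros hol)
    fix z :: complex assume z: "z \<in> ball 0 1"
    define d where "d = (1 - norm z) / 2"
    have d: "d > 0" using z by (simp add: d_def)
    have nw: "norm w \<le> 1 - d" if "w \<in> cball z d" for w
      using norm_triangle_ineq2[of w z] that by (simp add: d_def dist_norm norm_minus_commute field_simps)
    have "uniform_limit (cball z d) (\<lambda>n z. \<Sum>i<n. f i z) (\<lambda>z. \<Sum>n. f n z) sequentially"
    proof (rule Weierstrass_m_test[OF _ summ[of d]])
      fix n w assume "w \<in> cball z d"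
      then have w: "norm w \<le> 1 - d" by (rule nw)
      then have "norm (f n w) \<le> M n / (1 - norm w)"
        using d by (intro bd) auto
      also have "\<dots> \<le> M n / d"
        using w d M0 by (intro divide_left_mono) auto
      finally show "norm (f n w) \<le> M n / d" .
    qed
    moreover have "cball z d \<subseteq> ball 0 1"
      using nw d by (auto dest!: nw)
    ultimately show "\<exists>d>0. cball z d \<subseteq> ball 0 1 \<and> uniform_limit (cball z d) (\<lambda>n z. \<Sum>i<n. f i z) (\<lambda>z. \<Sum>n. f n z) sequentially"
      using d by blast
  qed simp
qed

text \<open>Tannery's theorem along one radius; the majorant may depend on the endpoint
  \<open>s\<close>.\<close>

lemma radial_limit_suminf:
  assumes lim: "\<And>n::nat. radial_limit_exists (f n) s"
    and bd: "\<And>n r. 0 \<le> r \<Longrightarrow> r < 1 \<Longrightarrow> norm (f n (of_real r * s)) \<le> M n"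
    and M: "summable M"
  shows "radial_limit_exists (\<lambda>z. \<Sum>n. f n z) s"
proof -
  obtain L where L: "\<And>n. ((\<lambda>r. f n (complex_of_real r * s)) \<longlongrightarrow> L n) (at_left 1)"
    using lim unfolding radial_limit_exists_def by metis
  have "eventually (\<lambda>r. \<forall>n. norm (f n (complex_of_real r * s)) \<le> M n) (at_left 1)"
    using eventually_at_left_1 by eventually_elim (use bd in auto)
  then have "eventually (\<lambda>(n, r). norm (f n (complex_of_real r * s)) \<le> M n) (at_top \<times>\<^sub>F at_left 1)"
    by (subst eventually_prod_filter) (auto intro!: exI[of _ "\<lambda>_. True"] exI[of _ "\<lambda>r. \<forall>n. norm (f n (complex_of_real r * s)) \<le> M n"])
  from tannerys_theorem[OF L this M] show ?thesis
    unfolding radial_limit_exists_def by auto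
qed

text \<open>As all real parts are nonnegative, every partial sum is a lower bound for the whole sum,
  and each partial sum has a limit.\<close>

lemma Re_suminf_at_top:
  fixes f :: "nat \<Rightarrow> complex \<Rightarrow> complex"
  assumes lim: "\<And>n. ((\<lambda>r. Re (f n (complex_of_real r * s))) \<longlongrightarrow> l n) (at_left 1)"
    and pos: "\<And>n r. 0 \<le> r \<Longrightarrow> r < 1 \<Longrightarrow> 0 \<le> Re (f n (of_real r * s))"
    and summ: "\<And>r. 0 \<le> r \<Longrightarrow> r < 1 \<Longrightarrow> summable (\<lambda>n. f n (of_real r * s))"
    and unb: "\<And>C. \<exists>N. C < (\<Sum>n<N. l n)"
  shows "filterlim (\<lambda>r. Re (\<Sum>n. f n (complex_of_real r * s))) at_top (at_left 1)"
proof (rule filterlim_at_top_dense[THEN iffD2, rule_format])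
  fix C :: real
  obtain N where N: "C < (\<Sum>n<N. l n)" using unb by blast
  have "((\<lambda>r. \<Sum>n<N. Re (f n (complex_of_real r * s))) \<longlongrightarrow> (\<Sum>n<N. l n)) (at_left 1)"
    by (intro tendsto_intros lim)
  from order_tendstoD(1)[OF this N] eventually_at_left_1
  show "eventually (\<lambda>r. C < Re (\<Sum>n. f n (complex_of_real r * s))) (at_left 1)"
  proof eventually_elim
    case (elim r)
    have s: "summable (\<lambda>n. f n (of_real r * s))" using elim by (intro summ) auto
    have "(\<Sum>n<N. Re (f n (complex_of_real r * s))) \<le> (\<Sum>n. Re (f n (complex_of_real r * s)))"
      using elim by (intro sum_le_suminf summable_Re s pos) auto
    also have "\<dots> = Re (\<Sum>n. f n (complex_of_real r * s))"
      by (rule Re_suminf[OF s, symmetric])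
    finally show ?case using elim by linarith
  qed
qed

text \<open>Outer regularity is applied to the measure transported to the plane. Intersecting with a
  larger disc leaves the trace on the circle unchanged and gives the open set a nonempty
  complement.\<close>

lemma null_set_outer_open:
  assumes "N \<in> null_sets circ" "\<epsilon> > 0"
  obtains V where "open V" "N \<subseteq> V" "bounded V" "measure circ (V \<inter> sphere 0 1) \<le> \<epsilon>"
proof -
  define M where "M = distr circ borel (\<lambda>x. x)"
  obtain B where B: "N = sphere 0 1 \<inter> B" "B \<in> sets borel"
    using null_setsD2[OF assms(1)] unfolding sets_circ sets_restrict_space by blast
  have N: "N \<in> sets borel"
    unfolding B(1) by (intro sets.Int B(2) borel_closed) simp
  have em: "emeasure M X = emeasure circ (X \<inter> sphere 0 1)" if "X \<in> sets borel" for X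
    unfolding M_def using that by (subst emeasure_distr) auto
  have "emeasure M N = (INF U\<in>{U. N \<subseteq> U \<and> open U}. emeasure M U)"
  proof (rule outer_regular)
    have "emeasure M (space M) = emeasure circ (sphere 0 1)"
      using em[of UNIV] by (simp add: M_def)
    then show "emeasure M (space M) \<noteq> \<infinity>"
      by (simp add: emeasure_circ)
  qed (auto simp: M_def N)
  moreover have "emeasure M N = 0"
  proof -
    have "N \<inter> sphere 0 1 = N" using B(1) by blast
    then show ?thesis using assms(1) em[OF N] by (simp add: null_sets_def)
  qed
  ultimately have "(INF U\<in>{U. N \<subseteq> U \<and> open U}. emeasure M U) < ennreal \<epsilon>"
    using assms(2) by simp
  then obtain U where U: "N \<subseteq> U" "open U" "emeasure M U < ennreal \<epsilon>"
    unfolding INF_less_iff by blast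
  have "emeasure circ (U \<inter> sphere 0 1) < ennreal \<epsilon>"
    using U by (simp add: em)
  then have m: "measure circ (U \<inter> sphere 0 1) < \<epsilon>"
    by (simp add: circ.emeasure_eq_measure ennreal_less_iff)
  have "(U \<inter> ball 0 2) \<inter> sphere 0 1 = U \<inter> sphere 0 (1::real)"
    by auto
  then have "measure circ ((U \<inter> ball 0 2) \<inter> sphere 0 1) \<le> \<epsilon>" using m by simp
  moreover have "N \<subseteq> U \<inter> ball 0 2" using U(1) B(1) by auto
  ultimately show ?thesis
    using U(2) by (intro that[of "U \<inter> ball 0 2"]) (auto intro: bounded_subset[OF bounded_ball])
qed

text \<open>Cauchy-Schwarz with the weights 2^-(n+1), whose sum is below 1.\<close>

lemma sum_power2_weighted_le:
  fixes x :: "nat \<Rightarrow> real"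
  shows "(\<Sum>n<m. x n)\<^sup>2 \<le> (\<Sum>n<m. 2 ^ Suc n * (x n)\<^sup>2)"
proof -
  have "(\<Sum>n<m. x n)\<^sup>2 = (\<Sum>n<m. sqrt (1 / 2 ^ Suc n) * (sqrt (2 ^ Suc n) * x n))\<^sup>2"
    by (simp flip: mult.assoc real_sqrt_mult)
  also have "\<dots> \<le> (\<Sum>n<m. (sqrt (1 / 2 ^ Suc n))\<^sup>2) * (\<Sum>n<m. (sqrt (2 ^ Suc n) * x n)\<^sup>2)"
    by (rule Cauchy_Schwarz_ineq_sum)
  also have "\<dots> = (\<Sum>n<m. 1 / 2 ^ Suc n) * (\<Sum>n<m. 2 ^ Suc n * (x n)\<^sup>2)"
    by (simp add: power_mult_distrib)
  also have "\<dots> \<le> 1 * (\<Sum>n<m. 2 ^ Suc n * (x n)\<^sup>2)"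
  proof (rule mult_right_mono)
    have "(\<Sum>n<m. 1 / 2 ^ Suc n) = 1 - 1 / (2::real) ^ m"
      by (induction m) (auto simp: field_simps)
    then show "(\<Sum>n<m. 1 / 2 ^ Suc n) \<le> (1::real)" by simp
  qed (auto intro!: sum_nonneg)
  finally show ?thesis by simp
qed

section \<open>Covering a null set by continuous functions\<close>

text \<open>A sum of indicators of ever smaller open neighbourhoods of \<open>N\<close> is infinite
  on \<open>N\<close> but small in square mean. It is approximated from below by an increasing
  sequence of continuous functions, and the \<open>a m\<close> are the increments along a
  subsequence whose square means decay geometrically.\<close>

lemma cover_functions:
  assumes N: "N \<in> null_sets circ" and h: "h > 0"
  obtains a :: "nat \<Rightarrow> complex \<Rightarrow> real" where
    "\<And>m. continuous_on UNIV (a m)" "\<And>m w. 0 \<le> a m w"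
    "\<And>m. (LINT w|circ. (a m w)\<^sup>2) \<le> (h / 2 ^ m)\<^sup>2"
    "\<And>w. w \<in> N \<Longrightarrow> \<not> summable (\<lambda>m. a m w)"
proof -
  define \<eta> where "\<eta> = h\<^sup>2"
  have \<eta>: "\<eta> > 0" using h by (simp add: \<eta>_def)
  \<comment> \<open>The powers of 4 absorb the weights 2^(n+1) of the Cauchy-Schwarz estimate and
    still leave a geometric series.\<close>
  have "\<exists>V. open V \<and> N \<subseteq> V \<and> bounded V \<and> measure circ (V \<inter> sphere 0 1) \<le> \<eta> / 4 ^ Suc n" for n
    using null_set_outer_open[OF N, of "\<eta> / 4 ^ Suc n"] \<eta> by (metis divide_pos_pos zero_less_numeral zero_less_power)
  then obtain V where V: "\<And>n. open (V n)" "\<And>n. N \<subseteq> V n" "\<And>n. bounded (V n)"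
      "\<And>n. measure circ (V n \<inter> sphere 0 1) \<le> \<eta> / 4 ^ Suc n"
    by metis
  define x where "x m n w = min 1 (real m * infdist w (- V n))" for m n and w :: complex
  define \<phi> where "\<phi> m w = (\<Sum>n<m. x m n w)" for m w
  \<comment> \<open>\<open>infdist\<close> to the empty set is 0 by convention, so without this the
    approximants could vanish on \<open>N\<close>.\<close>
  have V_ne: "- V n \<noteq> {}" for n
    using V(3)[of n] by (metis Compl_UNIV_eq double_complement not_bounded_UNIV)
  have x0: "0 \<le> x m n w" and x1: "x m n w \<le> indicator (V n) w" for m n w
    using V_ne[of n] by (auto simp: x_def indicator_def infdist_nonneg)
  have \<phi>0: "0 \<le> \<phi> m w" for m w
    unfolding \<phi>_def by (intro sum_nonneg x0)
  have \<phi>_mono: "\<phi> m w \<le> \<phi> m' w" if "m \<le> m'" for m m' w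
  proof -
    have "\<phi> m w \<le> (\<Sum>n<m. x m' n w)"
      unfolding \<phi>_def x_def using that by (intro sum_mono min.mono mult_right_mono infdist_nonneg) auto
    also have "\<dots> \<le> \<phi> m' w"
      unfolding \<phi>_def using that by (intro sum_mono2 x0) auto
    finally show ?thesis .
  qed
  have c\<phi>: "continuous_on A (\<phi> m)" for m A
    unfolding \<phi>_def x_def by (intro continuous_intros)
  define I where "I m = (LINT w|circ. (\<phi> m w)\<^sup>2)" for m
  have I_le: "I m \<le> \<eta>" for m
  proof -
    have ind: "integrable circ (\<lambda>w. indicator (V n) w :: real)" for n
    proof (rule Bochner_Integration.integrable_cong[THEN iffD1, OF refl])
      show "integrable circ (\<lambda>w. indicator (V n \<inter> sphere 0 1) w :: real)"
        using V(1)[of n]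
        by (intro integrable_real_indicator)
           (auto simp: circ.emeasure_eq_measure sets_circ sets_restrict_space)
    qed (auto simp: indicator_def)
    have ind_eq: "(LINT w|circ. indicator (V n) w :: real) = measure circ (V n \<inter> sphere 0 1)" for n
    proof -
      have "(LINT w|circ. indicator (V n) w :: real) = (LINT w|circ. indicator (V n \<inter> sphere 0 1) w)"
        by (intro Bochner_Integration.integral_cong) (auto simp: indicator_def)
      then show ?thesis by simp
    qed
    have "I m \<le> (LINT w|circ. (\<Sum>n<m. 2 ^ Suc n * indicator (V n) w))"
      unfolding I_def
    proof (rule integral_mono)
      show "integrable circ (\<lambda>w. (\<phi> m w)\<^sup>2)"
        by (intro integrable_circ continuous_intros c\<phi>)
      show "integrable circ (\<lambda>w. \<Sum>n<m. 2 ^ Suc n * indicator (V n) w :: real)"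
        by (intro Bochner_Integration.integrable_sum integrable_mult_right ind)
      fix w
      have "(\<phi> m w)\<^sup>2 \<le> (\<Sum>n<m. 2 ^ Suc n * (x m n w)\<^sup>2)"
        unfolding \<phi>_def by (rule sum_power2_weighted_le)
      also have "\<dots> \<le> (\<Sum>n<m. 2 ^ Suc n * indicator (V n) w)"
      proof (intro sum_mono mult_left_mono)
        fix n
        have "(x m n w)\<^sup>2 \<le> (indicator (V n) w)\<^sup>2"
          by (intro power_mono x0 x1)
        then show "(x m n w)\<^sup>2 \<le> indicator (V n) w"
          by (auto simp: indicator_def)
      qed auto
      finally show "(\<phi> m w)\<^sup>2 \<le> (\<Sum>n<m. 2 ^ Suc n * indicator (V n) w)" .
    qed
    also have "\<dots> = (\<Sum>n<m. 2 ^ Suc n * measure circ (V n \<inter> sphere 0 1))"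
      by (subst Bochner_Integration.integral_sum) (auto intro!: ind integrable_mult_right simp: ind_eq)
    also have "\<dots> \<le> (\<Sum>n<m. 2 ^ Suc n * (\<eta> / 4 ^ Suc n))"
      by (intro sum_mono mult_left_mono V(4)) auto
    also have "\<dots> = (\<Sum>n<m. \<eta> / 2 ^ Suc n)"
    proof (intro sum.cong refl)
      fix n
      have "(4::real) ^ Suc n = 2 ^ Suc n * 2 ^ Suc n"
        by (simp flip: power_mult_distrib)
      then show "2 ^ Suc n * (\<eta> / 4 ^ Suc n) = \<eta> / 2 ^ Suc n" by simp
    qed
    also have "\<dots> = \<eta> * (1 - 1 / 2 ^ m)"
      by (induction m) (auto simp: field_simps)
    also have "\<dots> \<le> \<eta>"
      using \<eta> by (simp add: mult_left_le)
    finally show ?thesis .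
  qed
  have I_mono: "incseq I"
    unfolding incseq_def I_def
    by (intro allI impI integral_circ_mono continuous_intros c\<phi> power_mono \<phi>_mono \<phi>0)
  have bdI: "Bseq I"
    using I_le by (intro BseqI'[of _ \<eta>]) (auto simp: I_def abs_of_nonneg integral_circ_nonneg)
  obtain L where L: "I \<longlonglongrightarrow> L"
    using Bseq_monoseq_convergent[OF bdI] I_mono unfolding monoseq_def incseq_def convergent_def by blast
  have IL: "I m \<le> L" for m
    using incseq_le[OF I_mono L] .
  have "\<exists>M. \<forall>m\<ge>M. L - \<eta> / 4 ^ Suc k < I m" for k
    using order_tendstoD(1)[OF L, of "L - \<eta> / 4 ^ Suc k"] \<eta> unfolding eventually_sequentially by auto
  then obtain M where M: "\<And>k m. M k \<le> m \<Longrightarrow> L - \<eta> / 4 ^ Suc k < I m"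
    by metis
  \<comment> \<open>A monotone choice of indices dominating both \<open>M k\<close>, for the decay
    of the increments, and \<open>k\<close>, so that the subsequence still exhausts the sum.\<close>
  define j where "j k = (\<Sum>i\<le>k. M i) + k" for k
  have j_ge: "k \<le> j k" "M k \<le> j k" "j k \<le> j (Suc k)" for k
    by (auto simp: j_def trans_le_add1 member_le_sum)
  define a where "a k w = (case k of 0 \<Rightarrow> \<phi> (j 0) w | Suc i \<Rightarrow> \<phi> (j (Suc i)) w - \<phi> (j i) w)" for k w
  show ?thesis
  proof
    show "continuous_on UNIV (a m)" for m
      unfolding a_def by (cases m) (auto intro!: continuous_intros c\<phi>)
    show "0 \<le> a m w" for m w
      unfolding a_def using \<phi>0 \<phi>_mono j_ge by (cases m) auto
    show "(LINT w|circ. (a m w)\<^sup>2) \<le> (h / 2 ^ m)\<^sup>2" for m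
    proof (cases m)
      case 0
      then show ?thesis using I_le[of "j 0"] by (simp add: a_def I_def \<eta>_def)
    next
      case (Suc i)
      have "(LINT w|circ. (a m w)\<^sup>2) \<le> (LINT w|circ. (\<phi> (j (Suc i)) w)\<^sup>2 - (\<phi> (j i) w)\<^sup>2)"
      proof (rule integral_circ_mono)
        fix w
        \<comment> \<open>For 0 <= y <= x one has (x - y)^2 <= x^2 - y^2: an increment is controlled
          by the gap in the convergent sequence \<open>I\<close>.\<close>
        have "0 \<le> 2 * \<phi> (j i) w * (\<phi> (j (Suc i)) w - \<phi> (j i) w)"
          using \<phi>0 \<phi>_mono[OF j_ge(3)] by (intro mult_nonneg_nonneg) auto
        then show "(a m w)\<^sup>2 \<le> (\<phi> (j (Suc i)) w)\<^sup>2 - (\<phi> (j i) w)\<^sup>2"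
          by (simp add: a_def Suc power2_eq_square algebra_simps)
      qed (auto simp: a_def Suc intro!: continuous_intros c\<phi>)
      also have "\<dots> = I (j (Suc i)) - I (j i)"
        unfolding I_def by (intro Bochner_Integration.integral_diff integrable_circ continuous_intros c\<phi>)
      also have "\<dots> \<le> \<eta> / 4 ^ Suc i"
        using IL[of "j (Suc i)"] M[OF j_ge(2)[of i]] by simp
      also have "\<dots> = (h / 2 ^ m)\<^sup>2"
      proof -
        have "(4::real) ^ m = (2 ^ m)\<^sup>2"
          by (simp add: power2_eq_square flip: power_mult_distrib)
        then show ?thesis by (simp add: \<eta>_def Suc power_divide)
      qed
      finally show ?thesis .
    qed
    show "\<not> summable (\<lambda>m. a m w)" if w: "w \<in> N" for w
    proof
      assume s: "summable (\<lambda>m. a m w)"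
      have part: "(\<Sum>k<Suc K. a k w) = \<phi> (j K) w" for K
        by (induction K) (auto simp: a_def)
      have le: "\<phi> (j K) w \<le> (\<Sum>m. a m w)" for K
        unfolding part[symmetric] using \<phi>0 \<phi>_mono j_ge
        by (intro sum_le_suminf s) (auto simp: a_def split: nat.splits)
      obtain n0 :: nat where n0: "(\<Sum>m. a m w) < real n0"
        using reals_Archimedean2 by blast
      have pos: "0 < infdist w (- V n)" for n
      proof -
        have "closed (- V n)" using V(1) by (simp add: closed_Compl)
        moreover have "w \<notin> - V n" using V(2) w by auto
        ultimately show ?thesis
          using infdist_pos_not_in_closed[OF _ V_ne] by blast
      qed
      have "\<exists>k. \<forall>n<n0. 1 \<le> real k * infdist w (- V n)"
      proof -
        have "\<exists>k. 1 \<le> real k * infdist w (- V n)" for n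
          using reals_Archimedean3[OF pos, of n] by (metis less_imp_le)
        then obtain kk where kk: "\<And>n. 1 \<le> real (kk n) * infdist w (- V n)" by metis
        have "1 \<le> real (\<Sum>i<n0. kk i) * infdist w (- V n)" if "n < n0" for n
        proof -
          have "kk n \<le> (\<Sum>i<n0. kk i)" using that by (intro member_le_sum) auto
          then have "real (kk n) * infdist w (- V n) \<le> real (\<Sum>i<n0. kk i) * infdist w (- V n)"
            by (intro mult_right_mono infdist_nonneg) (rule of_nat_mono)
          with kk[of n] show ?thesis by linarith
        qed
        then show ?thesis by blast
      qed
      then obtain k where k: "\<And>n. n < n0 \<Longrightarrow> 1 \<le> real k * infdist w (- V n)" by blast
      define K where "K = max k n0"
      have "real n0 = (\<Sum>n<n0. x K n w)"
      proof -
        have "x K n w = 1" if "n < n0" for n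
        proof -
          have "real k * infdist w (- V n) \<le> real K * infdist w (- V n)"
            by (intro mult_right_mono infdist_nonneg) (simp add: K_def)
          with k[OF that] show ?thesis by (simp add: x_def)
        qed
        then show ?thesis by simp
      qed
      also have "\<dots> \<le> \<phi> K w"
        unfolding \<phi>_def by (intro sum_mono2 x0) (auto simp: K_def)
      also have "\<dots> \<le> \<phi> (j K) w"
        by (intro \<phi>_mono j_ge)
      finally show False using le[of K] n0 by linarith
    qed
  qed
qed

section \<open>Dichotomy of radial limits\<close>

lemma tendsto_radial:
  assumes "continuous_on (cball 0 1) G" "norm s = 1"
  shows "((\<lambda>r. G (complex_of_real r * s)) \<longlongrightarrow> G s) (at_left 1)"
proof -
  have "continuous_on {0..1} (\<lambda>r. G (complex_of_real r * s))"
    using assms(2) by (intro continuous_on_compose2[OF assms(1)] continuous_intros) (auto simp: norm_mult)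
  then have "((\<lambda>r. G (complex_of_real r * s)) \<longlongrightarrow> G (complex_of_real 1 * s)) (at 1 within {0..1})"
    unfolding continuous_on_def by (rule bspec) simp
  then show ?thesis
    by (simp add: at_within_Icc_at_left)
qed

text \<open>Each weight is the next covering function plus a small multiple of the maximal function
  of the previous stage. The covering part forces divergence on \<open>N\<close>; the other part
  makes the weights majorants of the series wherever they are summable.\<close>

lemma layer:
  assumes F: "closed F" "F \<subseteq> sphere 0 1" "F \<noteq> {}" and N: "N \<in> null_sets circ" and \<epsilon>: "\<epsilon> > 0"
  obtains G where "G holomorphic_on ball 0 1"
    "\<And>z. norm z < 1 \<Longrightarrow> 0 \<le> Re (G z)"
    "\<And>z. norm z < 1 \<Longrightarrow> norm (G z) \<le> \<epsilon> / (1 - norm z)"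
    "\<And>s r. s \<in> F \<Longrightarrow> 0 \<le> r \<Longrightarrow> r < 1 \<Longrightarrow> norm (G (of_real r * s)) \<le> \<epsilon>"
    "\<And>s. norm s = 1 \<Longrightarrow> radial_limit_exists G s \<or> filterlim (\<lambda>r. Re (G (of_real r * s))) at_top (at_left 1)"
    "\<And>s. s \<in> N \<Longrightarrow> s \<notin> F \<Longrightarrow> filterlim (\<lambda>r. Re (G (of_real r * s))) at_top (at_left 1)"
proof -
  \<comment> \<open>The bounds \<open>6 * \<delta> m\<close> obtained below add up to 12 h =
    \<epsilon>.\<close>
  define h where "h = \<epsilon> / 12"
  have h: "h > 0" using \<epsilon> by (simp add: h_def)
  obtain a :: "nat \<Rightarrow> complex \<Rightarrow> real" where a:
    "\<And>m. continuous_on UNIV (a m)" "\<And>m w. 0 \<le> a m w"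
    "\<And>m. (LINT w|circ. (a m w)\<^sup>2) \<le> (h / 2 ^ m)\<^sup>2"
    "\<And>w. w \<in> N \<Longrightarrow> \<not> summable (\<lambda>m. a m w)"
    using cover_functions[OF N h] by metis
  define ok where "ok v \<longleftrightarrow> continuous_on (sphere 0 1) v \<and> (\<forall>w. norm w = 1 \<longrightarrow> 0 \<le> v w)" for v :: "complex \<Rightarrow> real"
  \<comment> \<open>Bundling the conclusions of one stage allows \<open>G\<close> and the majorant
    to be chosen as functions of the weight and \<delta>, which the recursion for the weights
    needs.\<close>
  define stage where "stage v \<delta> G v' \<longleftrightarrow>
    G holomorphic_on ball 0 1 \<and> continuous_on (cball 0 1) G \<and>
    (\<forall>z. norm z < 1 \<longrightarrow> 0 \<le> Re (G z)) \<and>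
    (\<forall>z. norm z < 1 \<longrightarrow> norm (G z) \<le> (LINT w|circ. v w) / (1 - norm z)) \<and>
    (\<forall>s r. s \<in> F \<longrightarrow> 0 \<le> r \<longrightarrow> r < 1 \<longrightarrow> norm (G (of_real r * s)) \<le> (LINT w|circ. v w)) \<and>
    (\<forall>s. norm s = 1 \<longrightarrow> infdist s F * v s - \<delta> \<le> Re (G s)) \<and>
    continuous_on (sphere 0 1) v' \<and>
    (\<forall>s r. norm s = 1 \<longrightarrow> 0 \<le> r \<longrightarrow> r \<le> 1 \<longrightarrow> norm (G (of_real r * s)) \<le> v' s) \<and>
    (LINT w|circ. (v' w)\<^sup>2) \<le> 1500000 * ((LINT w|circ. (v w)\<^sup>2) + \<delta>\<^sup>2)" for v v' :: "complex \<Rightarrow> real" and \<delta> :: real and G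
  have "\<exists>G v'. stage v \<delta> G v'" if "ok v" "\<delta> > 0" for v \<delta>
  proof -
    have "continuous_on (sphere 0 1) v" "\<And>w. norm w = 1 \<Longrightarrow> 0 \<le> v w"
      using that(1) by (auto simp: ok_def)
    then show ?thesis
    proof (rule one_stage[OF F(2,3) _ _ that(2)])
      fix G v'
      assume *: "G holomorphic_on ball 0 1" "continuous_on (cball 0 1) G"
        "\<And>z. norm z < 1 \<Longrightarrow> 0 \<le> Re (G z)"
        "\<And>z. norm z < 1 \<Longrightarrow> norm (G z) \<le> (LINT w|circ. v w) / (1 - norm z)"
        "\<And>s r. s \<in> F \<Longrightarrow> 0 \<le> r \<Longrightarrow> r < 1 \<Longrightarrow> norm (G (of_real r * s)) \<le> (LINT w|circ. v w)"
        "\<And>s. norm s = 1 \<Longrightarrow> infdist s F * v s - \<delta> \<le> Re (G s)"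
        "continuous_on (sphere 0 1) v'"
        "\<And>s r. norm s = 1 \<Longrightarrow> 0 \<le> r \<Longrightarrow> r \<le> 1 \<Longrightarrow> norm (G (of_real r * s)) \<le> v' s"
        "(LINT w|circ. (v' w)\<^sup>2) \<le> 1500000 * ((LINT w|circ. (v w)\<^sup>2) + \<delta>\<^sup>2)"
      show ?thesis
        unfolding stage_def by (intro exI[of _ G] exI[of _ v'] conjI allI impI *)
    qed
  qed
  then obtain Gf vf where st: "\<And>v \<delta>. ok v \<Longrightarrow> \<delta> > 0 \<Longrightarrow> stage v \<delta> (Gf v \<delta>) (vf v \<delta>)"
    by metis
  have stage_le: "norm (G (of_real r * s)) \<le> v' s"
    if "stage v \<delta> G v'" "norm s = 1" "0 \<le> r" "r \<le> 1" for v v' \<delta> G r s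
    using that unfolding stage_def by blast
  define \<delta> where "\<delta> m = h / 2 ^ m" for m :: nat
  have \<delta>: "\<delta> m > 0" for m using h by (simp add: \<delta>_def)
  \<comment> \<open>Small enough that \<open>2 b\<^sup>2 * 1500000 * 5 * 4 \<le> 2\<close>, which closes the induction \<open>q_le\<close>.\<close>
  define b :: real where "b = 1 / 10000"
  define v where "v = rec_nat (a 0) (\<lambda>m vm s. a (Suc m) s + b * vf vm (\<delta> m) s)"
  have v_0: "v 0 = a 0" by (simp add: v_def)
  have v_Suc: "v (Suc m) = (\<lambda>s. a (Suc m) s + b * vf (v m) (\<delta> m) s)" for m
    by (simp add: v_def)
  have ca: "continuous_on (sphere 0 1) (a m)" for m
    using a(1) by (rule continuous_on_subset) simp
  have vf0: "0 \<le> vf (v m) (\<delta> m) w" if "ok (v m)" "norm w = 1" for m w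
  proof -
    have "norm (Gf (v m) (\<delta> m) (of_real 0 * w)) \<le> vf (v m) (\<delta> m) w"
      by (rule stage_le[OF st[OF that(1) \<delta>[of m]] that(2)]) auto
    then show ?thesis by (rule order_trans[OF norm_ge_zero])
  qed
  have okv: "ok (v m)" for m
  proof (induction m)
    case 0
    show ?case using ca a(2) by (simp add: v_0 ok_def)
  next
    case (Suc m)
    have "continuous_on (sphere 0 1) (vf (v m) (\<delta> m))"
      using st[OF Suc \<delta>[of m]] by (simp add: stage_def)
    then show ?case
      unfolding ok_def v_Suc using ca a(2) vf0[OF Suc]
      by (auto intro!: continuous_intros add_nonneg_nonneg simp: b_def)
  qed
  define G where "G m = Gf (v m) (\<delta> m)" for m
  define v' where "v' m = vf (v m) (\<delta> m)" for m
  have S: "stage (v m) (\<delta> m) (G m) (v' m)" for m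
    unfolding G_def v'_def by (rule st[OF okv \<delta>])
  have hol: "G m holomorphic_on ball 0 1" and cont: "continuous_on (cball 0 1) (G m)"
    and cv': "continuous_on (sphere 0 1) (v' m)" for m
    using S[of m] by (auto simp: stage_def)
  have ReG: "0 \<le> Re (G m z)" if "norm z < 1" for m z
    using S[of m] that by (auto simp: stage_def)
  have cv: "continuous_on (sphere 0 1) (v m)" and v0: "\<And>w. norm w = 1 \<Longrightarrow> 0 \<le> v m w" for m
    using okv[of m] by (auto simp: ok_def)
  define q where "q m = (LINT w|circ. (v m w)\<^sup>2)" for m
  have q_le: "q m \<le> 4 * (\<delta> m)\<^sup>2" for m
  proof (induction m)
    case 0
    have "q 0 \<le> (\<delta> 0)\<^sup>2"
      using a(3)[of 0] by (simp add: q_def v_0 \<delta>_def)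
    then show ?case using zero_le_power2[of "\<delta> 0"] by linarith
  next
    case (Suc m)
    have "q (Suc m) \<le> (LINT w|circ. 2 * (a (Suc m) w)\<^sup>2 + 2 * b\<^sup>2 * (v' m w)\<^sup>2)"
      unfolding q_def
    proof (rule integral_circ_mono)
      fix w
      show "(v (Suc m) w)\<^sup>2 \<le> 2 * (a (Suc m) w)\<^sup>2 + 2 * b\<^sup>2 * (v' m w)\<^sup>2"
        using sum_squares_bound[of "a (Suc m) w" "b * v' m w"]
        by (simp add: v_Suc v'_def power2_sum power_mult_distrib)
    qed (intro continuous_intros ca cv cv')+
    also have "\<dots> = 2 * (LINT w|circ. (a (Suc m) w)\<^sup>2) + 2 * b\<^sup>2 * (LINT w|circ. (v' m w)\<^sup>2)"
      by (subst Bochner_Integration.integral_add) (auto intro!: integrable_circ continuous_intros ca cv')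
    also have "\<dots> \<le> 2 * (\<delta> (Suc m))\<^sup>2 + 2 * b\<^sup>2 * (1500000 * (q m + (\<delta> m)\<^sup>2))"
      using S[of m] a(3)[of "Suc m"] unfolding stage_def q_def \<delta>_def
      by (intro add_mono mult_left_mono) auto
    also have "\<dots> \<le> 2 * (\<delta> (Suc m))\<^sup>2 + 2 * b\<^sup>2 * (1500000 * (5 * (\<delta> m)\<^sup>2))"
      using Suc by (intro add_left_mono mult_left_mono) auto
    also have "(\<delta> m)\<^sup>2 = 4 * (\<delta> (Suc m))\<^sup>2"
      by (simp add: \<delta>_def power_divide power_mult_distrib)
    also have "2 * (\<delta> (Suc m))\<^sup>2 + 2 * b\<^sup>2 * (1500000 * (5 * (4 * (\<delta> (Suc m))\<^sup>2))) \<le> 4 * (\<delta> (Suc m))\<^sup>2"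
      using zero_le_power2[of "\<delta> (Suc m)"] by (simp add: b_def power2_eq_square[of "1 / 10000"])
    finally show ?case .
  qed
  define I where "I m = (LINT w|circ. v m w)" for m
  \<comment> \<open>From v <= \<delta>/2 + v^2 / (2 \<delta>): integration gives \<pi> \<delta> <= 4
    \<delta> from the constant and at most 2 \<delta> from \<open>q_le\<close>.\<close>
  have I_le: "I m \<le> 6 * \<delta> m" for m
  proof -
    have "I m \<le> (LINT w|circ. \<delta> m / 2 + (v m w)\<^sup>2 / (2 * \<delta> m))"
      unfolding I_def
    proof (rule integral_circ_mono)
      fix w
      show "v m w \<le> \<delta> m / 2 + (v m w)\<^sup>2 / (2 * \<delta> m)"
        using sum_squares_bound[of "v m w" "\<delta> m"] \<delta>[of m]
        by (simp add: field_simps power2_eq_square)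
    qed (use \<delta>[of m] in \<open>auto intro!: continuous_intros cv\<close>)
    also have "\<dots> = pi * \<delta> m + q m / (2 * \<delta> m)"
      unfolding q_def using \<delta>[of m]
      by (subst Bochner_Integration.integral_add) (auto intro!: integrable_circ continuous_intros cv)
    also have "\<dots> \<le> 4 * \<delta> m + 4 * (\<delta> m)\<^sup>2 / (2 * \<delta> m)"
      using pi_less_4 \<delta>[of m] q_le[of m] by (intro add_mono mult_right_mono divide_right_mono) auto
    also have "\<dots> = 6 * \<delta> m"
      using \<delta>[of m] by (simp add: power2_eq_square)
    finally show ?thesis .
  qed
  have \<delta>_sums: "\<delta> sums (2 * h)"
    using sums_mult[OF geometric_sums[of "1 / 2 :: real"], of h] by (simp add: \<delta>_def[abs_def] power_one_over field_simps)
  have sum\<delta>: "summable (\<lambda>m. 6 * \<delta> m)" "(\<Sum>m. 6 * \<delta> m) = \<epsilon>"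
    using sums_mult[OF \<delta>_sums, of 6] by (auto simp: sums_iff h_def)
  have bd: "norm (G m z) \<le> 6 * \<delta> m / (1 - norm z)" if "norm z < 1" for m z
  proof -
    have "norm (G m z) \<le> I m / (1 - norm z)"
      using S[of m] that by (simp add: stage_def I_def)
    also have "\<dots> \<le> 6 * \<delta> m / (1 - norm z)"
      using I_le that by (intro divide_right_mono) auto
    finally show ?thesis .
  qed
  have bdF: "norm (G m (of_real r * s)) \<le> 6 * \<delta> m" if "s \<in> F" "0 \<le> r" "r < 1" for m r s
  proof -
    have "norm (G m (of_real r * s)) \<le> I m"
      using S[of m] that by (simp add: stage_def I_def)
    with I_le[of m] show ?thesis by linarith
  qed
  have lim: "((\<lambda>r. G m (complex_of_real r * s)) \<longlongrightarrow> G m s) (at_left 1)" if "norm s = 1" for m s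
    by (rule tendsto_radial[OF cont that])
  have rl: "radial_limit_exists (G m) s" if "norm s = 1" for m s
    using lim[OF that] unfolding radial_limit_exists_def by blast
  define H where "H z = (\<Sum>m. G m z)" for z
  have "\<forall>m z. norm z < 1 \<longrightarrow> norm (G m z) \<le> 6 * \<delta> m / (1 - norm z)"
    using bd by blast
  note H = holomorphic_suminf[OF hol this sum\<delta>(1), folded H_def]
  have rl_F: "radial_limit_exists H s" if "s \<in> F" for s
  proof -
    have "norm s = 1" using that F by auto
    then show ?thesis
      unfolding H_def by (rule radial_limit_suminf[OF rl bdF[OF that] sum\<delta>(1)])
  qed
  \<comment> \<open>Since the covering part of \<open>v (Suc m)\<close> is nonnegative,
    \<open>v (Suc m) s / b\<close> dominates \<open>G m\<close> on the whole radius.\<close>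
  have rl_summable: "radial_limit_exists H s" if s: "norm s = 1" and vs: "summable (\<lambda>m. v m s)" for s
  proof -
    have S1: "summable (\<lambda>m. v (Suc m) s / b)"
      using vs by (intro summable_divide) (subst summable_Suc_iff)
    have S2: "norm (G m (of_real r * s)) \<le> v (Suc m) s / b" if "0 \<le> r" "r < 1" for m r
    proof -
      have "norm (G m (of_real r * s)) \<le> v' m s"
        using that by (intro stage_le[OF S[of m] s]) auto
      also have "\<dots> \<le> v (Suc m) s / b"
        using a(2)[of "Suc m" s] by (simp add: v_Suc v'_def b_def)
      finally show ?thesis .
    qed
    show ?thesis
      unfolding H_def by (rule radial_limit_suminf[OF rl[OF s] S2 S1])
  qed
  \<comment> \<open>At a fixed point off \<open>F\<close> the distance factor is a positive constant
    and the errors \<open>\<delta> m\<close> are summable, so bounded partial sums of the real parts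
    would make the weights summable.\<close>
  have infinite: "filterlim (\<lambda>r. Re (H (of_real r * s))) at_top (at_left 1)"
    if s: "norm s = 1" "s \<notin> F" and vs: "\<not> summable (\<lambda>m. v m s)" for s
    unfolding H_def
  proof (rule Re_suminf_at_top)
    show "((\<lambda>r. Re (G n (complex_of_real r * s))) \<longlongrightarrow> Re (G n s)) (at_left 1)" for n
      by (intro tendsto_intros lim s)
    show "0 \<le> Re (G n (of_real r * s))" if "0 \<le> r" "r < 1" for n r
      using that s by (intro ReG radial_in_ball)
    show "summable (\<lambda>n. G n (of_real r * s))" if "0 \<le> r" "r < 1" for r
      using that s by (intro summable_norm_cancel[OF H(2)] radial_in_ball)
    show "\<exists>N. C < (\<Sum>n<N. Re (G n s))" for C
    proof (rule ccontr)
      assume "\<not> ?thesis"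
      then have C: "(\<Sum>n<N. Re (G n s)) \<le> C" for N by (simp add: not_less)
      define c where "c = infdist s F"
      have c: "c > 0"
        unfolding c_def using infdist_pos_not_in_closed[OF F(1,3) s(2)] .
      have "summable (\<lambda>m. c * v m s)"
      proof (rule summableI_nonneg_bounded)
        show "0 \<le> c * v m s" for m using c v0 s by simp
        fix N
        have "(\<Sum>m<N. c * v m s) \<le> (\<Sum>m<N. Re (G m s) + \<delta> m)"
          using S s unfolding stage_def c_def by (intro sum_mono) (simp add: algebra_simps)
        also have "\<dots> = (\<Sum>m<N. Re (G m s)) + (\<Sum>m<N. \<delta> m)"
          by (rule sum.distrib)
        also have "\<dots> \<le> C + 2 * h"
          using C[of N] sum_le_suminf[OF sums_summable[OF \<delta>_sums], of "{..<N}"] \<delta> sums_unique[OF \<delta>_sums]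
          by (intro add_mono) (auto simp: less_imp_le)
        finally show "(\<Sum>m<N. c * v m s) \<le> C + 2 * h" .
      qed
      then have "summable (\<lambda>m. v m s)"
        using c by (simp add: summable_cmult_iff)
      with vs show False by blast
    qed
  qed
  have a_le_v: "a m s \<le> v m s" if "norm s = 1" for m s
    using vf0[OF okv that] by (cases m) (auto simp: v_0 v_Suc b_def)
  show ?thesis
  proof
    show "H holomorphic_on ball 0 1" by (rule H(1))
    show "norm (H z) \<le> \<epsilon> / (1 - norm z)" if "norm z < 1" for z
      using H(3)[OF that] by (simp add: sum\<delta>(2))
    show "0 \<le> Re (H z)" if "norm z < 1" for z
    proof -
      have "summable (\<lambda>n. G n z)" using H(2)[OF that] by (rule summable_norm_cancel)
      then show ?thesis
        unfolding H_def using ReG[OF that] by (subst Re_suminf) (auto intro!: suminf_nonneg summable_Re)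
    qed
    show "norm (H (of_real r * s)) \<le> \<epsilon>" if "s \<in> F" "0 \<le> r" "r < 1" for s r
    proof -
      have "norm (H (of_real r * s)) \<le> (\<Sum>m. norm (G m (of_real r * s)))"
        unfolding H_def using that F by (intro summable_norm H(2)) (auto simp: norm_mult subset_iff)
      also have "\<dots> \<le> (\<Sum>m. 6 * \<delta> m)"
        using that F by (intro suminf_le bdF sum\<delta> H(2)) (auto simp: norm_mult subset_iff)
      finally show ?thesis by (simp add: sum\<delta>(2))
    qed
    show "radial_limit_exists H s \<or> filterlim (\<lambda>r. Re (H (of_real r * s))) at_top (at_left 1)" if "norm s = 1" for s
    proof (cases "s \<in> F \<or> summable (\<lambda>m. v m s)")
      case True
      then have "radial_limit_exists H s"
        using rl_F[of s] rl_summable[OF that] by (elim disjE) simp_all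
      then show ?thesis ..
    next
      case False
      then have "filterlim (\<lambda>r. Re (H (of_real r * s))) at_top (at_left 1)"
        by (intro infinite that) simp_all
      then show ?thesis ..
    qed
    show "filterlim (\<lambda>r. Re (H (of_real r * s))) at_top (at_left 1)" if "s \<in> N" "s \<notin> F" for s
    proof -
      have s: "norm s = 1"
        using sets.sets_into_space[OF null_setsD2[OF N]] that(1) by auto
      have "\<not> summable (\<lambda>m. v m s)"
      proof
        assume "summable (\<lambda>m. v m s)"
        then have "summable (\<lambda>m. a m s)"
          by (rule summable_comparison_test'[where N = 0]) (use a(2) a_le_v[OF s] in auto)
        with a(4)[OF that(1)] show False by blast
      qed
      with infinite[OF s that(2)] show ?thesis by blast
    qed
  qed
qed

section \<open>Infinite limits exactly on a null Gdelta set\<close>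

text \<open>The map G / (1 + G) sends the right half-plane into the disc with diameter [0, 1] and
  infinity to 1. As |1 + G| >= 1, it does not increase moduli, so the smallness of \<open>G\<close>
  on radii ending in \<open>F\<close> is inherited.\<close>

lemma clamped_layer:
  assumes F: "closed F" "F \<subseteq> sphere 0 1" "F \<noteq> {}" and N: "N \<in> null_sets circ" and \<epsilon>: "\<epsilon> > 0"
  obtains g where "g holomorphic_on ball 0 1"
    "\<And>z. norm z < 1 \<Longrightarrow> 0 \<le> Re (g z)"
    "\<And>z. norm z < 1 \<Longrightarrow> norm (g z) \<le> 1"
    "\<And>z. norm z < 1 \<Longrightarrow> norm (g z) \<le> \<epsilon> / (1 - norm z)"
    "\<And>s r. s \<in> F \<Longrightarrow> 0 \<le> r \<Longrightarrow> r < 1 \<Longrightarrow> norm (g (of_real r * s)) \<le> \<epsilon>"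
    "\<And>s. norm s = 1 \<Longrightarrow> radial_limit_exists g s"
    "\<And>s. s \<in> N \<Longrightarrow> s \<notin> F \<Longrightarrow> ((\<lambda>r. Re (g (of_real r * s))) \<longlongrightarrow> 1) (at_left 1)"
proof (rule layer[OF F N \<epsilon>])
  fix G
  assume hol: "G holomorphic_on ball 0 1"
    and pos: "\<And>z. norm z < 1 \<Longrightarrow> 0 \<le> Re (G z)"
    and bd: "\<And>z. norm z < 1 \<Longrightarrow> norm (G z) \<le> \<epsilon> / (1 - norm z)"
    and bdF: "\<And>s r. s \<in> F \<Longrightarrow> 0 \<le> r \<Longrightarrow> r < 1 \<Longrightarrow> norm (G (of_real r * s)) \<le> \<epsilon>"
    and dich: "\<And>s. norm s = 1 \<Longrightarrow> radial_limit_exists G s \<or> filterlim (\<lambda>r. Re (G (of_real r * s))) at_top (at_left 1)"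
    and inf: "\<And>s. s \<in> N \<Longrightarrow> s \<notin> F \<Longrightarrow> filterlim (\<lambda>r. Re (G (of_real r * s))) at_top (at_left 1)"
  define g where "g z = G z / (1 + G z)" for z
  have n1: "1 \<le> norm (1 + G z)" if "norm z < 1" for z
    using complex_Re_le_cmod[of "1 + G z"] pos[OF that] by simp
  have nz: "1 + G z \<noteq> 0" if "norm z < 1" for z
    using n1[OF that] by auto
  have sq: "(norm (1 + G z))\<^sup>2 = 1 + 2 * Re (G z) + (norm (G z))\<^sup>2" for z
    unfolding cmod_power2 by (simp add: power2_eq_square algebra_simps)
  have g_le_G: "norm (g z) \<le> norm (G z)" if "norm z < 1" for z
    using divide_left_mono[OF n1[OF that], of "norm (G z)"] n1[OF that] nz[OF that]
    by (simp add: g_def norm_divide)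
  have on_top: "((\<lambda>r. g (of_real r * s)) \<longlongrightarrow> 1) (at_left 1)"
    if s: "norm s = 1" and top: "filterlim (\<lambda>r. Re (G (of_real r * s))) at_top (at_left 1)" for s
  proof -
    have ev: "eventually (\<lambda>r::real. norm (of_real r * s) < 1) (at_left 1)"
      using eventually_at_left_1 by eventually_elim (use s in \<open>auto simp: norm_mult\<close>)
    have "((\<lambda>r. 1 / (1 + G (complex_of_real r * s))) \<longlongrightarrow> 0) (at_left 1)"
    proof (rule Lim_null_comparison)
      show "((\<lambda>r. inverse (Re (G (complex_of_real r * s)))) \<longlongrightarrow> 0) (at_left 1)"
        by (rule tendsto_inverse_0_at_top[OF top])
      have "eventually (\<lambda>r. 0 < Re (G (complex_of_real r * s))) (at_left 1)"
        using top by (simp add: filterlim_at_top_dense)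
      then show "eventually (\<lambda>r. norm (1 / (1 + G (complex_of_real r * s))) \<le> inverse (Re (G (complex_of_real r * s)))) (at_left 1)"
      proof eventually_elim
        case (elim r)
        have "Re (G (complex_of_real r * s)) \<le> norm (1 + G (complex_of_real r * s))"
          using complex_Re_le_cmod[of "1 + G (complex_of_real r * s)"] by simp
        then show ?case
          using elim by (simp add: norm_divide inverse_eq_divide frac_le)
      qed
    qed
    then have "((\<lambda>r. 1 - 1 / (1 + G (complex_of_real r * s))) \<longlongrightarrow> 1 - 0) (at_left 1)"
      by (intro tendsto_diff tendsto_const)
    then have "((\<lambda>r. 1 - 1 / (1 + G (complex_of_real r * s))) \<longlongrightarrow> 1) (at_left 1)"
      by simp
    then show ?thesis
    proof (rule Lim_transform_eventually)
      show "eventually (\<lambda>r. 1 - 1 / (1 + G (complex_of_real r * s)) = g (of_real r * s)) (at_left 1)"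
        using ev by eventually_elim (use nz in \<open>auto simp: g_def field_simps\<close>)
    qed
  qed
  show ?thesis
  proof
    show "g holomorphic_on ball 0 1"
      unfolding g_def using nz by (intro holomorphic_intros hol) auto
    show "0 \<le> Re (g z)" if "norm z < 1" for z
    proof -
      have "Re (G z * cnj (1 + G z)) = Re (G z) + (norm (G z))\<^sup>2"
        unfolding cmod_power2 by (simp add: power2_eq_square algebra_simps)
      then have "0 \<le> Re (G z * cnj (1 + G z))"
        using pos[OF that] by simp
      then show ?thesis
        unfolding g_def complex_div_cnj[of "G z"] by (simp only: Re_divide_of_real divide_nonneg_nonneg zero_le_power2)
    qed
    show "norm (g z) \<le> 1" if "norm z < 1" for z
    proof -
      have "(norm (G z))\<^sup>2 \<le> (norm (1 + G z))\<^sup>2"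
        unfolding sq using pos[OF that] by simp
      then have "norm (G z) \<le> norm (1 + G z)"
        by (rule power2_le_imp_le) simp
      then show ?thesis
        using n1[OF that] by (simp add: g_def norm_divide divide_le_eq_1)
    qed
    show "norm (g z) \<le> \<epsilon> / (1 - norm z)" if "norm z < 1" for z
      using g_le_G[OF that] bd[OF that] by linarith
    show "norm (g (of_real r * s)) \<le> \<epsilon>" if "s \<in> F" "0 \<le> r" "r < 1" for s r
    proof -
      have "norm s = 1" using that(1) F(2) by auto
      then have "norm (of_real r * s) < 1" using that by (simp add: norm_mult)
      from g_le_G[OF this] bdF[OF that] show ?thesis by linarith
    qed
    show "((\<lambda>r. Re (g (of_real r * s))) \<longlongrightarrow> 1) (at_left 1)" if "s \<in> N" "s \<notin> F" for s
    proof -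
      have "norm s = 1"
        using sets.sets_into_space[OF null_setsD2[OF N]] that(1) by auto
      from tendsto_Re[OF on_top[OF this inf[OF that]]] show ?thesis by simp
    qed
    show "radial_limit_exists g s" if s: "norm s = 1" for s
      using dich[OF s]
    proof
      assume "filterlim (\<lambda>r. Re (G (of_real r * s))) at_top (at_left 1)"
      from on_top[OF s this] show ?thesis unfolding radial_limit_exists_def by blast
    next
      assume "radial_limit_exists G s"
      then obtain L where L: "((\<lambda>r. G (complex_of_real r * s)) \<longlongrightarrow> L) (at_left 1)"
        unfolding radial_limit_exists_def by blast
      have "0 \<le> Re L"
      proof (rule tendsto_lowerbound[OF tendsto_Re[OF L]])
        show "eventually (\<lambda>r. 0 \<le> Re (G (complex_of_real r * s))) (at_left 1)"
          using eventually_at_left_1 by eventually_elim (use s in \<open>auto intro!: pos simp: norm_mult\<close>)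
      qed simp
      then have "1 + L \<noteq> 0" by (auto simp: complex_eq_iff)
      then have "((\<lambda>r. g (complex_of_real r * s)) \<longlongrightarrow> L / (1 + L)) (at_left 1)"
        unfolding g_def by (intro tendsto_intros L)
      then show ?thesis unfolding radial_limit_exists_def by blast
    qed
  qed
qed

lemma infinite_radial_limits_exactly:
  assumes E: "Gdelta_T E" "E \<in> null_sets circ"
  obtains F where "F holomorphic_on ball 0 1" "\<And>z. norm z < 1 \<Longrightarrow> 0 \<le> Re (F z)"
    "\<And>s. norm s = 1 \<Longrightarrow> s \<notin> E \<Longrightarrow> radial_limit_exists F s"
    "\<And>s. s \<in> E \<Longrightarrow> filterlim (\<lambda>r. Re (F (of_real r * s))) at_top (at_left 1)"
proof -
  have Es: "E \<subseteq> sphere 0 1"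
    using sets.sets_into_space[OF null_setsD2[OF E(2)]] by simp
  from E(1)[unfolded Gdelta_T_def] obtain U :: "nat \<Rightarrow> complex set"
    where U': "(\<forall>n. openin (top_of_set (sphere 0 1)) (U n)) \<and> E = (\<Inter>n. U n)" by (rule exE)
  then have U: "\<And>n. openin (top_of_set (sphere 0 1)) (U n)" "E = (\<Inter>n. U n)"
    by simp_all
  have "E \<noteq> sphere 0 1"
    using E(2) emeasure_circ pi_gt_zero by (auto simp: null_sets_def)
  \<comment> \<open>A point of the circle outside \<open>E\<close>, present because \<open>E\<close>
    is null, keeps every \<open>K n\<close> nonempty.\<close>
  then obtain p where p: "p \<in> sphere 0 1" "p \<notin> E" using Es by blast
  define K where "K n = insert p (\<Union>i\<le>n. sphere 0 1 - U i)" for n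
  have cl: "closed (K n)" for n
  proof -
    have "closed (sphere 0 1 - U i)" for i
      using closedin_closed_trans[OF closedin_diff[OF closedin_subtopology_refl[THEN iffD2] U(1)[of i]]] by simp
    then show ?thesis unfolding K_def by (intro closed_insert closed_UN) auto
  qed
  have Ks: "K n \<subseteq> sphere 0 1" "K n \<noteq> {}" for n
    using p by (auto simp: K_def)
  have KE: "s \<notin> K n" if "s \<in> E" for s n
    using that p U(2) by (auto simp: K_def)
  define P where "P n g \<longleftrightarrow> g holomorphic_on ball 0 1 \<and>
    (\<forall>z. norm z < 1 \<longrightarrow> 0 \<le> Re (g z)) \<and>
    (\<forall>z. norm z < 1 \<longrightarrow> norm (g z) \<le> 1) \<and>
    (\<forall>z. norm z < 1 \<longrightarrow> norm (g z) \<le> (1/2) ^ n / (1 - norm z)) \<and>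
    (\<forall>s r. s \<in> K n \<longrightarrow> 0 \<le> r \<longrightarrow> r < 1 \<longrightarrow> norm (g (of_real r * s)) \<le> (1/2) ^ n) \<and>
    (\<forall>s. norm s = 1 \<longrightarrow> radial_limit_exists g s) \<and>
    (\<forall>s. s \<in> E \<longrightarrow> s \<notin> K n \<longrightarrow> ((\<lambda>r. Re (g (of_real r * s))) \<longlongrightarrow> 1) (at_left 1))" for n :: nat and g
  have "\<exists>g. P n g" for n
  proof -
    have half: "0 < (1/2::real) ^ n" by simp
    show ?thesis
    proof (rule clamped_layer[OF cl Ks E(2) half, of n])
      fix g
      assume *: "g holomorphic_on ball 0 1"
        "\<And>z. norm z < 1 \<Longrightarrow> 0 \<le> Re (g z)"
        "\<And>z. norm z < 1 \<Longrightarrow> norm (g z) \<le> 1"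
        "\<And>z. norm z < 1 \<Longrightarrow> norm (g z) \<le> (1/2) ^ n / (1 - norm z)"
        "\<And>s r. s \<in> K n \<Longrightarrow> 0 \<le> r \<Longrightarrow> r < 1 \<Longrightarrow> norm (g (of_real r * s)) \<le> (1/2) ^ n"
        "\<And>s. norm s = 1 \<Longrightarrow> radial_limit_exists g s"
        "\<And>s. s \<in> E \<Longrightarrow> s \<notin> K n \<Longrightarrow> ((\<lambda>r. Re (g (of_real r * s))) \<longlongrightarrow> 1) (at_left 1)"
      show ?thesis
        unfolding P_def by (intro exI[of _ g] conjI allI impI *)
    qed
  qed
  then obtain g where Pg: "\<And>n. P n (g n)" by metis
  have g: "\<And>n. g n holomorphic_on ball 0 1"
    "\<And>n z. norm z < 1 \<Longrightarrow> 0 \<le> Re (g n z)"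
    "\<And>n z. norm z < 1 \<Longrightarrow> norm (g n z) \<le> 1"
    "\<And>n z. norm z < 1 \<Longrightarrow> norm (g n z) \<le> (1/2) ^ n / (1 - norm z)"
    "\<And>n s r. s \<in> K n \<Longrightarrow> 0 \<le> r \<Longrightarrow> r < 1 \<Longrightarrow> norm (g n (of_real r * s)) \<le> (1/2) ^ n"
    "\<And>n s. norm s = 1 \<Longrightarrow> radial_limit_exists (g n) s"
    "\<And>n s. s \<in> E \<Longrightarrow> s \<notin> K n \<Longrightarrow> ((\<lambda>r. Re (g n (of_real r * s))) \<longlongrightarrow> 1) (at_left 1)"
    using Pg unfolding P_def by simp_all
  have geo: "summable (\<lambda>n. (1/2::real) ^ n)" by (rule summable_geometric) simp
  define F where "F z = (\<Sum>n. g n z)" for z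
  have "\<forall>n z. norm z < 1 \<longrightarrow> norm (g n z) \<le> (1/2) ^ n / (1 - norm z)"
    using g(4) by blast
  note H = holomorphic_suminf[OF g(1) this geo, folded F_def]
  show ?thesis
  proof
    show "F holomorphic_on ball 0 1" by (rule H(1))
    show "0 \<le> Re (F z)" if "norm z < 1" for z
    proof -
      have s: "summable (\<lambda>n. g n z)" using H(2)[OF that] by (rule summable_norm_cancel)
      have "0 \<le> (\<Sum>n. Re (g n z))"
        by (intro suminf_nonneg summable_Re s g(2) that)
      then show ?thesis by (simp only: F_def Re_suminf[OF s])
    qed
    show "radial_limit_exists F s" if s: "norm s = 1" "s \<notin> E" for s
    proof -
      obtain i where i: "s \<notin> U i" using s U(2) by blast
      have K: "s \<in> K n" if "i \<le> n" for n
        using i s that by (auto simp: K_def)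
      \<comment> \<open>A point outside \<open>E\<close> lies in \<open>K n\<close> from some index
        \<open>i\<close> on. The finitely many earlier terms are bounded by 1, the later ones by the
        geometric bound on \<open>K n\<close>.\<close>
      define M where "M n = (if n < i then 1 else (1/2::real) ^ n)" for n
      have S1: "summable M"
      proof (rule summable_cong[THEN iffD2, OF _ geo])
        show "eventually (\<lambda>n. M n = (1/2) ^ n) sequentially"
          using eventually_ge_at_top[of i] by eventually_elim (auto simp: M_def)
      qed
      have S2: "norm (g n (of_real r * s)) \<le> M n" if "0 \<le> r" "r < 1" for n r
        using g(3)[of "of_real r * s" n] g(5)[OF K that] that s by (auto simp: M_def norm_mult)
      show ?thesis
        unfolding F_def by (rule radial_limit_suminf[OF g(6)[OF s(1)] S2 S1])
    qed
    show "filterlim (\<lambda>r. Re (F (of_real r * s))) at_top (at_left 1)" if s: "s \<in> E" for s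
      unfolding F_def
    proof (rule Re_suminf_at_top)
      have ns: "norm s = 1" using s Es by auto
      \<comment> \<open>\<open>E\<close> avoids every \<open>K n\<close>, so each summand tends to 1
        and the series of limits diverges.\<close>
      show "((\<lambda>r. Re (g n (complex_of_real r * s))) \<longlongrightarrow> 1) (at_left 1)" for n
        by (rule g(7)[OF s KE[OF s]])
      show "0 \<le> Re (g n (of_real r * s))" if "0 \<le> r" "r < 1" for n r
        using that ns by (intro g(2) radial_in_ball)
      show "summable (\<lambda>n. g n (of_real r * s))" if "0 \<le> r" "r < 1" for r
        using that ns by (intro summable_norm_cancel[OF H(2)] radial_in_ball)
      show "\<exists>N::nat. C < (\<Sum>n<N. 1)" for C :: real
        using reals_Archimedean2[of C] by simp
    qed
  qed
qed

section \<open>Divergence exactly on a null Gdelta-sigma set\<close>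

text \<open>The Gdelta case, with an oscillation bound that does not depend on the set, so that the
  functions for countably many sets can be superposed with rapidly decreasing coefficients.\<close>

lemma Gdelta_null_no_limit:
  assumes E: "Gdelta_T E" "E \<in> null_sets circ"
  obtains f where "f holomorphic_on ball 0 1" "\<And>z. norm z < 1 \<Longrightarrow> norm (f z) \<le> 1"
    "\<And>s. norm s = 1 \<Longrightarrow> s \<notin> E \<Longrightarrow> radial_limit_exists f s"
    "E \<subseteq> osc_set f (exp (- 2 * pi))"
proof (rule infinite_radial_limits_exactly[OF E])
  fix F
  assume hol: "F holomorphic_on ball 0 1" and pos: "\<And>z. norm z < 1 \<Longrightarrow> 0 \<le> Re (F z)"
    and lim: "\<And>s. norm s = 1 \<Longrightarrow> s \<notin> E \<Longrightarrow> radial_limit_exists F s"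
    and top: "\<And>s. s \<in> E \<Longrightarrow> filterlim (\<lambda>r. Re (F (of_real r * s))) at_top (at_left 1)"
  \<comment> \<open>The exponential has modulus exp (- Im Ln), between exp (- pi) and exp pi. The
    factor exp (- pi) normalises the upper bound to 1 and leaves the lower bound exp (- 2
    pi).\<close>
  define f where "f z = of_real (exp (- pi)) * exp (\<i> * Ln (1 + F z))" for z
  have not_nonpos: "1 + F z \<notin> \<real>\<^sub>\<le>\<^sub>0" if "norm z < 1" for z
    using pos[OF that] by (auto simp: complex_nonpos_Reals_iff)
  have nz: "1 + F z \<noteq> 0" if "norm z < 1" for z
    using not_nonpos[OF that] by auto
  have polar: "f z = of_real (exp (- pi - Im (Ln (1 + F z)))) * cis (ln (norm (1 + F z)))" if "norm z < 1" for z
  proof -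
    have "exp (\<i> * Ln (1 + F z)) = of_real (exp (- Im (Ln (1 + F z)))) * cis (Re (Ln (1 + F z)))"
      by (subst exp_eq_polar) (simp add: exp_of_real)
    moreover have "Re (Ln (1 + F z)) = ln (norm (1 + F z))"
      using nz[OF that] by simp
    moreover have "exp (- pi - Im (Ln (1 + F z))) = exp (- pi) * exp (- Im (Ln (1 + F z)))"
      by (simp flip: exp_add)
    ultimately show ?thesis
      by (simp only: f_def of_real_mult mult.assoc)
  qed
  have Im_bd: "- pi < Im (Ln (1 + F z))" "Im (Ln (1 + F z)) < pi" if "norm z < 1" for z
  proof -
    show "- pi < Im (Ln (1 + F z))" by (rule mpi_less_Im_Ln[OF nz[OF that]])
    show "Im (Ln (1 + F z)) < pi"
      using Im_Ln_less_pi[of "1 + F z"] not_nonpos[OF that] by (simp add: complex_nonpos_Reals_iff)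
  qed
  have cont: "continuous_on (ball 0 1) F" by (rule holomorphic_on_imp_continuous_on[OF hol])
  show ?thesis
  proof
    show "f holomorphic_on ball 0 1"
      unfolding f_def using not_nonpos by (intro holomorphic_intros hol) auto
    show "norm (f z) \<le> 1" if "norm z < 1" for z
      unfolding polar[OF that] using Im_bd[OF that] by (simp add: norm_mult)
    show "radial_limit_exists f s" if s: "norm s = 1" "s \<notin> E" for s
    proof -
      obtain L where L: "((\<lambda>r. F (complex_of_real r * s)) \<longlongrightarrow> L) (at_left 1)"
        using lim[OF s] unfolding radial_limit_exists_def by blast
      have "0 \<le> Re L"
      proof (rule tendsto_lowerbound[OF tendsto_Re[OF L]])
        show "eventually (\<lambda>r. 0 \<le> Re (F (complex_of_real r * s))) (at_left 1)"
          using eventually_at_left_1 by eventually_elim (use s in \<open>auto intro!: pos simp: norm_mult\<close>)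
      qed simp
      then have "1 + L \<notin> \<real>\<^sub>\<le>\<^sub>0" by (simp add: complex_nonpos_Reals_iff)
      then have "((\<lambda>r. f (complex_of_real r * s)) \<longlongrightarrow> of_real (exp (- pi)) * exp (\<i> * Ln (1 + L))) (at_left 1)"
        unfolding f_def by (intro tendsto_intros L)
      then show ?thesis unfolding radial_limit_exists_def by blast
    qed
    show "E \<subseteq> osc_set f (exp (- 2 * pi))"
    proof
      fix s assume sE: "s \<in> E"
      have ns: "norm s = 1"
        using sets.sets_into_space[OF null_setsD2[OF E(2)]] sE by auto
      \<comment> \<open>This is the angle of \<open>f\<close> along the radius; it is continuous and
        unbounded near the end.\<close>
      define x where "x r = ln (norm (1 + F (complex_of_real r * s)))" for r
      have cF: "continuous_on {0..<1} (\<lambda>r. F (complex_of_real r * s))"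
        by (rule continuous_on_radius[OF cont ns])
      have nzr: "1 + F (complex_of_real r * s) \<noteq> 0" if "0 \<le> r" "r < 1" for r
        using that ns by (intro nz radial_in_ball)
      have cx: "continuous_on {0..<1} x"
        unfolding x_def using nzr by (intro continuous_intros cF) auto
      have large: "\<exists>r. \<rho> < r \<and> r < 1 \<and> C < x r" if "\<rho> < 1" for \<rho> C
      proof -
        have "eventually (\<lambda>r. exp C < Re (F (of_real r * s))) (at_left 1)"
          using top[OF sE] unfolding filterlim_at_top_dense by blast
        moreover have "eventually (\<lambda>r. \<rho> < r \<and> r < 1) (at_left 1)"
          using eventually_at_left_real[OF that] by (rule eventually_mono) auto
        ultimately have "eventually (\<lambda>r. \<rho> < r \<and> r < 1 \<and> exp C < Re (F (of_real r * s))) (at_left 1)"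
          by eventually_elim auto
        then have "\<exists>r. \<rho> < r \<and> r < 1 \<and> exp C < Re (F (of_real r * s))"
          by (rule eventually_happens'[OF trivial_limit_at_left_real])
        then obtain r where r: "\<rho> < r" "r < 1" "exp C < Re (F (of_real r * s))"
          by blast
        have "exp C < norm (1 + F (of_real r * s))"
          using r(3) complex_Re_le_cmod[of "1 + F (of_real r * s)"] by simp
        then have "C < x r"
          unfolding x_def by (metis exp_gt_zero less_trans ln_exp ln_less_cancel_iff)
        with r show ?thesis by blast
      qed
      have "\<exists>r r'. \<rho> < r \<and> r < 1 \<and> \<rho> < r' \<and> r' < 1 \<and>
          exp (- 2 * pi) < dist (f (of_real r * s)) (f (of_real r' * s))" if \<rho>: "\<rho> < 1" for \<rho>
      proof -
        obtain r0 where r0: "max \<rho> 0 < r0" "r0 < 1"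
          using \<rho> dense[of "max \<rho> 0" 1] by auto
        obtain k :: nat where k: "x r0 < 2 * pi * real k"
          using reals_Archimedean3[of "2 * pi"] by (auto simp: mult.commute)
        obtain r1 where r1: "r0 < r1" "r1 < 1" "2 * pi * real k + pi < x r1"
          using large[OF r0(2)] by blast
        have c01: "continuous_on {r0..r1} x"
          using cx by (rule continuous_on_subset) (use r0 r1 in auto)
        \<comment> \<open>The intermediate value theorem finds angles differing by \<pi>: there
          \<open>f\<close> takes a positive and a negative real value, whose distance is the sum of
          the two moduli.\<close>
        obtain r where r: "r0 \<le> r" "r \<le> r1" "x r = 2 * pi * real k"
          using IVT'[of x r0 "2 * pi * real k" r1] c01 k r1 pi_gt_zero by auto
        obtain r' where r': "r0 \<le> r'" "r' \<le> r1" "x r' = 2 * pi * real k + pi"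
          using IVT'[of x r0 "2 * pi * real k + pi" r1] c01 k r1 pi_gt_zero by auto
        have cis1: "cis (2 * pi * real k) = 1"
          using cis_multiple_2pi[of "real k"] by simp
        have cis2: "cis (2 * pi * real k + pi) = - 1"
          using cis1 by (simp flip: cis_mult)
        define y where "y q = exp (- pi - Im (Ln (1 + F (complex_of_real q * s))))" for q
        have in_ball: "norm (complex_of_real q * s) < 1" if "r0 \<le> q" "q \<le> r1" for q
          using that r0 r1 ns by (intro radial_in_ball) auto
        have y: "exp (- 2 * pi) < y q" if "r0 \<le> q" "q \<le> r1" for q
          using Im_bd(2)[OF in_ball[OF that]] by (simp add: y_def)
        have "f (of_real r * s) = of_real (y r)"
          using polar[OF in_ball[OF r(1,2)]] r(3) cis1 by (simp add: y_def x_def)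
        moreover have "f (of_real r' * s) = - of_real (y r')"
          using polar[OF in_ball[OF r'(1,2)]] r'(3) cis2 by (simp add: y_def x_def)
        ultimately have "dist (f (of_real r * s)) (f (of_real r' * s)) = norm (complex_of_real (y r + y r'))"
          by (simp add: dist_norm)
        also have "\<dots> = y r + y r'"
          by (simp only: norm_of_real) (simp add: y_def add_nonneg_nonneg)
        finally have "exp (- 2 * pi) < dist (f (of_real r * s)) (f (of_real r' * s))"
          using y[OF r(1,2)] y[OF r'(1,2)] exp_gt_zero[of "- 2 * pi"] by linarith
        moreover have "\<rho> < r" "r < 1" "\<rho> < r'" "r' < 1"
          using r r' r0 r1 by auto
        ultimately show ?thesis by blast
      qed
      then show "s \<in> osc_set f (exp (- 2 * pi))"
        unfolding osc_set_def using ns by simp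
    qed
  qed
qed

theorem Gdelta_sigma_null_no_limit:
  assumes E: "Gdelta_sigma_T E" "E \<in> null_sets circ"
  shows "\<exists>f\<in>Hinf. \<forall>z\<in>sphere 0 1. radial_limit_exists f z \<longleftrightarrow> z \<notin> E"
proof -
  from E(1)[unfolded Gdelta_sigma_T_def] obtain G :: "nat \<Rightarrow> complex set"
    where G': "(\<forall>n. Gdelta_T (G n)) \<and> E = (\<Union>n. G n)" by (rule exE)
  then have G: "\<And>n. Gdelta_T (G n)" "E = (\<Union>n. G n)"
    by simp_all
  have nullG: "G n \<in> null_sets circ" for n
    by (rule null_sets_subset[OF E(2) Gdelta_T_sets_circ[OF G(1)]]) (use G(2) in auto)
  define d where "d = exp (- 2 * pi)"
  have d: "0 < d" "d < 1" by (auto simp: d_def)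
  define P where "P n f \<longleftrightarrow> f holomorphic_on ball 0 1 \<and> (\<forall>z. norm z < 1 \<longrightarrow> norm (f z) \<le> 1) \<and>
    (\<forall>s. norm s = 1 \<longrightarrow> s \<notin> G n \<longrightarrow> radial_limit_exists f s) \<and> G n \<subseteq> osc_set f d" for n f
  have "\<exists>f. P n f" for n
  proof (rule Gdelta_null_no_limit[OF G(1)[of n] nullG[of n]])
    fix f
    assume *: "f holomorphic_on ball 0 1" "\<And>z. norm z < 1 \<Longrightarrow> norm (f z) \<le> 1"
      "\<And>s. norm s = 1 \<Longrightarrow> s \<notin> G n \<Longrightarrow> radial_limit_exists f s"
      "G n \<subseteq> osc_set f (exp (- 2 * pi))"
    show ?thesis
      unfolding P_def d_def by (intro exI[of _ f] conjI allI impI *)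
  qed
  then obtain f where Pf: "\<And>n. P n (f n)" by metis
  have f: "\<And>n. f n holomorphic_on ball 0 1" "\<And>n z. norm z < 1 \<Longrightarrow> norm (f n z) \<le> 1"
    "\<And>n s. norm s = 1 \<Longrightarrow> s \<notin> G n \<Longrightarrow> radial_limit_exists (f n) s" "\<And>n. G n \<subseteq> osc_set (f n) d"
    using Pf unfolding P_def by simp_all
  \<comment> \<open>The ratio makes the tail after index k at most c^k d / 7 (as 1 - c >= 7/8). The
    first k terms, subtracted from the sum, leave an oscillation of at most c^k d / 4, and 1/4 + 2/7
    = 15/28 < 1.\<close>
  define c where "c = d / 8"
  have c: "0 < c" "c < 1" using d by (auto simp: c_def)
  define h where "h n z = of_real (c ^ n) * f n z" for n z
  have h_le: "norm (h n z) \<le> c ^ n" if "norm z < 1" for n z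
    using f(2)[OF that, of n] c by (simp add: h_def norm_mult norm_power mult_left_le)
  have geo: "summable (\<lambda>n. c ^ n)" using c by (intro summable_geometric) auto
  have "norm (h n z) \<le> c ^ n / (1 - norm z)" if "norm z < 1" for n z
  proof -
    have "c ^ n * (1 - norm z) \<le> c ^ n"
      using c by (intro mult_left_le) auto
    then have "c ^ n \<le> c ^ n / (1 - norm z)"
      using that by (simp add: field_simps)
    with h_le[OF that, of n] show ?thesis by linarith
  qed
  then have h_bd: "\<forall>n z. norm z < 1 \<longrightarrow> norm (h n z) \<le> c ^ n / (1 - norm z)" by blast
  have h_hol: "h n holomorphic_on ball 0 1" for n
    unfolding h_def by (intro holomorphic_intros f)
  have h_sum: "summable (\<lambda>n. norm (h n z))" if "norm z < 1" for z
    by (rule summable_comparison_test'[OF geo, of 0]) (use h_le[OF that] in auto)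
  define F where "F z = (\<Sum>n. h n z)" for z
  have F_hol: "F holomorphic_on ball 0 1"
    unfolding F_def by (rule holomorphic_suminf(1)[OF h_hol h_bd geo])
  have "norm (F z) \<le> (\<Sum>n. c ^ n)" if "norm z < 1" for z
  proof -
    have "norm (F z) \<le> (\<Sum>n. norm (h n z))"
      unfolding F_def by (rule summable_norm[OF h_sum[OF that]])
    also have "\<dots> \<le> (\<Sum>n. c ^ n)"
      by (intro suminf_le h_le that h_sum geo)
    finally show ?thesis .
  qed
  then have "F \<in> Hinf"
    unfolding Hinf_def bounded_iff using F_hol by (auto intro!: exI[of _ "\<Sum>n. c ^ n"])
  moreover have "radial_limit_exists F s" if s: "norm s = 1" "s \<notin> E" for s
  proof -
    have rl: "radial_limit_exists (h n) s" for n
    proof -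
      have "s \<notin> G n" using s G(2) by auto
      from f(3)[OF s(1) this] show ?thesis
        unfolding radial_limit_exists_def h_def by (elim exE) (rule exI, erule tendsto_mult_left)
    qed
    have "norm (h n (of_real r * s)) \<le> c ^ n" if "0 \<le> r" "r < 1" for n r
      by (intro h_le radial_in_ball s that)
    from radial_limit_suminf[OF rl this geo] show ?thesis
      unfolding F_def .
  qed
  moreover have "\<not> radial_limit_exists F s" if "s \<in> E" for s
  proof
    assume F_lim: "radial_limit_exists F s"
    \<comment> \<open>By minimality all earlier terms have radial limits at \<open>s\<close>, so
      they can be subtracted from \<open>F\<close> without destroying its assumed limit.\<close>
    define k where "k = (LEAST k. s \<in> G k)"
    have "\<exists>k. s \<in> G k" using that G(2) by blast
    then have k: "s \<in> G k" "\<And>j. j < k \<Longrightarrow> s \<notin> G j"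
      unfolding k_def by (auto intro: LeastI_ex dest: not_less_Least)
    have s: "norm s = 1" using k(1) f(4)[of k] by (auto simp: osc_set_def)
    define A where "A z = F z - (\<Sum>j<k. h j z)" for z
    define T where "T z = (\<Sum>n. h (n + Suc k) z)" for z
    have A_eq: "A z = h k z + T z" if "norm z < 1" for z
      using suminf_split_initial_segment[OF summable_norm_cancel[OF h_sum[OF that]], of "Suc k"]
      by (simp add: A_def T_def F_def)
    have T_le: "norm (T z) \<le> c ^ k * (d / 7)" if "norm z < 1" for z
    proof -
      have sm: "summable (\<lambda>n. norm (h (n + Suc k) z))"
        using h_sum[OF that] by (subst summable_iff_shift)
      have "norm (T z) \<le> (\<Sum>n. norm (h (n + Suc k) z))"
        unfolding T_def by (rule summable_norm[OF sm])
      also have "\<dots> \<le> (\<Sum>n. c ^ Suc k * c ^ n)"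
      proof (intro suminf_le sm summable_mult geo)
        show "norm (h (n + Suc k) z) \<le> c ^ Suc k * c ^ n" for n
          using h_le[OF that, of "n + Suc k"] by (simp only: power_add mult.commute)
      qed
      also have "\<dots> = c ^ Suc k * (1 / (1 - c))"
        using c by (subst suminf_mult[OF geo]) (simp add: suminf_geometric)
      also have "\<dots> = c ^ k * (c / (1 - c))" by simp
      also have "\<dots> \<le> c ^ k * (d / 7)"
      proof (rule mult_left_mono)
        have "c / (1 - c) \<le> c / (7 / 8)"
          using c d by (intro divide_left_mono) (auto simp: c_def)
        then show "c / (1 - c) \<le> d / 7" by (simp add: c_def)
      qed (use c in auto)
      finally show ?thesis .
    qed
    obtain LF where LF: "((\<lambda>r. F (complex_of_real r * s)) \<longlongrightarrow> LF) (at_left 1)"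
      using F_lim unfolding radial_limit_exists_def by blast
    have "\<exists>L. ((\<lambda>r. h j (complex_of_real r * s)) \<longlongrightarrow> L) (at_left 1)" if "j < k" for j
      using f(3)[OF s k(2)[OF that]] unfolding radial_limit_exists_def h_def
      by (elim exE) (rule exI, erule tendsto_mult_left)
    then obtain L where L: "\<And>j. j < k \<Longrightarrow> ((\<lambda>r. h j (complex_of_real r * s)) \<longlongrightarrow> L j) (at_left 1)"
      by metis
    have "((\<lambda>r. A (complex_of_real r * s)) \<longlongrightarrow> LF - (\<Sum>j<k. L j)) (at_left 1)"
      unfolding A_def by (intro tendsto_diff LF tendsto_sum L) simp
    then have "\<exists>L. ((\<lambda>r. A (complex_of_real r * s)) \<longlongrightarrow> L) (at_left 1)" ..
    moreover have "0 < c ^ k * (d / 4)" using c d by simp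
    ultimately obtain \<rho> where \<rho>: "\<rho> < 1" "\<And>r r'. \<rho> < r \<Longrightarrow> r < 1 \<Longrightarrow> \<rho> < r' \<Longrightarrow> r' < 1 \<Longrightarrow>
        dist (A (complex_of_real r * s)) (A (complex_of_real r' * s)) \<le> c ^ k * (d / 4)"
      unfolding Cauchy_at_left_iff by blast
    have "max \<rho> 0 < 1" using \<rho> by simp
    then obtain r r' where r: "max \<rho> 0 < r" "r < 1" "max \<rho> 0 < r'" "r' < 1"
        "d < dist (f k (of_real r * s)) (f k (of_real r' * s))"
      using k(1) f(4)[of k] unfolding osc_set_def by blast
    have nr: "norm (complex_of_real r * s) < 1" "norm (complex_of_real r' * s) < 1"
      using r s by (auto intro!: radial_in_ball)
    have "c ^ k * d < c ^ k * dist (f k (of_real r * s)) (f k (of_real r' * s))"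
      using r(5) c by simp
    also have "\<dots> = dist (h k (of_real r * s)) (h k (of_real r' * s))"
    proof -
      have "h k (of_real r * s) - h k (of_real r' * s) = of_real (c ^ k) * (f k (of_real r * s) - f k (of_real r' * s))"
        by (simp add: h_def algebra_simps)
      then show ?thesis
        using c by (simp only: dist_norm norm_mult norm_of_real) simp
    qed
    also have "\<dots> \<le> dist (A (of_real r * s)) (A (of_real r' * s)) + norm (T (of_real r * s)) + norm (T (of_real r' * s))"
    proof -
      have eq: "h k (of_real r * s) - h k (of_real r' * s)
         = (A (of_real r * s) - A (of_real r' * s)) - (T (of_real r * s) - T (of_real r' * s))"
        using A_eq[OF nr(1)] A_eq[OF nr(2)] by simp
      show ?thesis
        unfolding dist_norm eq
        using norm_triangle_ineq4[of "A (of_real r * s) - A (of_real r' * s)" "T (of_real r * s) - T (of_real r' * s)"]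
          norm_triangle_ineq4[of "T (of_real r * s)" "T (of_real r' * s)"] by linarith
    qed
    also have "\<dots> \<le> c ^ k * (d / 4) + c ^ k * (d / 7) + c ^ k * (d / 7)"
      using r by (intro add_mono \<rho>(2) T_le nr) auto
    also have "\<dots> = c ^ k * (15 / 28 * d)" by (simp add: algebra_simps)
    finally have "c ^ k * d < c ^ k * (15 / 28 * d)" .
    then show False using c d by simp
  qed
  ultimately show ?thesis
    by (intro bexI[of _ F]) auto
qed

theorem mainTheorem5:
  fixes E :: "complex set"
  assumes "E \<subseteq> sphere 0 1"
  shows "(\<exists>f \<in> Hinf. \<forall>z \<in> sphere 0 1. radial_limit_exists f z \<longleftrightarrow> z \<notin> E)
         \<longleftrightarrow> Gdelta_sigma_T E \<and> arc_null E"
proof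
  assume "\<exists>f \<in> Hinf. \<forall>z \<in> sphere 0 1. radial_limit_exists f z \<longleftrightarrow> z \<notin> E"
  then show "Gdelta_sigma_T E \<and> arc_null E"
    using no_radial_limit_set[OF _ assms] by (elim bexE)
next
  assume E: "Gdelta_sigma_T E \<and> arc_null E"
  then have "E \<in> null_sets circ"
    using arc_null_iff[OF Gdelta_sigma_T_sets_circ] by blast
  with E show "\<exists>f \<in> Hinf. \<forall>z \<in> sphere 0 1. radial_limit_exists f z \<longleftrightarrow> z \<notin> E"
    by (intro Gdelta_sigma_null_no_limit) auto
qed

end
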